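(* Let $q\in\Bbbk$ be a root of unity of multiplicative order $d\ge 2$, and let $\mathcal{D}_q$ be the tensor category of finite dimensional right $\Bbbk\mathcal{A}(q)$-comodules. Then the Green ring $\mathcal{GR}(\mathcal{D}_q)$ is isomorphic to $\mathbb{Z}[x,x^{-1},y,z]/J$, where $J$ is the ideal of $\mathbb{Z}[x,x^{-1},y,z]$ generated by $$(y-x-1)\Big[\sum_{i=0}^{[\frac{d-1}{2}]}(-1)^i\binom{d-1-i}{i}x^iy^{d-1-2i}\Big].$$
   Context: $\Bbbk$ is an algebraically closed field of characteristic $0$; $[a]$ denotes the integer part of $a$ for a rational number $a$. For $q\in\Bbbk$ and integers $l,m\ge 0$ put $l_q=1+q+\cdots+q^{l-1}$, $l!_q=1_q\cdots l_q$, and let $\binom{l+m}{l}_q=\frac{(l+m)!_q}{l!_q\,m!_q}$ be the Gaussian binomial coefficient (a polynomial in $q$, evaluated at $q$). For $0\ne q\in\Bbbk$, $\Bbbk\mathcal{A}(q)$ is the Hopf algebra with $\Bbbk$-basis $\{p_i^l\mid i\in\mathbb{Z},\ l\ge 0\}$ ($p_i^l$ is the path of length $l$ starting at vertex $i$ of the infinite linear quiver, with vertex set $\mathbb{Z}$ and one arrow $i\to i+1$ for each $i$), comultiplication $\Delta(p_i^l)=\sum_{j=0}^{l}p_{i+j}^{l-j}\otimes p_i^{j}$, counit $\varepsilon(p_i^l)=\delta_{l,0}$, multiplication $p_i^l\cdot p_j^m=q^{im}\binom{l+m}{l}_q\,p_{i+j}^{l+m}$, and unit $p_0^0$. $\mathcal{D}_q$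 is the tensor category of finite dimensional right $\Bbbk\mathcal{A}(q)$-comodules, where the comodule structure of $U\otimes V$ is $u\otimes v\mapsto u_0\otimes v_0\otimes u_1v_1$ (Sweedler notation). The Green ring $\mathcal{GR}(\mathcal{C})$ of a tensor category $\mathcal{C}$ is the abelian group generated by the isomorphism classes $[X]$ of objects of $\mathcal{C}$ modulo all split short exact sequences (i.e. $[X\oplus Y]=[X]+[Y]$), with multiplication $[X]\cdot[Y]=[X\otimes Y]$. *)

theory Defs
  imports
    "HOL-Algebra.Free_Abelian_Groups"
    "HOL-Algebra.Algebraic_Closure_Type"
    "HOL-Library.Product_Plus"
    "HOL-Computational_Algebra.Computational_Algebra"
begin

section \<open>Linear algebra on free vector spaces\<close>

text \<open>
  The vector space with basis \<open>B\<close> is modelled by the finitely supported functions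
  \<^typ>\<open>'b \<Rightarrow>\<^sub>0 'k\<close> with support in \<open>B\<close>.  Accordingly, the tensor product of the spaces with
  bases \<open>A\<close> and \<open>B\<close> is the space with basis \<open>A \<times> B\<close>.
\<close>

definition vspace :: "'b set \<Rightarrow> ('b \<Rightarrow>\<^sub>0 'k::field) set"
  where "vspace B = {v. Poly_Mapping.keys v \<subseteq> B}"

definition basis_vec :: "'b \<Rightarrow> ('b \<Rightarrow>\<^sub>0 'k::field)"
  where "basis_vec b = Poly_Mapping.single b 1"

definition vscale :: "'k::field \<Rightarrow> ('b \<Rightarrow>\<^sub>0 'k) \<Rightarrow> ('b \<Rightarrow>\<^sub>0 'k)"
  where "vscale c v = Poly_Mapping.map ((*) c) v"

definition linear_from :: "'b set \<Rightarrow> (('b \<Rightarrow>\<^sub>0 'k::field) \<Rightarrow> ('c \<Rightarrow>\<^sub>0 'k)) \<Rightarrow> bool"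
  where "linear_from B f \<longleftrightarrow>
    (\<forall>u \<in> vspace B. \<forall>v \<in> vspace B. f (u + v) = f u + f v) \<and>
    (\<forall>c. \<forall>v \<in> vspace B. f (vscale c v) = vscale c (f v))"

text \<open>The linear map with prescribed values on basis vectors.\<close>

definition lin_ext :: "('b \<Rightarrow> ('c \<Rightarrow>\<^sub>0 'k::field)) \<Rightarrow> ('b \<Rightarrow>\<^sub>0 'k) \<Rightarrow> ('c \<Rightarrow>\<^sub>0 'k)"
  where "lin_ext g v = (\<Sum>b \<in> Poly_Mapping.keys v. vscale (Poly_Mapping.lookup v b) (g b))"

definition vtensor :: "('b \<Rightarrow>\<^sub>0 'k::field) \<Rightarrow> ('c \<Rightarrow>\<^sub>0 'k) \<Rightarrow> ('b \<times> 'c \<Rightarrow>\<^sub>0 'k)"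
  where "vtensor u v =
    lin_ext (\<lambda>b. lin_ext (\<lambda>c. basis_vec (b, c)) v) u"

text \<open>The map \<open>f \<otimes> g\<close>, for linear \<open>f\<close> and \<open>g\<close>.\<close>

definition map_tensor ::
  "(('a \<Rightarrow>\<^sub>0 'k::field) \<Rightarrow> ('c \<Rightarrow>\<^sub>0 'k)) \<Rightarrow> (('b \<Rightarrow>\<^sub>0 'k) \<Rightarrow> ('d \<Rightarrow>\<^sub>0 'k)) \<Rightarrow>
   ('a \<times> 'b \<Rightarrow>\<^sub>0 'k) \<Rightarrow> ('c \<times> 'd \<Rightarrow>\<^sub>0 'k)"
  where "map_tensor f g =
    lin_ext (\<lambda>(a, b). vtensor (f (basis_vec a)) (g (basis_vec b)))"


section \<open>The Hopf algebra of the infinite linear quiver\<close>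

text \<open>The pair \<open>(i, l)\<close> is the path \<open>p\<^sub>i\<^sup>l\<close> of length \<open>l\<close> starting at the vertex \<open>i\<close>.\<close>

type_synonym path = "int \<times> nat"

text \<open>
  The polynomials \<open>l\<^sub>q\<close>, \<open>l!\<^sub>q\<close> and the Gaussian binomial coefficient \<open>(l + m choose l)\<^sub>q\<close> in the
  indeterminate \<open>q\<close>.  The division in \<open>gauss_binom_poly\<close> is exact; it has to be carried out
  before evaluation, as \<open>l!\<^sub>q\<close> may vanish at a root of unity.
\<close>

definition q_int_poly :: "nat \<Rightarrow> 'k::field poly"
  where "q_int_poly l = (\<Sum>i<l. [:0, 1:] ^ i)"

definition q_fact_poly :: "nat \<Rightarrow> 'k::field poly"
  where "q_fact_poly l = (\<Prod>i=1..l. q_int_poly i)"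

definition gauss_binom_poly :: "nat \<Rightarrow> nat \<Rightarrow> 'k::field poly"
  where "gauss_binom_poly l m = q_fact_poly (l + m) div (q_fact_poly l * q_fact_poly m)"

definition gauss_binom :: "'k::field \<Rightarrow> nat \<Rightarrow> nat \<Rightarrow> 'k"
  where "gauss_binom q l m = Polynomial.poly (gauss_binom_poly l m) q"

definition A_comult :: "(path \<Rightarrow>\<^sub>0 'k::field) \<Rightarrow> (path \<times> path \<Rightarrow>\<^sub>0 'k)"
  where "A_comult = lin_ext (\<lambda>(i, l).
    \<Sum>j\<le>l. vtensor (basis_vec (i + int j, l - j)) (basis_vec (i, j)))"

definition A_counit :: "(path \<Rightarrow>\<^sub>0 'k::field) \<Rightarrow> 'k"
  where "A_counit x =
    (\<Sum>(i, l) \<in> Poly_Mapping.keys x. Poly_Mapping.lookup x (i, l) * (if l = 0 then 1 else 0))"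

text \<open>The multiplication, as a linear map on the tensor square.\<close>

definition A_mult :: "'k::field \<Rightarrow> (path \<times> path \<Rightarrow>\<^sub>0 'k) \<Rightarrow> (path \<Rightarrow>\<^sub>0 'k)"
  where "A_mult q = lin_ext (\<lambda>((i, l), (j, m)).
    vscale (q powi (i * int m) * gauss_binom q l m) (basis_vec (i + j, l + m)))"

definition A_unit :: "path \<Rightarrow>\<^sub>0 'k::field"
  where "A_unit = basis_vec (0, 0)"


section \<open>Finite-dimensional right comodules\<close>

text \<open>
  A comodule consists of a finite set \<open>B\<close> of basis labels and a coaction
  \<open>\<rho> : V \<rightarrow> V \<otimes> A\<close> on the vector space \<open>V\<close> with basis \<open>B\<close>.  The values of the coaction
  outside \<open>V\<close> are irrelevant.
\<close>

type_synonym ('b, 'k) comod = "'b set \<times> (('b \<Rightarrow>\<^sub>0 'k) \<Rightarrow> ('b \<times> path \<Rightarrow>\<^sub>0 'k))"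

abbreviation (input) cm_basis :: "('b, 'k::field) comod \<Rightarrow> 'b set"
  where "cm_basis \<equiv> fst"

abbreviation (input) coact :: "('b, 'k::field) comod \<Rightarrow> ('b \<Rightarrow>\<^sub>0 'k) \<Rightarrow> ('b \<times> path \<Rightarrow>\<^sub>0 'k)"
  where "coact \<equiv> snd"

text \<open>The last two conditions are
  \<open>(\<rho> \<otimes> id) \<circ> \<rho> = (id \<otimes> \<Delta>) \<circ> \<rho>\<close>, up to the associativity isomorphism
  \<open>V \<otimes> (A \<otimes> A) \<cong> (V \<otimes> A) \<otimes> A\<close>, and \<open>(id \<otimes> \<epsilon>) \<circ> \<rho> = id\<close>, up to \<open>V \<otimes> k \<cong> V\<close>.\<close>

definition fd_comodule :: "('b, 'k::field) comod \<Rightarrow> bool"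
  where "fd_comodule M \<longleftrightarrow>
    finite (cm_basis M) \<and>
    linear_from (cm_basis M) (coact M) \<and>
    coact M ` vspace (cm_basis M) \<subseteq> vspace (cm_basis M \<times> UNIV) \<and>
    (\<forall>v \<in> vspace (cm_basis M).
      map_tensor (coact M) id (coact M v) =
      lin_ext (\<lambda>(b, (x, y)). basis_vec ((b, x), y)) (map_tensor id A_comult (coact M v))) \<and>
    (\<forall>v \<in> vspace (cm_basis M).
      lin_ext (\<lambda>(b, x). vscale (A_counit (basis_vec x)) (basis_vec b)) (coact M v) = v)"

definition comodule_hom ::
  "('b, 'k::field) comod \<Rightarrow> ('c, 'k) comod \<Rightarrow> (('b \<Rightarrow>\<^sub>0 'k) \<Rightarrow> ('c \<Rightarrow>\<^sub>0 'k)) \<Rightarrow> bool"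
  where "comodule_hom M N f \<longleftrightarrow>
    linear_from (cm_basis M) f \<and>
    f ` vspace (cm_basis M) \<subseteq> vspace (cm_basis N) \<and>
    (\<forall>v \<in> vspace (cm_basis M). coact N (f v) = map_tensor f id (coact M v))"

definition comodule_iso :: "('b, 'k::field) comod \<Rightarrow> ('c, 'k) comod \<Rightarrow> bool"
  where "comodule_iso M N \<longleftrightarrow>
    (\<exists>f. comodule_hom M N f \<and> bij_betw f (vspace (cm_basis M)) (vspace (cm_basis N)))"

definition comodule_sum ::
  "('b, 'k::field) comod \<Rightarrow> ('c, 'k) comod \<Rightarrow> ('b + 'c, 'k) comod"
  where "comodule_sum M N =
    (cm_basis M <+> cm_basis N,
     lin_ext (\<lambda>s. case s of
        Inl b \<Rightarrow> lin_ext (\<lambda>(b', x). basis_vec (Inl b', x)) (coact M (basis_vec b))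
      | Inr c \<Rightarrow> lin_ext (\<lambda>(c', x). basis_vec (Inr c', x)) (coact N (basis_vec c))))"

text \<open>The coaction \<open>u \<otimes> v \<mapsto> u\<^sub>0 \<otimes> v\<^sub>0 \<otimes> u\<^sub>1 v\<^sub>1\<close>.\<close>

definition comodule_tensor ::
  "'k::field \<Rightarrow> ('b, 'k) comod \<Rightarrow> ('c, 'k) comod \<Rightarrow> ('b \<times> 'c, 'k) comod"
  where "comodule_tensor q M N =
    (cm_basis M \<times> cm_basis N,
     \<lambda>w. lin_ext (\<lambda>((b, x), (c, y)). vtensor (basis_vec (b, c)) (A_mult q (basis_vec (x, y))))
          (map_tensor (coact M) (coact N) w))"

definition comodule_unit :: "(unit, 'k::field) comod"
  where "comodule_unit = (UNIV, \<lambda>v. vtensor v A_unit)"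


section \<open>The Green ring\<close>

text \<open>
  Every finite-dimensional comodule is isomorphic to one with basis labels in \<^typ>\<open>nat\<close>, so the
  isomorphism class of a comodule (with labels of any type) is represented by the set of its
  isomorphic copies with labels in \<^typ>\<open>nat\<close>.
\<close>

definition iso_class :: "('b, 'k::field) comod \<Rightarrow> (nat, 'k) comod set"
  where "iso_class M = {N. fd_comodule N \<and> comodule_iso N M}"

definition iso_classes :: "(nat, 'k::field) comod set set"
  where "iso_classes = iso_class ` {M :: (nat, 'k) comod. fd_comodule M}"

definition class_tensor ::
  "'k::field \<Rightarrow> (nat, 'k) comod set \<Rightarrow> (nat, 'k) comod set \<Rightarrow> (nat, 'k) comod set"
  where "class_tensor q C D = (\<Union>M \<in> C. \<Union>N \<in> D. iso_class (comodule_tensor q M N))"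

text \<open>The free abelian group on the isomorphism classes, with the biadditive extension of
  \<open>[M] \<cdot> [N] = [M \<otimes> N]\<close>.\<close>

definition pre_green_ring :: "'k::field \<Rightarrow> ((nat, 'k) comod set \<Rightarrow>\<^sub>0 int) ring"
  where "pre_green_ring q =
    \<lparr>carrier = carrier (free_Abelian_group iso_classes),
     monoid.mult = (\<lambda>a b. frag_extend (\<lambda>C. frag_extend (\<lambda>D. frag_of (class_tensor q C D)) b) a),
     one = frag_of (iso_class (comodule_unit :: (unit, 'k) comod)),
     ring.zero = 0,
     add = (+)\<rparr>"

definition split_relations :: "((nat, 'k::field) comod set \<Rightarrow>\<^sub>0 int) set"
  where "split_relations = generate (free_Abelian_group iso_classes)
    {frag_of (iso_class (comodule_sum M N)) - frag_of (iso_class M) - frag_of (iso_class N) |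
       (M :: (nat, 'k) comod) (N :: (nat, 'k) comod). fd_comodule M \<and> fd_comodule N}"

text \<open>The subgroup of relations is an ideal, since \<open>\<otimes>\<close> is biadditive, so the coset ring below is the
  quotient group with the induced multiplication.\<close>

definition green_ring :: "'k::field \<Rightarrow> ((nat, 'k) comod set \<Rightarrow>\<^sub>0 int) set ring"
  where "green_ring q = pre_green_ring q Quot split_relations"


section \<open>The ring \<open>\<int>[x, x\<^sup>-\<^sup>1, y, z]\<close>\<close>

text \<open>This is the monoid ring over \<open>\<int>\<close> of \<open>\<int> \<times> \<nat> \<times> \<nat>\<close>: the triple \<open>(a, b, c)\<close> stands for the
  monomial \<open>x\<^sup>a y\<^sup>b z\<^sup>c\<close>.\<close>

type_synonym laurent_xyz = "(int \<times> nat \<times> nat) \<Rightarrow>\<^sub>0 int"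

definition var_x :: laurent_xyz where "var_x = Poly_Mapping.single (1, 0, 0) 1"
definition var_y :: laurent_xyz where "var_y = Poly_Mapping.single (0, 1, 0) 1"

definition laurent_ring :: "laurent_xyz ring"
  where "laurent_ring = ring_of_type_algebra"

definition green_relation :: "nat \<Rightarrow> laurent_xyz"
  where "green_relation d =
    (var_y - var_x - 1) *
    (\<Sum>i=0..(d - 1) div 2.
      (-1) ^ i * of_nat ((d - 1 - i) choose i) * var_x ^ i * var_y ^ (d - 1 - 2 * i))"

definition green_ideal :: "nat \<Rightarrow> laurent_xyz set"
  where "green_ideal d = Idl\<^bsub>laurent_ring\<^esub> {green_relation d}"

end

theory Submission
  imports Defs
begin

text \<open>
  A finite-dimensional comodule is a representation of the quiver: the path \<open>p\<close> acts on it by a matrix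
  \<open>D p\<close>.  Every comodule is a direct sum of intervals (the interval \<open>(i, l)\<close> has one basis vector in each
  of the weights \<open>i, \<dots>, i + l\<close>), and the multiplicity of \<open>(i, l)\<close> is an alternating sum of ranks of
  four of the matrices \<open>D p\<close>.  So the Green ring is free over \<open>\<int>\<close> on the intervals, and identities in it are
  identities between ranks.  Let \<open>x\<close>, \<open>y\<close>, \<open>z\<close> be the classes of \<open>(1, 0)\<close>, \<open>(0, 1)\<close>, \<open>(0, d)\<close>.  The product
  of \<open>y\<close> and \<open>(0, m)\<close> is \<open>(0, m + 1) + (1, m - 1)\<close> if \<open>1 + q + \<dots> + q\<^sup>m \<noteq> 0\<close> and \<open>(0, m) + (1, m)\<close> otherwise,
  which makes the Chebyshev-like sum in the relation the class of \<open>(0, d - 1)\<close>, killed by \<open>y - x - 1\<close>.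
  Since \<open>1 + q + \<dots> + q\<^sup>b\<close> vanishes only if \<open>d\<close> divides \<open>b + 1\<close>, and the Gaussian binomial coefficient
  \<open>(dc + d choose d)\<close> equals \<open>c + 1 \<noteq> 0\<close>, the monomial \<open>x\<^sup>a y\<^sup>b z\<^sup>c\<close> with \<open>b < d\<close> is \<open>(a, b + dc)\<close> plus shorter intervals.  As the
  relation is monic of degree \<open>d\<close> in \<open>y\<close>, these monomials form a basis of both rings.
\<close>

text \<open>The map from the Laurent ring is therefore built from left multiplications: it needs
  only associativity and the commutation of the three generators, and the latter holds because both
  orders of each product have the same ranks. Ranks also take over the role of the Krull-Schmidt
  theorem. They are obtained as traces, hence as elements of the field, and characteristic 0 turns
  them back into integers. The variable \<open>z\<close> is forced by the rule for products with
  \<open>y\<close>: at \<open>m = d - 1\<close> such a product contains no interval longer than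
  \<open>m\<close>, so \<open>x\<close> and \<open>y\<close> generate nothing of length
  \<open>d\<close> or more, and the same block recurs at every length congruent to
  \<open>d - 1\<close> modulo \<open>d\<close>. Both rings are compared with an intermediate ring on
  the free abelian group over the intervals, so that the split relations are dealt with only once,
  as the kernel of a map to that group.\<close>

abbreviation (input) "lookup \<equiv> Poly_Mapping.lookup"
abbreviation (input) "keys \<equiv> Poly_Mapping.keys"

section \<open>Matrices indexed by finite sets\<close>

definition mmult :: "'b set \<Rightarrow> ('a \<Rightarrow> 'b \<Rightarrow> 'k::comm_ring_1) \<Rightarrow> ('b \<Rightarrow> 'c \<Rightarrow> 'k) \<Rightarrow> 'a \<Rightarrow> 'c \<Rightarrow> 'k"
  where "mmult B P Q = (\<lambda>a c. \<Sum>b\<in>B. P a b * Q b c)"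

definition idmat :: "'b set \<Rightarrow> 'b \<Rightarrow> 'b \<Rightarrow> 'k::comm_ring_1"
  where "idmat B = (\<lambda>a b. if a = b \<and> a \<in> B then 1 else 0)"

definition mtrace :: "'b set \<Rightarrow> ('b \<Rightarrow> 'b \<Rightarrow> 'k::comm_ring_1) \<Rightarrow> 'k"
  where "mtrace B P = (\<Sum>b\<in>B. P b b)"

text \<open>Matrices are total functions on the label types. Demanding zero entries outside the
  index sets turns equality of matrices into equality of functions.\<close>

definition msupp :: "'a set \<Rightarrow> 'b set \<Rightarrow> ('a \<Rightarrow> 'b \<Rightarrow> 'k::comm_ring_1) \<Rightarrow> bool"
  where "msupp A B P \<longleftrightarrow> (\<forall>a b. P a b \<noteq> 0 \<longrightarrow> a \<in> A \<and> b \<in> B)"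

lemma msuppI: "(\<And>a b. P a b \<noteq> 0 \<Longrightarrow> a \<in> A \<and> b \<in> B) \<Longrightarrow> msupp A B P"
  unfolding msupp_def by blast

lemma msuppD: "msupp A B P \<Longrightarrow> a \<notin> A \<or> b \<notin> B \<Longrightarrow> P a b = 0"
  unfolding msupp_def by blast

lemma mmult_assoc: "mmult C (mmult B P Q) W = mmult B P (mmult C Q W)"
  unfolding mmult_def sum_distrib_left sum_distrib_right
  by (subst sum.swap) (simp add: mult.assoc)

lemma msupp_mmult:
  assumes "msupp A B P" "msupp C D Q"
  shows "msupp A D (mmult S P Q)"
proof (rule msuppI)
  fix a d assume "mmult S P Q a d \<noteq> 0"
  then obtain b where "P a b * Q b d \<noteq> 0"
    unfolding mmult_def by (meson sum.neutral)
  then have "P a b \<noteq> 0" "Q b d \<noteq> 0" by auto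
  then show "a \<in> A \<and> d \<in> D" using assms unfolding msupp_def by blast
qed

lemma msupp_idmat: "msupp B B (idmat B)"
  by (rule msuppI) (auto simp: idmat_def split: if_splits)

lemma msupp_zero: "msupp A B (\<lambda>_ _. 0)"
  by (rule msuppI) simp

lemma mmult_idmat_left:
  assumes "finite B" "msupp B C P" shows "mmult B (idmat B) P = P"
proof (intro ext)
  fix a c
  have "(\<Sum>b\<in>B. idmat B a b * P b c) = (\<Sum>b\<in>B. if a = b then P a c else 0)"
    by (rule sum.cong) (auto simp: idmat_def)
  then show "mmult B (idmat B) P a c = P a c"
    using assms by (auto simp: mmult_def dest: msuppD)
qed

lemma mmult_idmat_right:
  assumes "finite B" "msupp A B P" shows "mmult B P (idmat B) = P"
proof (intro ext)
  fix a c
  have "(\<Sum>b\<in>B. P a b * idmat B b c) = (\<Sum>b\<in>B. if c = b then P a c else 0)"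
    by (rule sum.cong) (auto simp: idmat_def)
  then show "mmult B P (idmat B) a c = P a c"
    using assms by (auto simp: mmult_def dest: msuppD)
qed

lemma mmult_zero_left [simp]: "mmult B (\<lambda>_ _. 0) P = (\<lambda>_ _. 0)"
  by (simp add: mmult_def)

lemma mmult_zero_right [simp]: "mmult B P (\<lambda>_ _. 0) = (\<lambda>_ _. 0)"
  by (simp add: mmult_def)

lemma mmult_diff_left: "mmult B (\<lambda>a b. P a b - Q a b) W = (\<lambda>a b. mmult B P W a b - mmult B Q W a b)"
  by (simp add: mmult_def algebra_simps sum_subtractf)

lemma mmult_diff_right: "mmult B W (\<lambda>a b. P a b - Q a b) = (\<lambda>a b. mmult B W P a b - mmult B W Q a b)"
  by (simp add: mmult_def algebra_simps sum_subtractf)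

lemma mmult_sum_left: "mmult B (\<lambda>a b. \<Sum>i\<in>I. P i a b) W = (\<lambda>a b. \<Sum>i\<in>I. mmult B (P i) W a b)"
  unfolding mmult_def sum_distrib_right by (subst sum.swap) simp

lemma mmult_sum_right: "mmult B W (\<lambda>a b. \<Sum>i\<in>I. P i a b) = (\<lambda>a b. \<Sum>i\<in>I. mmult B W (P i) a b)"
  unfolding mmult_def sum_distrib_left by (subst sum.swap) simp

lemma mtrace_mmult_commute: "mtrace A (mmult B P Q) = mtrace B (mmult A Q P)"
  unfolding mtrace_def mmult_def by (subst sum.swap) (simp add: mult.commute)

lemma mtrace_diff: "mtrace B (\<lambda>a b. P a b - Q a b) = mtrace B P - mtrace B Q"
  by (simp add: mtrace_def sum_subtractf)

lemma mtrace_idmat: "mtrace B (idmat B) = of_nat (card B)"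
  by (simp add: mtrace_def idmat_def)

text \<open>A column times a row through a nonzero entry gives an idempotent of trace 1 absorbed by
  \<open>e\<close>; removing it empties a row. Iteration counts the rank, so the trace is the image
  of a natural number.\<close>

lemma idempotent_trace_nat:
  fixes e :: "'b \<Rightarrow> 'b \<Rightarrow> 'k::field"
  assumes "finite B" "msupp B B e" "mmult B e e = e"
  shows "\<exists>r. mtrace B e = of_nat r"
  using assms(2,3)
proof (induction "card {a. \<exists>b. e a b \<noteq> 0}" arbitrary: e rule: less_induct)
  case less
  show ?case
  proof (cases "\<forall>a b. e a b = 0")
    case True
    then have "mtrace B e = of_nat 0" by (simp add: mtrace_def)
    then show ?thesis ..
  next
    case False
    then obtain r c where rc: "e r c \<noteq> 0" by auto
    have rB: "r \<in> B" "c \<in> B" using rc less.prems(1) by (auto simp: msupp_def)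
    \<comment> \<open>The division by the pivot makes \<open>f\<close> idempotent of trace 1. It
      agrees with \<open>e\<close> on row \<open>r\<close>, hence \<open>e - f\<close> has that row
      zero.\<close>
    define f where "f = (\<lambda>a b. e a c * e r b / e r c)"
    have ee: "(\<Sum>b\<in>B. e a b * e b d) = e a d" for a d
      using fun_cong[OF fun_cong[OF less.prems(2)]] by (simp add: mmult_def)
    have ef: "mmult B e f = f"
    proof (intro ext)
      fix a d
      have "mmult B e f a d = (\<Sum>b\<in>B. e a b * e b c) * e r d / e r c"
        unfolding mmult_def f_def sum_distrib_right sum_divide_distrib by (simp add: mult.assoc)
      then show "mmult B e f a d = f a d" by (simp add: ee f_def)
    qed
    have fe: "mmult B f e = f"
    proof (intro ext)
      fix a d
      have "mmult B f e a d = e a c * (\<Sum>b\<in>B. e r b * e b d) / e r c"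
        unfolding mmult_def f_def sum_distrib_left sum_divide_distrib by (simp add: mult.assoc)
      then show "mmult B f e a d = f a d" by (simp add: ee f_def)
    qed
    have ff: "mmult B f f = f"
    proof (intro ext)
      fix a d
      have "mmult B f f a d = e a c * (\<Sum>b\<in>B. e r b * e b c) * e r d / (e r c * e r c)"
        unfolding mmult_def f_def sum_distrib_left sum_distrib_right sum_divide_distrib
        by (simp add: mult_ac)
      then show "mmult B f f a d = f a d" using rc by (simp add: ee f_def)
    qed
    have trf: "mtrace B f = 1"
    proof -
      have "mtrace B f = (\<Sum>b\<in>B. e r b * e b c) / e r c"
        unfolding mtrace_def f_def sum_divide_distrib by (simp add: mult.commute)
      then show ?thesis using rc by (simp add: ee)
    qed
    define e' where "e' = (\<lambda>a b. e a b - f a b)"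
    have "mmult B e' e' = e'"
      unfolding e'_def mmult_diff_left mmult_diff_right by (simp add: ef fe ff less.prems(2))
    moreover have "msupp B B e'"
    proof (rule msuppI, rule ccontr)
      fix a b assume "e' a b \<noteq> 0" "\<not> (a \<in> B \<and> b \<in> B)"
      then show False
        using msuppD[OF less.prems(1), of a b] msuppD[OF less.prems(1), of a c]
          msuppD[OF less.prems(1), of r b] by (auto simp: e'_def f_def)
    qed
    moreover have "card {a. \<exists>b. e' a b \<noteq> 0} < card {a. \<exists>b. e a b \<noteq> 0}"
    proof (rule psubset_card_mono)
      have "{a. \<exists>b. e a b \<noteq> 0} \<subseteq> B" using less.prems(1) by (auto simp: msupp_def)
      then show "finite {a. \<exists>b. e a b \<noteq> 0}" using assms(1) finite_subset by blast
      have "{a. \<exists>b. e' a b \<noteq> 0} \<subseteq> {a. \<exists>b. e a b \<noteq> 0}"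
        by (auto simp: e'_def f_def) (metis div_0 mult_zero_left)
      moreover have "r \<notin> {a. \<exists>b. e' a b \<noteq> 0}" using rc by (auto simp: e'_def f_def)
      ultimately show "{a. \<exists>b. e' a b \<noteq> 0} \<subset> {a. \<exists>b. e a b \<noteq> 0}" using rc by blast
    qed
    ultimately obtain n where "mtrace B e' = of_nat n" using less.hyps by blast
    then have "mtrace B e = of_nat (Suc n)"
      using trf by (simp add: e'_def mtrace_diff algebra_simps)
    then show ?thesis ..
  qed
qed

text \<open>Any generalized inverse computes the rank as a trace, so ranks can be compared without bases.\<close>

definition has_rank :: "'b set \<Rightarrow> ('b \<Rightarrow> 'b \<Rightarrow> 'k::comm_ring_1) \<Rightarrow> 'k \<Rightarrow> bool"
  where "has_rank B D t \<longleftrightarrow> (\<exists>G. mmult B (mmult B D G) D = D \<and> mtrace B (mmult B D G) = t)"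

text \<open>\<open>D G\<close> and \<open>D H\<close> project onto the same column space, so each
  fixes the other from the left: \<open>D H D G = D G\<close> and \<open>D G D H = D H\<close>. The
  traces of these two products agree.\<close>

lemma has_rank_unique:
  assumes "has_rank B D s" "has_rank B D t" shows "s = t"
proof -
  obtain G H where G: "mmult B (mmult B D G) D = D" "mtrace B (mmult B D G) = s"
    and H: "mmult B (mmult B D H) D = D" "mtrace B (mmult B D H) = t"
    using assms unfolding has_rank_def by blast
  have "s = mtrace B (mmult B (mmult B D H) (mmult B D G))"
    using G(2) H(1) by (metis mmult_assoc)
  also have "\<dots> = mtrace B (mmult B (mmult B D G) (mmult B D H))"
    by (rule mtrace_mmult_commute)
  also have "\<dots> = t"
    using H(2) G(1) by (metis mmult_assoc)
  finally show ?thesis .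
qed

lemma has_rank_zero: "has_rank B (\<lambda>_ _. 0) 0"
  unfolding has_rank_def by (rule exI[of _ "\<lambda>_ _. 0"]) (simp add: mtrace_def)

lemma has_rank_similar:
  assumes fin: "finite B" "finite C"
    and supp: "msupp B B D" "msupp C C E" "msupp C B F" "msupp B C F'"
    and inv: "mmult C F' F = idmat B" "mmult B F F' = idmat C"
    and eq: "mmult C E F = mmult B F D"
    and rank: "has_rank B D t"
  shows "has_rank C E t"
proof -
  obtain G where G: "mmult B (mmult B D G) D = D" "mtrace B (mmult B D G) = t"
    using rank unfolding has_rank_def by blast
  have E: "E = mmult B F (mmult B D F')"
    by (metis eq fin(2) inv(2) mmult_assoc mmult_idmat_right supp(2))
  \<comment> \<open>The generalized inverse is conjugated along with the matrix.\<close>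
  let ?H = "mmult B F (mmult B G F')"
  have EH: "mmult C E ?H = mmult B F (mmult B (mmult B D G) F')"
  proof -
    have "mmult C E ?H = mmult B F (mmult B D (mmult B (mmult C F' F) (mmult B G F')))"
      unfolding E by (simp only: mmult_assoc)
    also have "\<dots> = mmult B F (mmult B (mmult B D (idmat B)) (mmult B G F'))"
      by (simp only: inv mmult_assoc)
    also have "\<dots> = mmult B F (mmult B (mmult B D G) F')"
      by (simp only: mmult_idmat_right[OF fin(1) supp(1)] mmult_assoc)
    finally show ?thesis .
  qed
  have "mmult C (mmult C E ?H) E = E"
  proof -
    have "mmult C (mmult C E ?H) E = mmult B F (mmult B (mmult B D G) (mmult B (mmult C F' F) (mmult B D F')))"
      unfolding EH unfolding E by (simp only: mmult_assoc)
    also have "\<dots> = mmult B F (mmult B (mmult B D G) (mmult B D F'))"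
      unfolding inv by (subst mmult_idmat_left[OF fin(1)]) (use msupp_mmult[OF supp(1,4)] in auto)
    also have "\<dots> = mmult B F (mmult B (mmult B (mmult B D G) D) F')"
      by (simp only: mmult_assoc)
    finally show ?thesis using G(1) E by simp
  qed
  moreover have "mtrace C (mmult C E ?H) = t"
  proof -
    have "mtrace C (mmult C E ?H) = mtrace B (mmult C (mmult B (mmult B D G) F') F)"
      unfolding EH by (rule mtrace_mmult_commute)
    also have "\<dots> = mtrace B (mmult B (mmult B D G) (idmat B))"
      by (simp only: mmult_assoc inv)
    also have "\<dots> = mtrace B (mmult B (idmat B) (mmult B D G))"
      by (rule mtrace_mmult_commute)
    also have "mmult B (idmat B) (mmult B D G) = mmult B D G"
      using mmult_idmat_left[OF fin(1) supp(1)] by (metis mmult_assoc)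
    finally show ?thesis using G(2) by simp
  qed
  ultimately show ?thesis unfolding has_rank_def by blast
qed

section \<open>Gaussian binomial coefficients\<close>

text \<open>The Gaussian binomials by the q-Pascal rule. This form satisfies the factorial identity
  without any division, which shows that the division in \<open>gauss_binom_poly\<close> is exact,
  and it evaluates well at roots of unity.\<close>

fun pascal_poly :: "nat \<Rightarrow> nat \<Rightarrow> 'k::field poly"
  where
    "pascal_poly 0 m = 1"
  | "pascal_poly (Suc l) 0 = 1"
  | "pascal_poly (Suc l) (Suc m) = [:0, 1:] ^ Suc m * pascal_poly l (Suc m) + pascal_poly (Suc l) m"

lemma q_int_poly_add: "(q_int_poly (a + b) :: 'k::field poly) = q_int_poly a * [:0, 1:] ^ b + q_int_poly b"
  by (induction a) (simp_all add: q_int_poly_def algebra_simps power_add)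

lemma q_fact_poly_Suc: "(q_fact_poly (Suc l) :: 'k::field poly) = q_int_poly (Suc l) * q_fact_poly l"
  by (simp add: q_fact_poly_def prod.atLeast1_atMost_eq mult.commute)

lemma q_fact_poly_0 [simp]: "q_fact_poly 0 = (1 :: 'k::field poly)"
  by (simp add: q_fact_poly_def)

lemma q_int_poly_nz: "(q_int_poly (Suc l) :: 'k::field poly) \<noteq> 0"
proof -
  have "Polynomial.poly (q_int_poly (Suc l) :: 'k poly) 0 = 1"
    by (simp add: q_int_poly_def Polynomial.poly_sum poly_power sum.lessThan_Suc_shift del: sum.lessThan_Suc)
  then show ?thesis by auto
qed

lemma q_fact_poly_nz: "(q_fact_poly l :: 'k::field poly) \<noteq> 0"
  by (induction l) (simp_all add: q_fact_poly_Suc q_int_poly_nz)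

lemma pascal_poly_fact:
  "pascal_poly l m * (q_fact_poly l * q_fact_poly m) = (q_fact_poly (l + m) :: 'k::field poly)"
proof (induction l m rule: pascal_poly.induct)
  case (3 l m)
  let ?T = "[:0, 1:] :: 'k poly"
  have "pascal_poly (Suc l) (Suc m) * (q_fact_poly (Suc l) * q_fact_poly (Suc m)) =
      ?T ^ Suc m * q_int_poly (Suc l) * (pascal_poly l (Suc m) * (q_fact_poly l * q_fact_poly (Suc m)))
      + q_int_poly (Suc m) * (pascal_poly (Suc l) m * (q_fact_poly (Suc l) * q_fact_poly m))"
    by (simp only: pascal_poly.simps q_fact_poly_Suc algebra_simps)
  also have "\<dots> = (q_int_poly (Suc l) * ?T ^ Suc m + q_int_poly (Suc m)) * q_fact_poly (Suc l + m)"
    unfolding 3 by (simp only: algebra_simps add_Suc add_Suc_right)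
  also have "\<dots> = q_int_poly (Suc l + Suc m) * q_fact_poly (Suc l + m)"
    by (simp only: q_int_poly_add)
  also have "\<dots> = q_fact_poly (Suc l + Suc m)"
    by (simp add: q_fact_poly_Suc)
  finally show ?case .
qed simp_all

lemma gauss_binom_poly_fact:
  "gauss_binom_poly l m * (q_fact_poly l * q_fact_poly m) = (q_fact_poly (l + m) :: 'k::field poly)"
  and gauss_binom_poly_pascal: "gauss_binom_poly l m = (pascal_poly l m :: 'k::field poly)"
proof -
  show *: "gauss_binom_poly l m = (pascal_poly l m :: 'k::field poly)"
    unfolding gauss_binom_poly_def pascal_poly_fact[symmetric]
    by (simp add: q_fact_poly_nz)
  show "gauss_binom_poly l m * (q_fact_poly l * q_fact_poly m) = (q_fact_poly (l + m) :: 'k::field poly)"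
    unfolding * by (rule pascal_poly_fact)
qed

lemma gauss_binom_0_left [simp]: "gauss_binom q 0 m = 1"
  and gauss_binom_0_right [simp]: "gauss_binom q l 0 = 1"
  by (simp add: gauss_binom_def gauss_binom_poly_pascal, cases l)
    (simp_all add: gauss_binom_def gauss_binom_poly_pascal)

lemma gauss_binom_Suc_Suc:
  "gauss_binom q (Suc l) (Suc m) = q ^ Suc m * gauss_binom q l (Suc m) + gauss_binom q (Suc l) m"
  by (simp add: gauss_binom_def gauss_binom_poly_pascal poly_power)

text \<open>Multiplied by the three q-factorials, both sides become the q-factorial of
  \<open>a + b + c\<close>. The cancellation takes place among polynomials, since the values of the
  q-factorials at a root of unity can be zero.\<close>

lemma gauss_binom_assoc:
  "gauss_binom q a b * gauss_binom q (a + b) c = gauss_binom q b c * gauss_binom q a (b + c)"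
proof -
  have "gauss_binom_poly a b * gauss_binom_poly (a + b) c * (q_fact_poly a * q_fact_poly b * q_fact_poly c)
     = gauss_binom_poly (a + b) c * ((gauss_binom_poly a b * (q_fact_poly a * q_fact_poly b)) * q_fact_poly c)"
    by (simp only: mult_ac)
  also have "\<dots> = q_fact_poly (a + b + c)"
    by (simp only: gauss_binom_poly_fact)
  also have "\<dots> = gauss_binom_poly a (b + c) * (q_fact_poly a * (gauss_binom_poly b c * (q_fact_poly b * q_fact_poly c)))"
    by (simp only: gauss_binom_poly_fact add.assoc)
  also have "\<dots> = gauss_binom_poly b c * gauss_binom_poly a (b + c) * (q_fact_poly a * q_fact_poly b * q_fact_poly c)"
    by (simp only: mult_ac)
  finally have "gauss_binom_poly a b * gauss_binom_poly (a + b) c = gauss_binom_poly b c * (gauss_binom_poly a (b + c) :: 'a poly)"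
    by (simp add: q_fact_poly_nz)
  then show ?thesis by (metis gauss_binom_def poly_mult)
qed

lemma gauss_binom_commute: "gauss_binom q l m = gauss_binom q m l"
proof -
  have "gauss_binom_poly l m * (q_fact_poly l * q_fact_poly m) =
      gauss_binom_poly m l * (q_fact_poly l * (q_fact_poly m :: 'a poly))"
    using gauss_binom_poly_fact[of l m, where 'k = 'a] gauss_binom_poly_fact[of m l, where 'k = 'a]
    by (simp add: add.commute[of l m] mult.commute[of "q_fact_poly l" "q_fact_poly m"])
  then have "gauss_binom_poly l m = (gauss_binom_poly m l :: 'a poly)"
    by (simp add: q_fact_poly_nz)
  then show ?thesis by (simp add: gauss_binom_def)
qed

lemma gauss_binom_1_left: "gauss_binom q 1 m = (\<Sum>i<Suc m. q ^ i)"
proof (induction m)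
  case (Suc m)
  then show ?case using gauss_binom_Suc_Suc[of q 0 m] by simp
qed simp

lemma gauss_binom_1_right: "gauss_binom q m 1 = (\<Sum>i<Suc m. q ^ i)"
  by (metis gauss_binom_1_left gauss_binom_commute)

text \<open>The q-Vandermonde identity, by induction with the q-Pascal rule; \<open>g n l\<close> is
  the Gaussian binomial \<open>n\<close> over \<open>l\<close>, extended by zero. Truncation of
  \<open>n' + l - a\<close> is harmless, because then \<open>a - l > n'\<close> and the last factor
  vanishes.\<close>

lemma gauss_binom_vandermonde_aux:
  fixes q :: "'k::field"
  defines "g \<equiv> \<lambda>n l. if l \<le> n then gauss_binom q l (n - l) else 0"
  shows "(\<Sum>l\<le>a. q ^ (l * (n' + l - a)) * g n l * g n' (a - l)) = g (n + n') a"
proof (induction n arbitrary: a)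
  case 0
  have "(\<Sum>l\<le>a. q ^ (l * (n' + l - a)) * g 0 l * g n' (a - l)) = (\<Sum>l\<in>{0::nat}. g n' a)"
    by (rule sum.mono_neutral_cong_right) (auto simp: g_def)
  then show ?case by simp
next
  case (Suc n)
  have pascal: "g (Suc n) (Suc l) = q ^ (n - l) * g n l + g n (Suc l)" for n l
  proof -
    consider "l < n" | "l = n" | "l > n" by linarith
    then show ?thesis
    proof cases
      case 1
      then obtain m where "n - l = Suc m" "n - Suc l = m" by (metis Suc_diff_Suc)
      then show ?thesis using 1 gauss_binom_Suc_Suc[of q l m] by (simp add: g_def)
    qed (simp_all add: g_def)
  qed
  show ?case
  proof (cases a)
    case 0
    then show ?thesis by (simp add: g_def)
  next
    case (Suc b)
    have "(\<Sum>l\<le>a. q ^ (l * (n' + l - a)) * g (Suc n) l * g n' (a - l)) =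
      g n' (Suc b) + (\<Sum>l\<le>b. q ^ (Suc l * (n' + l - b)) * (q ^ (n - l) * g n l + g n (Suc l)) * g n' (b - l))"
      unfolding Suc sum.atMost_Suc_shift pascal by (simp add: g_def)
    also have "\<dots> = (\<Sum>l\<le>b. q ^ (Suc l * (n' + l - b)) * q ^ (n - l) * g n l * g n' (b - l)) +
       (g n' (Suc b) + (\<Sum>l\<le>b. q ^ (Suc l * (n' + l - b)) * g n (Suc l) * g n' (b - l)))"
      by (simp add: sum.distrib algebra_simps)
    also have "g n' (Suc b) + (\<Sum>l\<le>b. q ^ (Suc l * (n' + l - b)) * g n (Suc l) * g n' (b - l)) =
       (\<Sum>l\<le>Suc b. q ^ (l * (n' + l - Suc b)) * g n l * g n' (Suc b - l))"
      unfolding sum.atMost_Suc_shift by (simp add: g_def)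
    also have "(\<Sum>l\<le>b. q ^ (Suc l * (n' + l - b)) * q ^ (n - l) * g n l * g n' (b - l)) =
       (\<Sum>l\<le>b. q ^ (n + n' - b) * (q ^ (l * (n' + l - b)) * g n l * g n' (b - l)))"
    proof (rule sum.cong)
      fix l assume "l \<in> {..b}"
      show "q ^ (Suc l * (n' + l - b)) * q ^ (n - l) * g n l * g n' (b - l) =
         q ^ (n + n' - b) * (q ^ (l * (n' + l - b)) * g n l * g n' (b - l))"
      \<comment> \<open>In this range no subtraction truncates and the exponents add up; outside it
        one of the two Gaussian factors is zero.\<close>
      proof (cases "l \<le> n \<and> b \<le> n' + l")
        case True
        then have "n' + l - b + (n - l) = n + n' - b" by auto
        then have "Suc l * (n' + l - b) + (n - l) = n + n' - b + l * (n' + l - b)" by simp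
        then have "q ^ (Suc l * (n' + l - b)) * q ^ (n - l) = q ^ (n + n' - b) * q ^ (l * (n' + l - b))"
          by (metis power_add)
        then show ?thesis by simp
      next
        case False
        then have "g n l = 0 \<or> g n' (b - l) = 0" by (auto simp: g_def)
        then show ?thesis by auto
      qed
    qed simp
    finally show ?thesis
      unfolding sum_distrib_left[symmetric] Suc.IH Suc using pascal[of "n + n'" b] by simp
  qed
qed

text \<open>Summing over the nonzero terms only keeps all subtractions untruncated.\<close>

lemma gauss_binom_vandermonde:
  fixes q :: "'k::field"
  assumes "n \<le> a + b"
  shows "(\<Sum>l\<in>{l. l \<le> a \<and> l \<le> n \<and> n \<le> l + b}.
      q ^ (l * (b + l - n)) * gauss_binom q l (n - l) * gauss_binom q (a - l) (b + l - n)) = gauss_binom q a b"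
    (is "?S = _")
proof -
  define g where "g = (\<lambda>n l. if l \<le> n then gauss_binom q l (n - l) else 0)"
  define n' where "n' = a + b - n"
  have "?S = (\<Sum>l\<le>a. q ^ (l * (n' + l - a)) * g n l * g n' (a - l))"
  proof (rule sum.mono_neutral_cong_left)
    show "\<forall>l\<in>{..a} - {l. l \<le> a \<and> l \<le> n \<and> n \<le> l + b}. q ^ (l * (n' + l - a)) * g n l * g n' (a - l) = 0"
      using assms by (auto simp: g_def n'_def)
    fix l assume l: "l \<in> {l. l \<le> a \<and> l \<le> n \<and> n \<le> l + b}"
    then have "n' + l - a = b + l - n" "n' - (a - l) = b + l - n" "a - l \<le> n'" "l \<le> n"
      using assms by (auto simp: n'_def)
    then show "q ^ (l * (b + l - n)) * gauss_binom q l (n - l) * gauss_binom q (a - l) (b + l - n) =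
      q ^ (l * (n' + l - a)) * g n l * g n' (a - l)" by (simp add: g_def)
  qed auto
  also have "\<dots> = g (n + n') a"
    unfolding g_def by (rule gauss_binom_vandermonde_aux)
  also have "\<dots> = gauss_binom q a b"
    using assms by (simp add: g_def n'_def)
  finally show ?thesis .
qed

section \<open>q-integers and Gaussian binomials at a root of unity\<close>

definition q_int :: "'k::field \<Rightarrow> nat \<Rightarrow> 'k"
  where "q_int q n = (\<Sum>i<n. q ^ i)"

lemma q_int_eq_0_iff:
  fixes q :: "'k::field"
  assumes "q ^ d = 1" "\<And>m. 0 < m \<Longrightarrow> m < d \<Longrightarrow> q ^ m \<noteq> 1" "d \<ge> 2"
  shows "q_int q n = 0 \<longleftrightarrow> d dvd n"
proof -
  have q1: "q \<noteq> 1" using assms(2)[of 1] assms(3) by auto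
  have "q_int q n = 0 \<longleftrightarrow> q ^ n = 1"
    using geometric_sum[OF q1, of n] q1 by (auto simp: q_int_def)
  also have "q ^ n = q ^ (n mod d)"
    by (metis assms(1) mult.left_neutral mult_div_mod_eq power_add power_mult power_one)
  also have "q ^ (n mod d) = 1 \<longleftrightarrow> n mod d = 0"
    using assms(2)[of "n mod d"] assms(3) by (metis gr0I mod_less_divisor not_gr0 order.strict_trans2 power_0 zero_less_numeral)
  finally show ?thesis by (simp add: dvd_eq_mod_eq_0)
qed

lemma poly_q_int_poly: "Polynomial.poly (q_int_poly n) q = q_int q n"
  by (simp add: q_int_poly_def q_int_def Polynomial.poly_sum poly_power)

text \<open>The powers are grouped into \<open>c\<close> blocks of length \<open>d\<close>. At a
  root of unity of order \<open>d\<close> the first factor vanishes while the second takes the value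
  \<open>c\<close>, so the zero can be cancelled before evaluation.\<close>

lemma q_int_poly_mult:
  "(q_int_poly (d * c) :: 'k::field poly) = q_int_poly d * (\<Sum>k<c. ([:0, 1:] ^ d) ^ k)"
proof (induction c)
  case (Suc c)
  have "(q_int_poly (d * Suc c) :: 'k poly) = q_int_poly d * [:0, 1:] ^ (d * c) + q_int_poly (d * c)"
    using q_int_poly_add[of d "d * c"] by simp
  then show ?case using Suc by (simp add: algebra_simps power_mult[of _ d c, symmetric])
qed (simp add: q_int_poly_def)

lemma q_fact_poly_add: "(q_fact_poly (l + m) :: 'k::field poly) = q_fact_poly m * (\<Prod>i=1..l. q_int_poly (m + i))"
  by (induction l) (simp_all add: q_fact_poly_Suc mult_ac add.commute)

text \<open>The coefficient is the product of the q-integers of \<open>d * c + i\<close> for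
  \<open>i = 1..d\<close>, divided by the q-factorial of \<open>d\<close>. For \<open>i < d\<close>
  numerator and denominator have equal nonzero values, by periodicity. The factor
  \<open>i = d\<close> would be zero over zero; cancelled as a polynomial, it leaves a sum of
  \<open>c + 1\<close> powers of \<open>q ^ d = 1\<close>.\<close>

lemma gauss_binom_root_of_unity:
  fixes q :: "'k::field"
  assumes q: "q ^ d = 1" "\<And>m. 0 < m \<Longrightarrow> m < d \<Longrightarrow> q ^ m \<noteq> 1" and d: "d \<ge> 2"
  shows "gauss_binom q d (d * c) = of_nat (Suc c)"
proof -
  obtain e where e: "d = Suc e" using d by (cases d) auto
  let ?P = "gauss_binom_poly d (d * c) :: 'k poly"
  have "?P * q_fact_poly d * q_fact_poly (d * c) = q_fact_poly (d * c) * (\<Prod>i=1..d. q_int_poly (d * c + i))"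
    using gauss_binom_poly_fact[of d "d * c"] by (simp add: q_fact_poly_add mult_ac)
  then have "?P * q_fact_poly d = (\<Prod>i=1..d. q_int_poly (d * c + i))"
    by (simp add: q_fact_poly_nz mult.commute)
  also have "\<dots> = (\<Prod>i=1..e. q_int_poly (d * c + i)) * q_int_poly (d * Suc c)"
    unfolding e by (simp add: algebra_simps)
  finally have "q_int_poly d * (?P * q_fact_poly e) =
      q_int_poly d * ((\<Prod>i=1..e. q_int_poly (d * c + i)) * (\<Sum>k<Suc c. ([:0, 1:] ^ d) ^ k))"
    unfolding q_int_poly_mult using e by (simp only: q_fact_poly_Suc mult_ac)
  then have "?P * q_fact_poly e = (\<Prod>i=1..e. q_int_poly (d * c + i)) * (\<Sum>k<Suc c. ([:0, 1:] ^ d) ^ k)"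
    using q_int_poly_nz[of e, where 'k = 'k] e by simp
  then have "Polynomial.poly (?P * q_fact_poly e) q =
      Polynomial.poly ((\<Prod>i=1..e. q_int_poly (d * c + i)) * (\<Sum>k<Suc c. ([:0, 1:] ^ d) ^ k)) q"
    by (rule arg_cong)
  then have "gauss_binom q d (d * c) * (\<Prod>i=1..e. q_int q i) = (\<Prod>i=1..e. q_int q (d * c + i)) * of_nat (Suc c)"
    by (simp add: gauss_binom_def q_fact_poly_def poly_prod poly_q_int_poly Polynomial.poly_sum poly_power q del: sum.lessThan_Suc)
  moreover have "q_int q (d * c + i) = q_int q i" for i
  proof -
    have "q_int_poly (d * c + i) = q_int_poly i * [:0, 1:] ^ (d * c) + (q_int_poly (d * c) :: 'k poly)"
      by (metis add.commute q_int_poly_add)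
    then have "Polynomial.poly (q_int_poly (d * c + i)) q = Polynomial.poly (q_int_poly i * [:0, 1:] ^ (d * c) + q_int_poly (d * c)) q"
      by simp
    then have "q_int q (d * c + i) = q_int q i * q ^ (d * c) + q_int q (d * c)"
      by (simp add: poly_q_int_poly poly_power)
    then show ?thesis using q_int_eq_0_iff[OF q d, of "d * c"] q by (simp add: power_mult)
  qed
  moreover have "(\<Prod>i=1..e. q_int q i) \<noteq> 0"
  proof -
    have "q_int q i \<noteq> 0" if "i \<in> {1..e}" for i
      using that q_int_eq_0_iff[OF q d, of i] e by (auto dest: dvd_imp_le)
    then show ?thesis by simp
  qed
  ultimately show ?thesis by simp
qed

section \<open>Comodules as matrix representations\<close>

subsection \<open>Coordinates\<close>

lemma lookup_vscale [simp]: "lookup (vscale c v) a = c * lookup v a"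
  by (simp add: vscale_def map.rep_eq when_def)

lemma lookup_basis_vec: "lookup (basis_vec b) a = (if a = b then 1 else 0)"
  by (simp add: basis_vec_def lookup_single when_def)

lemma keys_basis_vec [simp]: "keys (basis_vec b :: 'b \<Rightarrow>\<^sub>0 'k::field) = {b}"
  by (simp add: basis_vec_def)

lemma basis_vec_in_vspace [simp]: "(basis_vec b :: 'b \<Rightarrow>\<^sub>0 'k::field) \<in> vspace B \<longleftrightarrow> b \<in> B"
  by (simp add: vspace_def)

lemma lookup_vspace: "v \<in> vspace B \<Longrightarrow> b \<notin> B \<Longrightarrow> lookup v b = 0"
  by (auto simp: vspace_def in_keys_iff)

lemma vspaceI: "(\<And>b. b \<notin> B \<Longrightarrow> lookup v b = 0) \<Longrightarrow> v \<in> vspace B"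
  by (auto simp: vspace_def in_keys_iff)

lemma lookup_lin_ext:
  assumes "finite S" "keys v \<subseteq> S"
  shows "lookup (lin_ext g v) c =
    (\<Sum>b\<in>S. lookup v b * lookup (g b) c)"
  unfolding lin_ext_def lookup_sum lookup_vscale
  using assms by (intro sum.mono_neutral_left) (auto simp: in_keys_iff)

lemma lin_ext_basis_vec [simp]: "lin_ext g (basis_vec b) = g b"
  by (rule poly_mapping_eqI) (simp add: lookup_lin_ext[of "{b}"] lookup_basis_vec)

lemma lin_ext_add: "lin_ext g (u + v) = lin_ext g u + lin_ext g v"
proof (rule poly_mapping_eqI)
  fix c
  let ?S = "keys u \<union> keys v"
  have S: "finite ?S" "keys (u + v) \<subseteq> ?S"
    by (auto dest: subsetD[OF Poly_Mapping.keys_add])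
  then show "lookup (lin_ext g (u + v)) c = lookup (lin_ext g u + lin_ext g v) c"
    by (simp add: lookup_lin_ext[of ?S] lookup_add algebra_simps sum.distrib)
qed

lemma lin_ext_vscale: "lin_ext g (vscale c v) = vscale c (lin_ext g v)"
proof (rule poly_mapping_eqI)
  fix a
  let ?S = "keys v"
  have S: "finite ?S" "keys (vscale c v) \<subseteq> ?S"
    by (auto simp: in_keys_iff)
  then show "lookup (lin_ext g (vscale c v)) a = lookup (vscale c (lin_ext g v)) a"
    by (simp add: lookup_lin_ext[of ?S] sum_distrib_left mult.assoc)
qed

lemma linear_from_lin_ext: "linear_from B (lin_ext g)"
  by (simp add: linear_from_def lin_ext_add lin_ext_vscale)

text \<open>Linearity is known on \<open>vspace B\<close> only, so the induction has to keep all
  partial sums inside that space.\<close>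

lemma lookup_linear_from:
  assumes f: "linear_from B f" and B: "finite B" and v: "v \<in> vspace B"
  shows "lookup (f v) c =
    (\<Sum>b\<in>B. lookup v b * lookup (f (basis_vec b)) c)"
proof -
  define s where "s = (\<lambda>S. \<Sum>b\<in>S. vscale (lookup v b) (basis_vec b))"
  have "s S \<in> vspace B \<and> f (s S) = (\<Sum>b\<in>S. vscale (lookup v b) (f (basis_vec b)))"
    if "finite S" "S \<subseteq> B" for S
    using that
  proof (induction S)
    case empty
    have "vscale 0 (basis_vec undefined) = (0 :: 'a \<Rightarrow>\<^sub>0 'b)" "vscale 0 (f 0) = 0"
      "vscale 0 0 = (0 :: 'a \<Rightarrow>\<^sub>0 'b)" "0 \<in> vspace B"
      by (rule poly_mapping_eqI; simp)+ (simp add: vspace_def)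
    moreover have "f (vscale 0 0) = vscale 0 (f 0)"
      using f \<open>0 \<in> vspace B\<close> unfolding linear_from_def by blast
    ultimately show ?case by (simp add: s_def)
  next
    case (insert b S)
    have "basis_vec b \<in> vspace B" "vscale (lookup v b) (basis_vec b) \<in> vspace B" "s S \<in> vspace B"
      using insert by (auto intro!: vspaceI simp: lookup_basis_vec)
    moreover have "s (insert b S) = vscale (lookup v b) (basis_vec b) + s S"
      using insert by (simp add: s_def)
    moreover have "f (vscale (lookup v b) (basis_vec b) + s S) =
        vscale (lookup v b) (f (basis_vec b)) + f (s S)"
      using f calculation(1-3) unfolding linear_from_def by metis
    moreover have "s (insert b S) \<in> vspace B"
      unfolding calculation(4)
      by (rule vspaceI) (use calculation(2,3) in \<open>simp add: lookup_add lookup_vspace del: lookup_vscale\<close>)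
    ultimately show ?case using insert by simp
  qed
  from this[OF B order.refl]
  have "f (s B) = (\<Sum>b\<in>B. vscale (lookup v b) (f (basis_vec b)))" by blast
  moreover have "s B = v"
  proof (rule poly_mapping_eqI)
    fix a
    have "lookup (s B) a = (\<Sum>b\<in>B. if a = b then lookup v a else 0)"
      unfolding s_def lookup_sum by (rule sum.cong) (auto simp: lookup_basis_vec)
    then show "lookup (s B) a = lookup v a"
      using B lookup_vspace[OF v] by auto
  qed
  ultimately show ?thesis by (simp add: lookup_sum)
qed

lemma lookup_vtensor [simp]:
  "lookup (vtensor u v) (b, c) = lookup u b * lookup v c"
proof -
  have "lookup (vtensor u v) (b, c) = (\<Sum>b'\<in>keys u. lookup u b' *
      (\<Sum>c'\<in>keys v. lookup v c' * (if b = b' \<and> c = c' then 1 else 0)))"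
    unfolding vtensor_def
    by (subst lookup_lin_ext[OF finite_keys order.refl], subst lookup_lin_ext[OF finite_keys order.refl])
      (simp add: lookup_basis_vec)
  also have "\<dots> = (\<Sum>b'\<in>keys u. if b = b' then lookup u b' * lookup v c else 0)"
  proof (rule sum.cong)
    fix b'
    have "(\<Sum>c'\<in>keys v. lookup v c' * (if b = b' \<and> c = c' then 1 else 0)) =
      (\<Sum>c'\<in>keys v. if c = c' then (if b = b' then lookup v c else 0) else 0)"
      by (rule sum.cong) auto
    then show "lookup u b' *
      (\<Sum>c'\<in>keys v. lookup v c' * (if b = b' \<and> c = c' then 1 else 0)) =
      (if b = b' then lookup u b' * lookup v c else 0)"
      by (auto simp: in_keys_iff)
  qed simp
  finally show ?thesis by (auto simp: in_keys_iff)
qed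

lemma lookup_map_tensor:
  assumes "finite S" "keys w \<subseteq> S"
  shows "lookup (map_tensor f g w) (c, d) =
    (\<Sum>(a, b)\<in>S. lookup w (a, b) *
      (lookup (f (basis_vec a)) c * lookup (g (basis_vec b)) d))"
  unfolding map_tensor_def
  by (subst lookup_lin_ext[OF assms]) (simp add: case_prod_beta)

lemma lookup_lin_ext_inj:
  assumes "inj h"
  shows "lookup (lin_ext (\<lambda>b. basis_vec (h b)) v) (h b) = lookup v b"
proof -
  have "lookup (lin_ext (\<lambda>b. basis_vec (h b)) v) (h b) =
    (\<Sum>b'\<in>keys v. if b = b' then lookup v b else 0)"
    by (subst lookup_lin_ext[OF finite_keys order.refl], rule sum.cong)
      (auto simp: lookup_basis_vec dest: injD[OF assms])
  then show ?thesis by (auto simp: in_keys_iff)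
qed

lemma A_counit_basis_vec: "A_counit (basis_vec (i, l)) = (if l = 0 then 1 else 0 :: 'k::field)"
  by (simp add: A_counit_def lookup_basis_vec)

lemma lookup_A_comult_basis_vec:
  "lookup (A_comult (basis_vec z)) ((i', l'), (i, j)) =
    (if i' = i + int j \<and> z = (i, j + l') then 1 else 0 :: 'k::field)"
proof -
  obtain k l where z: "z = (k, l)" by fastforce
  have "lookup (A_comult (basis_vec z :: path \<Rightarrow>\<^sub>0 'k)) ((i', l'), (i, j)) =
    (\<Sum>m\<le>l. if m = j then (if i' = k + int j \<and> l' = l - j \<and> i = k then 1 else 0) else 0)"
    unfolding A_comult_def lin_ext_basis_vec z case_prod_conv lookup_sum
    by (rule sum.cong) (auto simp: lookup_basis_vec)
  then show ?thesis unfolding z by (auto simp: add.commute)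
qed

subsection \<open>The matrices of a comodule\<close>

text \<open>The conditions of \<open>fd_comodule\<close> without coassociativity and counit. They
  already make the coaction a finite family of matrices.\<close>

definition precomodule :: "('b, 'k::field) comod \<Rightarrow> bool"
  where "precomodule M \<longleftrightarrow> finite (fst M) \<and> linear_from (fst M) (snd M) \<and>
    snd M ` vspace (fst M) \<subseteq> vspace (fst M \<times> UNIV)"

text \<open>The coaction sends the basis vector \<open>b\<close> to the sum of
  \<open>cmat M p a b\<close> times \<open>a\<close> tensor \<open>p\<close>, over all
  \<open>a\<close> and \<open>p\<close>.\<close>

definition cmat :: "('b, 'k::field) comod \<Rightarrow> path \<Rightarrow> 'b \<Rightarrow> 'b \<Rightarrow> 'k"
  where "cmat M p a b = (if a \<in> fst M \<and> b \<in> fst M then lookup (snd M (basis_vec b)) (a, p) else 0)"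

text \<open>Coassociativity and counit in terms of matrices: composable paths multiply by
  concatenation, and the vertices \<open>(i, 0)\<close> act as orthogonal projections with sum the
  identity. The finite set \<open>I\<close> stands in for the sum over all integers.\<close>

definition path_rep :: "'b set \<Rightarrow> (path \<Rightarrow> 'b \<Rightarrow> 'b \<Rightarrow> 'k::field) \<Rightarrow> bool"
  where "path_rep B D \<longleftrightarrow> finite B \<and> (\<forall>p. msupp B B (D p)) \<and>
    (\<forall>i l i' l'. mmult B (D (i', l')) (D (i, l)) = (if i' = i + int l then D (i, l + l') else (\<lambda>_ _. 0))) \<and>
    (\<exists>I. finite I \<and> (\<forall>i. i \<notin> I \<longrightarrow> D (i, 0) = (\<lambda>_ _. 0)) \<and> (\<lambda>a b. \<Sum>i\<in>I. D (i, 0) a b) = idmat B)"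

lemma msupp_cmat: "msupp (fst M) (fst M) (cmat M p)"
  by (rule msuppI) (auto simp: cmat_def split: if_splits)

lemma lookup_coact:
  assumes M: "precomodule M" and v: "v \<in> vspace (fst M)"
  shows "lookup (snd M v) (a, p) = (\<Sum>b\<in>fst M. cmat M p a b * lookup v b)"
proof (cases "a \<in> fst M")
  case True
  then show ?thesis
    using M v by (subst lookup_linear_from[of "fst M"]) (auto simp: precomodule_def cmat_def mult.commute)
next
  case False
  have "snd M v \<in> vspace (fst M \<times> UNIV)" using M v by (auto simp: precomodule_def)
  then have "lookup (snd M v) (a, p) = 0" using False by (simp add: lookup_vspace)
  then show ?thesis using False by (simp add: cmat_def)
qed

lemma cmat_eq:
  assumes "precomodule M" "b \<in> fst M"
  shows "cmat M p a b = lookup (snd M (basis_vec b)) (a, p)"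
  using assms by (subst lookup_coact) (auto simp: lookup_basis_vec cmat_def precomodule_def if_distrib cong: if_cong)

lemma precomodule_finite:
  assumes "precomodule M"
  shows "finite {p. cmat M p \<noteq> (\<lambda>_ _. 0)}"
proof (rule finite_subset)
  show "{p. cmat M p \<noteq> (\<lambda>_ _. 0)} \<subseteq> (\<Union>b\<in>fst M. snd ` keys (snd M (basis_vec b)))"
  proof
    fix p assume "p \<in> {p. cmat M p \<noteq> (\<lambda>_ _. 0)}"
    then obtain a b where "cmat M p a b \<noteq> 0" by fastforce
    then have "b \<in> fst M" "(a, p) \<in> keys (snd M (basis_vec b))"
      by (auto simp: cmat_def in_keys_iff split: if_splits)
    then show "p \<in> (\<Union>b\<in>fst M. snd ` keys (snd M (basis_vec b)))" by force
  qed
  show "finite (\<Union>b\<in>fst M. snd ` keys (snd M (basis_vec b)))"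
    using assms by (auto simp: precomodule_def)
qed

lemma keys_coact:
  assumes M: "precomodule M" and v: "v \<in> vspace (fst M)"
  shows "keys (snd M v) \<subseteq> fst M \<times> snd ` keys (snd M v)"
proof -
  have "snd M v \<in> vspace (fst M \<times> UNIV)" using M v by (auto simp: precomodule_def)
  then show ?thesis by (force simp: vspace_def)
qed

lemma lookup_map_tensor_id:
  assumes M: "precomodule M" and v: "v \<in> vspace (fst M)"
  shows "lookup (map_tensor f id (snd M v)) (c, p) =
    (\<Sum>a\<in>fst M. lookup (f (basis_vec a)) c * lookup (snd M v) (a, p))"
proof -
  let ?w = "snd M v" and ?Y = "snd ` keys (snd M v)"
  have "lookup (map_tensor f id ?w) (c, p) =
    (\<Sum>(a, y)\<in>fst M \<times> ?Y. lookup ?w (a, y) *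
      (lookup (f (basis_vec a)) c * (if p = y then 1 else 0)))"
    using M by (subst lookup_map_tensor[OF _ keys_coact[OF M v]])
      (auto simp: precomodule_def lookup_basis_vec)
  also have "\<dots> = (\<Sum>a\<in>fst M. \<Sum>y\<in>?Y. if p = y then lookup (f (basis_vec a)) c * lookup ?w (a, p) else 0)"
    unfolding sum.cartesian_product[symmetric] by (intro sum.cong) auto
  also have "\<dots> = (\<Sum>a\<in>fst M. lookup (f (basis_vec a)) c * lookup ?w (a, p))"
  proof (rule sum.cong)
    fix a
    have "p \<notin> ?Y \<Longrightarrow> lookup ?w (a, p) = 0"
      by (force simp: in_keys_iff)
    then show "(\<Sum>y\<in>?Y. if p = y then lookup (f (basis_vec a)) c * lookup ?w (a, p) else 0) =
      lookup (f (basis_vec a)) c * lookup ?w (a, p)"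
      by auto
  qed simp
  finally show ?thesis .
qed

text \<open>The comultiplication of a path contains \<open>(i', l')\<close> tensor
  \<open>(i, l)\<close> exactly when the path is the concatenation of the two, the later piece
  standing on the left. Comparing coefficients therefore leaves one product of matrices.\<close>

lemma coassoc_lookup:
  assumes M: "precomodule M" and v: "v \<in> vspace (fst M)"
  shows "map_tensor (snd M) id (snd M v) =
      lin_ext (\<lambda>(b, (x, y)). basis_vec ((b, x), y)) (map_tensor id A_comult (snd M v)) \<longleftrightarrow>
    (\<forall>a i' l' i l. (\<Sum>c\<in>fst M. cmat M (i', l') a c * lookup (snd M v) (c, (i, l))) =
      (if i' = i + int l then lookup (snd M v) (a, (i, l + l')) else 0))"
proof -
  let ?w = "snd M v"
  let ?h = "\<lambda>(b, (x, y)). ((b, x :: path), y :: path)"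
  have h: "inj ?h" by (auto simp: inj_def)
  have hd: "(\<lambda>(b :: 'a, (x :: path, y :: path)). basis_vec ((b, x), y) :: ('a \<times> path) \<times> path \<Rightarrow>\<^sub>0 'b) =
      (\<lambda>z. basis_vec (?h z))" by auto
  then have R: "lookup (lin_ext (\<lambda>(b, (x, y)). basis_vec ((b, x), y)) u) ((a, x), y) =
      lookup u (a, (x, y))" for u :: "'a \<times> path \<times> path \<Rightarrow>\<^sub>0 'b" and a x y
    unfolding hd using lookup_lin_ext_inj[OF h, of u "(a, (x, y))"] by simp
  have R2: "lookup (map_tensor id A_comult ?w) (a, ((i', l'), (i, l))) =
    (if i' = i + int l then lookup ?w (a, (i, l + l')) else 0)" for a i' l' i l
  proof -
    have "lookup (map_tensor id A_comult ?w) (a, ((i', l'), (i, l))) =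
      (\<Sum>z\<in>keys ?w. if z = (a, (i, l + l')) then
        (if i' = i + int l then lookup ?w (a, (i, l + l')) else 0) else 0)"
      by (subst lookup_map_tensor[OF finite_keys order.refl], rule sum.cong)
        (auto simp: lookup_basis_vec lookup_A_comult_basis_vec split: if_splits)
    then show ?thesis by (auto simp: in_keys_iff)
  qed
  have L: "lookup (map_tensor (snd M) id ?w) ((a, x), y) =
     (\<Sum>c\<in>fst M. cmat M x a c * lookup ?w (c, y))" for a x y
    by (subst lookup_map_tensor_id[OF M v]) (auto simp: cmat_eq[OF M])
  show ?thesis
    unfolding poly_mapping_eq_iff fun_eq_iff split_paired_All L R R2 by blast
qed

lemma counit_lookup:
  assumes M: "precomodule M" and v: "v \<in> vspace (fst M)"
    and I: "finite I" "\<And>i. i \<notin> I \<Longrightarrow> cmat M (i, 0) = (\<lambda>_ _. 0)"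
  shows "lookup (lin_ext (\<lambda>(b, x). vscale (A_counit (basis_vec x)) (basis_vec b)) (snd M v)) a =
    (\<Sum>i\<in>I. lookup (snd M v) (a, (i, 0)))"
proof -
  let ?w = "snd M v"
  have "lookup (lin_ext (\<lambda>(b, x). vscale (A_counit (basis_vec x)) (basis_vec b)) ?w) a =
    (\<Sum>z\<in>keys ?w. if fst z = a \<and> snd (snd z) = 0 then lookup ?w z else 0)"
    by (subst lookup_lin_ext[OF finite_keys order.refl], rule sum.cong)
      (auto simp: lookup_basis_vec A_counit_basis_vec)
  also have "\<dots> = (\<Sum>z\<in>{z \<in> keys ?w. fst z = a \<and> snd (snd z) = 0}. lookup ?w z)"
    by (simp add: sum.inter_filter)
  also have "\<dots> = (\<Sum>z\<in>(\<lambda>i. (a, (i, 0))) ` I. lookup ?w z)"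
  proof (rule sum.mono_neutral_left)
    show "{z \<in> keys ?w. fst z = a \<and> snd (snd z) = 0} \<subseteq> (\<lambda>i. (a, (i, 0))) ` I"
    proof
      fix z assume z: "z \<in> {z \<in> keys ?w. fst z = a \<and> snd (snd z) = 0}"
      then obtain i where i: "z = (a, (i, 0))" by (cases z) auto
      with z have "lookup ?w (a, (i, 0)) \<noteq> 0" by (simp add: in_keys_iff)
      then have "cmat M (i, 0) \<noteq> (\<lambda>_ _. 0)" by (auto simp: lookup_coact[OF M v])
      then have "i \<in> I" using I(2) by blast
      then show "z \<in> (\<lambda>i. (a, (i, 0))) ` I" using i by blast
    qed
  qed (use I in \<open>auto simp: in_keys_iff\<close>)
  also have "\<dots> = (\<Sum>i\<in>I. lookup ?w (a, (i, 0)))"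
    by (subst sum.reindex) (auto simp: inj_on_def)
  finally show ?thesis .
qed

text \<open>The dictionary that lets the later arguments work with matrices: the relations of
  \<open>path_rep\<close> are the comodule axioms on basis vectors, and conversely they extend
  linearly to all vectors.\<close>

lemma fd_comodule_iff: "fd_comodule M \<longleftrightarrow> precomodule M \<and> path_rep (fst M) (cmat M)"
proof
  assume fd: "fd_comodule M"
  then have M: "precomodule M" by (simp add: fd_comodule_def precomodule_def)
  have "mmult (fst M) (cmat M (i', l')) (cmat M (i, l)) =
      (if i' = i + int l then cmat M (i, l + l') else (\<lambda>_ _. 0))" for i l i' l'
  proof (intro ext)
    fix a b
    show "mmult (fst M) (cmat M (i', l')) (cmat M (i, l)) a b =
      (if i' = i + int l then cmat M (i, l + l') else (\<lambda>_ _. 0)) a b"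
    proof (cases "b \<in> fst M")
      case True
      then have v: "basis_vec b \<in> vspace (fst M)" by simp
      have "map_tensor (snd M) id (snd M (basis_vec b)) =
          lin_ext (\<lambda>(b, (x, y)). basis_vec ((b, x), y)) (map_tensor id A_comult (snd M (basis_vec b)))"
        using fd v unfolding fd_comodule_def by blast
      then show ?thesis
        unfolding coassoc_lookup[OF M v] mmult_def by (simp add: cmat_eq[OF M True])
    next
      case False
      then show ?thesis by (simp add: mmult_def cmat_def)
    qed
  qed
  moreover have "\<exists>I. finite I \<and> (\<forall>i. i \<notin> I \<longrightarrow> cmat M (i, 0) = (\<lambda>_ _. 0)) \<and>
      (\<lambda>a b. \<Sum>i\<in>I. cmat M (i, 0) a b) = idmat (fst M)"
  proof (intro exI conjI)
    \<comment> \<open>The starting vertices of the paths with nonzero matrix; they are finitely many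
      because each value of the coaction has finite support.\<close>
    define I where "I = fst ` {p. cmat M p \<noteq> (\<lambda>_ _. 0)}"
    show fin: "finite I" using precomodule_finite[OF M] by (simp add: I_def)
    have out: "cmat M (i, 0) = (\<lambda>_ _. 0)" if "i \<notin> I" for i
    proof (rule ccontr)
      assume "cmat M (i, 0) \<noteq> (\<lambda>_ _. 0)"
      then have "fst (i, 0 :: nat) \<in> I" unfolding I_def by blast
      then show False using that by simp
    qed
    then show "\<forall>i. i \<notin> I \<longrightarrow> cmat M (i, 0) = (\<lambda>_ _. 0)" by blast
    show "(\<lambda>a b. \<Sum>i\<in>I. cmat M (i, 0) a b) = idmat (fst M)"
    proof (intro ext)
      fix a b
      show "(\<Sum>i\<in>I. cmat M (i, 0) a b) = idmat (fst M) a b"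
      proof (cases "b \<in> fst M")
        case True
        then have v: "basis_vec b \<in> vspace (fst M)" by simp
        have "lin_ext (\<lambda>(b, x). vscale (A_counit (basis_vec x)) (basis_vec b)) (snd M (basis_vec b)) = basis_vec b"
          using fd v unfolding fd_comodule_def by blast
        then show ?thesis
          using counit_lookup[OF M v fin out, of a] True
          by (auto simp: cmat_eq[OF M True] lookup_basis_vec idmat_def)
      next
        case False
        then show ?thesis by (auto simp: cmat_def idmat_def)
      qed
    qed
  qed
  ultimately have "path_rep (fst M) (cmat M)"
    using M by (simp add: path_rep_def msupp_cmat precomodule_def)
  with M show "precomodule M \<and> path_rep (fst M) (cmat M)" by blast
next
  assume "precomodule M \<and> path_rep (fst M) (cmat M)"
  then have M: "precomodule M" and R: "path_rep (fst M) (cmat M)" by auto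
  have mult: "(\<Sum>c\<in>fst M. cmat M (i', l') a c * cmat M (i, l) c b) = (if i' = i + int l then cmat M (i, l + l') a b else 0)"
    for a b i l i' l'
  proof -
    have "mmult (fst M) (cmat M (i', l')) (cmat M (i, l)) = (if i' = i + int l then cmat M (i, l + l') else (\<lambda>_ _. 0))"
      using R unfolding path_rep_def by blast
    from fun_cong[OF fun_cong[OF this], of a b] show ?thesis by (auto simp: mmult_def)
  qed
  obtain I where I: "finite I" "\<And>i. i \<notin> I \<Longrightarrow> cmat M (i, 0) = (\<lambda>_ _. 0)"
      "(\<lambda>a b. \<Sum>i\<in>I. cmat M (i, 0) a b) = idmat (fst M)"
    using R unfolding path_rep_def by blast
  have "map_tensor (snd M) id (snd M v) =
      lin_ext (\<lambda>(b, (x, y)). basis_vec ((b, x), y)) (map_tensor id A_comult (snd M v))"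
    if v: "v \<in> vspace (fst M)" for v
    unfolding coassoc_lookup[OF M v]
  proof (intro allI)
    fix a i' l' i l
    have "(\<Sum>c\<in>fst M. cmat M (i', l') a c * lookup (snd M v) (c, (i, l))) =
      (\<Sum>b\<in>fst M. (\<Sum>c\<in>fst M. cmat M (i', l') a c * cmat M (i, l) c b) * lookup v b)"
      unfolding lookup_coact[OF M v] sum_distrib_left sum_distrib_right
      by (subst sum.swap) (simp add: mult.assoc)
    then show "(\<Sum>c\<in>fst M. cmat M (i', l') a c * lookup (snd M v) (c, (i, l))) =
      (if i' = i + int l then lookup (snd M v) (a, (i, l + l')) else 0)"
      unfolding mult by (simp add: lookup_coact[OF M v])
  qed
  moreover have "lin_ext (\<lambda>(b, x). vscale (A_counit (basis_vec x)) (basis_vec b)) (snd M v) = v"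
    if v: "v \<in> vspace (fst M)" for v
  proof (rule poly_mapping_eqI)
    fix a
    have "(\<Sum>i\<in>I. lookup (snd M v) (a, (i, 0))) =
      (\<Sum>b\<in>fst M. (\<Sum>i\<in>I. cmat M (i, 0) a b) * lookup v b)"
      unfolding lookup_coact[OF M v] sum_distrib_right by (subst sum.swap) simp
    also have "\<dots> = (\<Sum>b\<in>fst M. idmat (fst M) a b * lookup v b)"
      using I(3) by (simp add: fun_eq_iff)
    also have "\<dots> = (\<Sum>b\<in>fst M. if a = b then lookup v a else 0)"
      by (rule sum.cong) (auto simp: idmat_def)
    also have "\<dots> = lookup v a"
      using M lookup_vspace[OF v] by (auto simp: precomodule_def)
    finally show "lookup (lin_ext (\<lambda>(b, x). vscale (A_counit (basis_vec x)) (basis_vec b)) (snd M v)) a =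
      lookup v a"
      using counit_lookup[OF M v I(1,2), of a] by simp
  qed
  ultimately show "fd_comodule M"
    using M unfolding fd_comodule_def precomodule_def by blast
qed

subsection \<open>Isomorphisms\<close>

text \<open>Equivariance is asked of \<open>F\<close> alone, since conjugation gives it for
  \<open>F'\<close>. Naming the two-sided inverse allows label sets of different types.\<close>

definition rep_iso :: "'b set \<Rightarrow> (path \<Rightarrow> 'b \<Rightarrow> 'b \<Rightarrow> 'k::field) \<Rightarrow> 'c set \<Rightarrow> (path \<Rightarrow> 'c \<Rightarrow> 'c \<Rightarrow> 'k) \<Rightarrow> bool"
  where "rep_iso B D C E \<longleftrightarrow> (\<exists>F F'. msupp C B F \<and> msupp B C F' \<and>
    mmult C F' F = idmat B \<and> mmult B F F' = idmat C \<and> (\<forall>p. mmult C (E p) F = mmult B F (D p)))"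

abbreviation cm_iso :: "('b, 'k::field) comod \<Rightarrow> ('c, 'k) comod \<Rightarrow> bool"
  where "cm_iso M N \<equiv> rep_iso (fst M) (cmat M) (fst N) (cmat N)"

lemma rep_iso_relabel:
  assumes h: "bij_betw h B C" and B: "finite B" and supp: "\<And>p. msupp B B (D p)" "\<And>p. msupp C C (E p)"
    and eq: "\<And>p a b. a \<in> B \<Longrightarrow> b \<in> B \<Longrightarrow> E p (h a) (h b) = D p a b"
  shows "rep_iso B D C E"
proof -
  \<comment> \<open>The permutation matrix of \<open>h\<close>; the inverse \<open>F'\<close> is its
    transpose.\<close>
  define F :: "'b \<Rightarrow> 'a \<Rightarrow> 'c" where "F = (\<lambda>c b. if b \<in> B \<and> c = h b then 1 else 0)"
  define F' :: "'a \<Rightarrow> 'b \<Rightarrow> 'c" where "F' = (\<lambda>b c. if b \<in> B \<and> c = h b then 1 else 0)"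
  have hC: "h b \<in> C" if "b \<in> B" for b using h that by (auto simp: bij_betw_def)
  have hinj: "h a = h b \<longleftrightarrow> a = b" if "a \<in> B" "b \<in> B" for a b
    using h that by (auto simp: bij_betw_def inj_on_def)
  have C: "finite C" using h B bij_betw_finite by blast
  have "mmult C F' F a b = idmat B a b" for a b
  proof -
    have "mmult C F' F a b = (\<Sum>c\<in>C. if c = h a then (if a \<in> B \<and> b \<in> B \<and> h a = h b then 1 else 0) else 0)"
      unfolding mmult_def F_def F'_def by (rule sum.cong) auto
    then show ?thesis using C hC hinj by (auto simp: idmat_def)
  qed
  moreover have "mmult B F F' c d = idmat C c d" for c d
  proof (cases "c \<in> C")
    case True
    then obtain a where a: "a \<in> B" "c = h a" using h by (auto simp: bij_betw_def)
    have "mmult B F F' c d = (\<Sum>b\<in>B. if b = a then (if c = d then 1 else 0) else 0)"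
      unfolding mmult_def F_def F'_def by (rule sum.cong) (use a hinj in auto)
    then show ?thesis using B a True by (auto simp: idmat_def)
  next
    case False
    then have "F c b = 0" for b using hC by (auto simp: F_def)
    then show ?thesis using False by (simp add: mmult_def idmat_def)
  qed
  moreover have "mmult C (E p) F c b = mmult B F (D p) c b" for p c b
  proof (cases "c \<in> C \<and> b \<in> B")
    case True
    then obtain a where a: "a \<in> B" "c = h a" using h by (auto simp: bij_betw_def)
    have "mmult C (E p) F c b = (\<Sum>d\<in>C. if d = h b then E p c (h b) else 0)"
      unfolding mmult_def F_def by (rule sum.cong) (use True in auto)
    moreover have "mmult B F (D p) c b = (\<Sum>d\<in>B. if d = a then D p a b else 0)"
      unfolding mmult_def F_def by (rule sum.cong) (use a hinj in auto)
    ultimately show ?thesis using B C a True hC eq by simp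
  next
    case False
    then consider "c \<notin> C" | "b \<notin> B" by blast
    then show ?thesis
    proof cases
      case 1
      then have "F c b = 0" "E p c b' = 0" for b b' using hC msuppD[OF supp(2)] by (auto simp: F_def)
      then show ?thesis by (simp add: mmult_def)
    next
      case 2
      then have "F c b = 0" "D p c' b = 0" for c c' using msuppD[OF supp(1)] by (auto simp: F_def)
      then show ?thesis by (simp add: mmult_def)
    qed
  qed
  moreover have "msupp C B F" "msupp B C F'"
    by (auto intro!: msuppI simp: F_def F'_def hC split: if_splits)
  ultimately show ?thesis unfolding rep_iso_def by blast
qed

lemma rep_iso_refl: "finite B \<Longrightarrow> (\<And>p. msupp B B (D p)) \<Longrightarrow> rep_iso B D B D"
  by (rule rep_iso_relabel[of id]) auto

lemma rep_iso_sym: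
  assumes "rep_iso B D C E" "finite B" "finite C" "\<And>p. msupp B B (D p)" "\<And>p. msupp C C (E p)"
  shows "rep_iso C E B D"
proof -
  obtain F F' where F: "msupp C B F" "msupp B C F'" "mmult C F' F = idmat B" "mmult B F F' = idmat C"
      "\<And>p. mmult C (E p) F = mmult B F (D p)"
    using assms(1) unfolding rep_iso_def by blast
  have "mmult B (D p) F' = mmult C F' (E p)" for p
  proof -
    have "mmult B (D p) F' = mmult B (mmult B (mmult C F' F) (D p)) F'"
      unfolding F(3) mmult_idmat_left[OF assms(2,4)] ..
    also have "\<dots> = mmult C F' (mmult C (E p) (mmult B F F'))"
      by (metis F(5) mmult_assoc)
    also have "\<dots> = mmult C F' (E p)"
      unfolding F(4) mmult_idmat_right[OF assms(3,5)] ..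
    finally show ?thesis .
  qed
  then show ?thesis using F unfolding rep_iso_def by blast
qed

lemma rep_iso_trans:
  assumes "rep_iso A D B E" "rep_iso B E C G" "finite B"
  shows "rep_iso A D C G"
proof -
  obtain F F' where F: "msupp B A F" "msupp A B F'" "mmult B F' F = idmat A" "mmult A F F' = idmat B"
      "\<And>p. mmult B (E p) F = mmult A F (D p)"
    using assms(1) unfolding rep_iso_def by blast
  obtain H H' where H: "msupp C B H" "msupp B C H'" "mmult C H' H = idmat B" "mmult B H H' = idmat C"
      "\<And>p. mmult C (G p) H = mmult B H (E p)"
    using assms(2) unfolding rep_iso_def by blast
  have "mmult C (mmult B F' H') (mmult B H F) = idmat A"
    by (metis F(1,3) H(3) assms(3) mmult_assoc mmult_idmat_left)
  moreover have "mmult A (mmult B H F) (mmult B F' H') = idmat C"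
    by (metis F(4) H(2,4) assms(3) mmult_assoc mmult_idmat_left)
  moreover have "mmult C (G p) (mmult B H F) = mmult A (mmult B H F) (D p)" for p
    by (metis F(5) H(5) mmult_assoc)
  moreover have "msupp C A (mmult B H F)" "msupp A C (mmult B F' H')"
    using F H msupp_mmult by blast+
  ultimately show ?thesis unfolding rep_iso_def by blast
qed

lemma path_rep_iso:
  assumes iso: "rep_iso B D C E" and B: "path_rep B D" and C: "finite C" "\<And>p. msupp C C (E p)"
  shows "path_rep C E"
proof -
  obtain F F' where F: "msupp C B F" "msupp B C F'" "mmult C F' F = idmat B" "mmult B F F' = idmat C"
      "\<And>p. mmult C (E p) F = mmult B F (D p)"
    using iso unfolding rep_iso_def by blast
  have fin: "finite B" and supp: "\<And>p. msupp B B (D p)" using B by (auto simp: path_rep_def)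
  have E: "E p = mmult B F (mmult B (D p) F')" for p
    by (metis F(4,5) C mmult_assoc mmult_idmat_right)
  have "mmult C (E x) (E y) = mmult B F (mmult B (mmult B (D x) (D y)) F')" for x y
  proof -
    have "mmult C (E x) (E y) = mmult B F (mmult B (D x) (mmult B (mmult C F' F) (mmult B (D y) F')))"
      unfolding E by (simp only: mmult_assoc)
    also have "mmult B (mmult C F' F) (mmult B (D y) F') = mmult B (D y) F'"
      unfolding F(3) by (rule mmult_idmat_left[OF fin msupp_mmult[OF supp F(2)]])
    finally show ?thesis by (simp only: mmult_assoc)
  qed
  then have "mmult C (E (i', l')) (E (i, l)) = (if i' = i + int l then E (i, l + l') else (\<lambda>_ _. 0))" for i l i' l'
    using B by (simp add: path_rep_def E)
  moreover obtain I where I: "finite I" "\<And>i. i \<notin> I \<Longrightarrow> D (i, 0) = (\<lambda>_ _. 0)"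
      "(\<lambda>a b. \<Sum>i\<in>I. D (i, 0) a b) = idmat B"
    using B unfolding path_rep_def by blast
  have "(\<lambda>a b. \<Sum>i\<in>I. E (i, 0) a b) = mmult B F (mmult B (\<lambda>a b. \<Sum>i\<in>I. D (i, 0) a b) F')"
    unfolding E mmult_sum_left mmult_sum_right ..
  then have "(\<lambda>a b. \<Sum>i\<in>I. E (i, 0) a b) = idmat C"
    unfolding I(3) mmult_idmat_left[OF fin F(2)] F(4) .
  moreover have "E (i, 0) = (\<lambda>_ _. 0)" if "i \<notin> I" for i
    using I(2)[OF that] by (simp add: E)
  ultimately show ?thesis using C I(1) unfolding path_rep_def by blast
qed

lemma has_rank_rep_iso:
  assumes "rep_iso B D C E" "finite B" "finite C" "\<And>p. msupp B B (D p)" "\<And>p. msupp C C (E p)"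
    and "has_rank B (D p) t"
  shows "has_rank C (E p) t"
proof -
  obtain F F' where F: "msupp C B F" "msupp B C F'" "mmult C F' F = idmat B" "mmult B F F' = idmat C"
      "\<And>p. mmult C (E p) F = mmult B F (D p)"
    using assms(1) unfolding rep_iso_def by blast
  show ?thesis by (rule has_rank_similar[OF assms(2,3,4,5) F assms(6)])
qed

lemma lookup_matrix_map:
  assumes "finite C" "finite B" "msupp C B F" "v \<in> vspace B"
  shows "lookup (lin_ext (\<lambda>b. \<Sum>a\<in>C. Poly_Mapping.single a (F a b)) v) c =
    (\<Sum>b\<in>B. F c b * lookup v b)"
proof -
  have "lookup (\<Sum>a\<in>C. Poly_Mapping.single a (F a b)) c = F c b" for b
  proof -
    have "lookup (\<Sum>a\<in>C. Poly_Mapping.single a (F a b)) c = (\<Sum>a\<in>C. if a = c then F c b else 0)"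
      unfolding lookup_sum by (rule sum.cong) (auto simp: lookup_single when_def)
    then show ?thesis using assms(1) msuppD[OF assms(3)] by auto
  qed
  then show ?thesis
    using assms(2,4) by (subst lookup_lin_ext[of B]) (auto simp: vspace_def mult.commute)
qed

lemma comodule_isoI:
  fixes M :: "('b, 'k::field) comod" and N :: "('c, 'k) comod"
  assumes M: "precomodule M" and N: "precomodule N" and iso: "cm_iso M N"
  shows "comodule_iso M N"
proof -
  let ?B = "fst M" and ?C = "fst N"
  have fin: "finite ?B" "finite ?C" using M N by (auto simp: precomodule_def)
  obtain F F' where F: "msupp ?C ?B F" "msupp ?B ?C F'" "mmult ?C F' F = idmat ?B" "mmult ?B F F' = idmat ?C"
      "\<And>p. mmult ?C (cmat N p) F = mmult ?B F (cmat M p)"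
    using iso unfolding rep_iso_def by blast
  define f where "f = lin_ext (\<lambda>b. \<Sum>a\<in>?C. Poly_Mapping.single a (F a b))"
  define g where "g = lin_ext (\<lambda>b. \<Sum>a\<in>?B. Poly_Mapping.single a (F' a b))"
  have f: "lookup (f v) c = (\<Sum>b\<in>?B. F c b * lookup v b)" if "v \<in> vspace ?B" for v c
    unfolding f_def by (rule lookup_matrix_map[OF fin(2,1) F(1) that])
  have g: "lookup (g v) c = (\<Sum>b\<in>?C. F' c b * lookup v b)" if "v \<in> vspace ?C" for v c
    unfolding g_def by (rule lookup_matrix_map[OF fin F(2) that])
  have fV: "f v \<in> vspace ?C" if "v \<in> vspace ?B" for v
    using msuppD[OF F(1)] by (intro vspaceI) (simp add: f[OF that])
  have gV: "g v \<in> vspace ?B" if "v \<in> vspace ?C" for v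
    using msuppD[OF F(2)] by (intro vspaceI) (simp add: g[OF that])
  have id: "(\<Sum>b\<in>S. idmat S c b * lookup v b) = lookup v c"
    if "v \<in> vspace S" "finite S" for v :: "'z \<Rightarrow>\<^sub>0 'k" and S c
  proof -
    have "(\<Sum>b\<in>S. idmat S c b * lookup v b) = (\<Sum>b\<in>S. if c = b then lookup v c else 0)"
      by (rule sum.cong) (auto simp: idmat_def)
    then show ?thesis using that lookup_vspace[OF that(1)] by auto
  qed
  have gf: "g (f v) = v" if v: "v \<in> vspace ?B" for v
  proof (rule poly_mapping_eqI)
    fix c
    have "lookup (g (f v)) c = (\<Sum>b\<in>?B. mmult ?C F' F c b * lookup v b)"
      unfolding g[OF fV[OF v]] f[OF v] mmult_def sum_distrib_left sum_distrib_right
      by (subst sum.swap) (simp add: mult.assoc)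
    then show "lookup (g (f v)) c = lookup v c"
      unfolding F(3) id[OF v fin(1)] .
  qed
  have fg: "f (g v) = v" if v: "v \<in> vspace ?C" for v
  proof (rule poly_mapping_eqI)
    fix c
    have "lookup (f (g v)) c = (\<Sum>b\<in>?C. mmult ?B F F' c b * lookup v b)"
      unfolding f[OF gV[OF v]] g[OF v] mmult_def sum_distrib_left sum_distrib_right
      by (subst sum.swap) (simp add: mult.assoc)
    then show "lookup (f (g v)) c = lookup v c"
      unfolding F(4) id[OF v fin(2)] .
  qed
  have "bij_betw f (vspace ?B) (vspace ?C)"
    by (rule bij_betw_byWitness[of _ g]) (use gf fg fV gV in auto)
  moreover have "snd N (f v) = map_tensor f id (snd M v)" if v: "v \<in> vspace ?B" for v
  proof -
    have "lookup (snd N (f v)) (c, p) = lookup (map_tensor f id (snd M v)) (c, p)" for c p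
    proof -
      have "lookup (snd N (f v)) (c, p) = (\<Sum>b\<in>?B. mmult ?C (cmat N p) F c b * lookup v b)"
        unfolding lookup_coact[OF N fV[OF v]] f[OF v] mmult_def sum_distrib_left sum_distrib_right
        by (subst sum.swap) (simp add: mult.assoc)
      also have "\<dots> = (\<Sum>a\<in>?B. F c a * (\<Sum>b\<in>?B. cmat M p a b * lookup v b))"
        unfolding F(5) unfolding mmult_def sum_distrib_left sum_distrib_right
        by (subst sum.swap) (simp add: mult.assoc)
      also have "\<dots> = (\<Sum>a\<in>?B. lookup (f (basis_vec a)) c * lookup (snd M v) (a, p))"
      proof (rule sum.cong)
        fix a assume a: "a \<in> ?B"
        have "lookup (f (basis_vec a)) c = (\<Sum>b\<in>?B. if b = a then F c a else 0)"
          unfolding f[OF iffD2[OF basis_vec_in_vspace a]] by (rule sum.cong) (auto simp: lookup_basis_vec)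
        then show "F c a * (\<Sum>b\<in>?B. cmat M p a b * lookup v b) =
          lookup (f (basis_vec a)) c * lookup (snd M v) (a, p)"
          using a fin by (simp add: lookup_coact[OF M v])
      qed simp
      also have "\<dots> = lookup (map_tensor f id (snd M v)) (c, p)"
        by (rule lookup_map_tensor_id[OF M v, symmetric])
      finally show ?thesis .
    qed
    then show ?thesis by (auto simp: poly_mapping_eq_iff fun_eq_iff)
  qed
  ultimately show ?thesis
    unfolding comodule_iso_def comodule_hom_def
    using fV by (intro exI[of _ f]) (auto simp: f_def linear_from_lin_ext)
qed

lemma comodule_isoD:
  fixes M :: "('b, 'k::field) comod" and N :: "('c, 'k) comod"
  assumes M: "precomodule M" and N: "precomodule N" and iso: "comodule_iso M N"
  shows "cm_iso M N"
proof -
  let ?B = "fst M" and ?C = "fst N"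
  have fin: "finite ?B" "finite ?C" using M N by (auto simp: precomodule_def)
  obtain f where hom: "comodule_hom M N f" and bij: "bij_betw f (vspace ?B) (vspace ?C)"
    using iso unfolding comodule_iso_def by blast
  define g where "g = the_inv_into (vspace ?B) f"
  have lf: "linear_from ?B f" using hom by (simp add: comodule_hom_def)
  have fV: "f v \<in> vspace ?C" if "v \<in> vspace ?B" for v using bij that by (auto simp: bij_betw_def)
  have gV: "g v \<in> vspace ?B" if "v \<in> vspace ?C" for v
    unfolding g_def using bij that by (metis bij_betw_def order_refl the_inv_into_into)
  have gf: "g (f v) = v" if "v \<in> vspace ?B" for v
    using bij that by (simp add: g_def bij_betw_def the_inv_into_f_f)
  have fg: "f (g v) = v" if "v \<in> vspace ?C" for v
    using bij that by (simp add: g_def bij_betw_def f_the_inv_into_f)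
  have vadd: "u + v \<in> vspace S" if "u \<in> vspace S" "v \<in> vspace S" for u v :: "'z \<Rightarrow>\<^sub>0 'k" and S
    using that by (intro vspaceI) (simp add: lookup_add lookup_vspace)
  have vsc: "vscale c v \<in> vspace S" if "v \<in> vspace S" for v :: "'z \<Rightarrow>\<^sub>0 'k" and S c
    using that by (intro vspaceI) (simp add: lookup_vspace)
  have lg: "linear_from ?C g"
    unfolding linear_from_def
  proof (intro conjI allI ballI)
    fix u v :: "'c \<Rightarrow>\<^sub>0 'k" assume uv: "u \<in> vspace ?C" "v \<in> vspace ?C"
    have "f (g u + g v) = u + v"
      using lf gV fg uv unfolding linear_from_def by simp
    then show "g (u + v) = g u + g v"
      using gf[OF vadd[OF gV[OF uv(1)] gV[OF uv(2)]]] by simp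
  next
    fix c and v :: "'c \<Rightarrow>\<^sub>0 'k" assume v: "v \<in> vspace ?C"
    have "f (vscale c (g v)) = vscale c v"
      using lf gV fg v unfolding linear_from_def by simp
    then show "g (vscale c v) = vscale c (g v)"
      using gf[OF vsc[OF gV[OF v]]] by metis
  qed
  define F where "F = (\<lambda>a b. if b \<in> ?B then lookup (f (basis_vec b)) a else 0)"
  define F' where "F' = (\<lambda>a b. if b \<in> ?C then lookup (g (basis_vec b)) a else 0)"
  have f: "lookup (f v) c = (\<Sum>b\<in>?B. F c b * lookup v b)" if "v \<in> vspace ?B" for v c
    by (subst lookup_linear_from[OF lf fin(1) that]) (simp add: F_def mult.commute)
  have g: "lookup (g v) c = (\<Sum>b\<in>?C. F' c b * lookup v b)" if "v \<in> vspace ?C" for v c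
    by (subst lookup_linear_from[OF lg fin(2) that]) (simp add: F'_def mult.commute)
  have "mmult ?C F' F a b = idmat ?B a b" for a b
  proof (cases "b \<in> ?B")
    case True
    then have v: "basis_vec b \<in> vspace ?B" by simp
    have "mmult ?C F' F a b = lookup (g (f (basis_vec b))) a"
      unfolding g[OF fV[OF v]] mmult_def using True by (simp add: F_def)
    then show ?thesis using True by (simp add: gf[OF v] lookup_basis_vec idmat_def)
  qed (simp add: mmult_def F_def idmat_def)
  moreover have "mmult ?B F F' a b = idmat ?C a b" for a b
  proof (cases "b \<in> ?C")
    case True
    then have v: "basis_vec b \<in> vspace ?C" by simp
    have "mmult ?B F F' a b = lookup (f (g (basis_vec b))) a"
      unfolding f[OF gV[OF v]] mmult_def using True by (simp add: F'_def)
    then show ?thesis using True by (simp add: fg[OF v] lookup_basis_vec idmat_def)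
  qed (simp add: mmult_def F'_def idmat_def)
  moreover have "mmult ?C (cmat N p) F c b = mmult ?B F (cmat M p) c b" for p c b
  proof (cases "b \<in> ?B")
    case True
    then have v: "basis_vec b \<in> vspace ?B" by simp
    have "snd N (f (basis_vec b)) = map_tensor f id (snd M (basis_vec b))"
      using hom v unfolding comodule_hom_def by blast
    then have "lookup (snd N (f (basis_vec b))) (c, p) =
        lookup (map_tensor f id (snd M (basis_vec b))) (c, p)" by simp
    then show ?thesis
      unfolding lookup_coact[OF N fV[OF v]] lookup_map_tensor_id[OF M v] mmult_def
      using True by (simp add: F_def cmat_eq[OF M True])
  qed (simp add: mmult_def F_def cmat_def)
  moreover have "a \<in> ?C" if "b \<in> ?B" "lookup (f (basis_vec b)) a \<noteq> 0" for a b
    using lookup_vspace[OF fV] that by (metis basis_vec_in_vspace)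
  then have "msupp ?C ?B F"
    by (auto intro!: msuppI simp: F_def split: if_splits)
  moreover have "a \<in> ?B" if "b \<in> ?C" "lookup (g (basis_vec b)) a \<noteq> 0" for a b
    using lookup_vspace[OF gV] that by (metis basis_vec_in_vspace)
  then have "msupp ?B ?C F'"
    by (auto intro!: msuppI simp: F'_def split: if_splits)
  ultimately show ?thesis unfolding rep_iso_def by blast
qed

lemma comodule_iso_iff: "precomodule M \<Longrightarrow> precomodule N \<Longrightarrow> comodule_iso M N \<longleftrightarrow> cm_iso M N"
  using comodule_isoI comodule_isoD by blast

lemma cm_iso_sym: "precomodule M \<Longrightarrow> precomodule N \<Longrightarrow> cm_iso M N \<Longrightarrow> cm_iso N M"
  by (rule rep_iso_sym) (auto simp: precomodule_def msupp_cmat)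

lemma cm_iso_trans: "precomodule N \<Longrightarrow> cm_iso M N \<Longrightarrow> cm_iso N P \<Longrightarrow> cm_iso M P"
  by (rule rep_iso_trans) (auto simp: precomodule_def)

lemma cm_iso_refl: "precomodule M \<Longrightarrow> cm_iso M M"
  by (rule rep_iso_refl) (auto simp: precomodule_def msupp_cmat)

lemma fd_comodule_iso:
  assumes "fd_comodule M" "precomodule N" "cm_iso M N" shows "fd_comodule N"
  using assms path_rep_iso[of "fst M" "cmat M" "fst N" "cmat N"]
  by (auto simp: fd_comodule_iff precomodule_def msupp_cmat)

subsection \<open>Constructions of comodules\<close>

text \<open>The converse of \<open>cmat\<close>. The sum is meaningful only for finitely many
  nonzero matrices, which \<open>path_rep_finite\<close> supplies for representations.\<close>

definition mat_comodule :: "'b set \<Rightarrow> (path \<Rightarrow> 'b \<Rightarrow> 'b \<Rightarrow> 'k::field) \<Rightarrow> ('b, 'k) comod"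
  where "mat_comodule B D = (B, lin_ext (\<lambda>b. \<Sum>p\<in>{p. D p \<noteq> (\<lambda>_ _. 0)}. \<Sum>a\<in>B. Poly_Mapping.single (a, p) (D p a b)))"

lemma fst_mat_comodule [simp]: "fst (mat_comodule B D) = B"
  by (simp add: mat_comodule_def)

lemma mat_comodule:
  assumes B: "finite B" and supp: "\<And>p. msupp B B (D p)" and fin: "finite {p. D p \<noteq> (\<lambda>_ _. 0)}"
  shows "precomodule (mat_comodule B D)" "cmat (mat_comodule B D) = D"
proof -
  have L: "lookup (\<Sum>p\<in>{p. D p \<noteq> (\<lambda>_ _. 0)}. \<Sum>a\<in>B. Poly_Mapping.single (a, p) (D p a b)) (c, x) = D x c b" for b c x
  proof -
    have "lookup (\<Sum>p\<in>{p. D p \<noteq> (\<lambda>_ _. 0)}. \<Sum>a\<in>B. Poly_Mapping.single (a, p) (D p a b)) (c, x) =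
      (\<Sum>p\<in>{p. D p \<noteq> (\<lambda>_ _. 0)}. \<Sum>a\<in>B. if a = c then (if p = x then D x c b else 0) else 0)"
      unfolding lookup_sum by (intro sum.cong) (auto simp: lookup_single when_def)
    also have "\<dots> = (\<Sum>p\<in>{p. D p \<noteq> (\<lambda>_ _. 0)}. if p = x then D x c b else 0)"
      using B msuppD[OF supp] by (intro sum.cong) auto
    also have "\<dots> = D x c b" using fin by auto
    finally show ?thesis .
  qed
  show M: "precomodule (mat_comodule B D)"
    unfolding precomodule_def fst_mat_comodule
  proof (intro conjI)
    show "snd (mat_comodule B D) ` vspace B \<subseteq> vspace (B \<times> UNIV)"
    proof (rule image_subsetI, rule vspaceI)
      fix v :: "'a \<Rightarrow>\<^sub>0 'b" and z assume v: "v \<in> vspace B" "z \<notin> B \<times> (UNIV :: path set)"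
      obtain c x where z: "z = (c, x)" by (cases z)
      show "lookup (snd (mat_comodule B D) v) z = 0"
        unfolding mat_comodule_def z snd_conv
        by (subst lookup_lin_ext[OF finite_keys order.refl])
          (use v z msuppD[OF supp] in \<open>auto simp: L\<close>)
    qed
  qed (use B in \<open>auto simp: mat_comodule_def linear_from_lin_ext\<close>)
  show "cmat (mat_comodule B D) = D"
    using msuppD[OF supp] by (intro ext) (auto simp: cmat_def mat_comodule_def L)
qed

text \<open>\<open>D (i, l)\<close> is unchanged by the projections at its two ends, so a path with
  nonzero matrix has both end vertices in \<open>I\<close>, and the ends determine the path.\<close>

lemma path_rep_finite:
  assumes "path_rep B D" shows "finite {p. D p \<noteq> (\<lambda>_ _. 0)}"
proof -
  obtain I where I: "finite I" "\<And>i. i \<notin> I \<Longrightarrow> D (i, 0) = (\<lambda>_ _. 0)"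
    using assms unfolding path_rep_def by blast
  have m: "mmult B (D (i', l')) (D (i, l)) = (if i' = i + int l then D (i, l + l') else (\<lambda>_ _. 0))" for i l i' l'
    using assms unfolding path_rep_def by blast
  have "{p. D p \<noteq> (\<lambda>_ _. 0)} \<subseteq> (\<lambda>(i, j). (i, nat (j - i))) ` (I \<times> I)"
  proof
    fix p assume p: "p \<in> {p. D p \<noteq> (\<lambda>_ _. 0)}"
    obtain i l where il: "p = (i, l)" by (cases p)
    have "D (i, 0) \<noteq> (\<lambda>_ _. 0)" using m[of i l i 0] p il by auto
    then have "i \<in> I" using I(2) by blast
    moreover have "D (i + int l, 0) \<noteq> (\<lambda>_ _. 0)" using m[of "i + int l" 0 i l] p il by auto
    then have "i + int l \<in> I" using I(2) by blast
    ultimately show "p \<in> (\<lambda>(i, j). (i, nat (j - i))) ` (I \<times> I)"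
      by (intro image_eqI[of _ _ "(i, i + int l)"]) (auto simp: il)
  qed
  then show ?thesis using I(1) finite_subset by blast
qed

lemma fd_mat_comodule:
  assumes "path_rep B D"
  shows "fd_comodule (mat_comodule B D)" "cmat (mat_comodule B D) = D"
  using assms mat_comodule[of B D] path_rep_finite[OF assms]
  by (auto simp: fd_comodule_iff path_rep_def)

text \<open>Isomorphism classes consist of comodules with labels in \<open>nat\<close>, whereas sums
  and tensor products carry other label types; this provides the representatives.\<close>

lemma fd_comodule_nat_copy:
  fixes M :: "('b, 'k::field) comod"
  assumes "fd_comodule M"
  obtains N :: "(nat, 'k) comod" where "fd_comodule N" "cm_iso M N"
proof -
  let ?B = "fst M"
  have fin: "finite ?B" and rep: "path_rep ?B (cmat M)"
    using assms by (auto simp: fd_comodule_iff path_rep_def)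
  obtain h where h: "bij_betw h ?B {0..<card ?B}"
    using ex_bij_betw_finite_nat[OF fin] by blast
  define C where "C = {0..<card ?B}"
  define D where "D = (\<lambda>p a b. if a \<in> C \<and> b \<in> C then cmat M p (inv_into ?B h a) (inv_into ?B h b) else 0)"
  have iso: "rep_iso ?B (cmat M) C D"
  proof (rule rep_iso_relabel)
    show "bij_betw h ?B C" using h by (simp add: C_def)
    then show "\<And>p a b. a \<in> ?B \<Longrightarrow> b \<in> ?B \<Longrightarrow> D p (h a) (h b) = cmat M p a b"
      by (auto simp: D_def bij_betw_def)
    show "\<And>p. msupp C C (D p)" by (rule msuppI) (auto simp: D_def split: if_splits)
  qed (use fin in \<open>auto simp: msupp_cmat\<close>)
  have "path_rep C D"
    by (rule path_rep_iso[OF iso rep]) (auto simp: C_def D_def intro!: msuppI split: if_splits)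
  note fd = fd_mat_comodule[OF this]
  have "cm_iso M (mat_comodule C D)" using iso unfolding fd(2) fst_mat_comodule .
  with fd(1) show ?thesis by (rule that)
qed

text \<open>The structure constants of the algebra: the coefficient of \<open>z\<close> in the
  product of the paths \<open>x\<close> and \<open>y\<close>.\<close>

definition coef :: "'k::field \<Rightarrow> path \<Rightarrow> path \<Rightarrow> path \<Rightarrow> 'k"
  where "coef q x y z = (if z = (fst x + fst y, snd x + snd y)
    then q powi (fst x * int (snd y)) * gauss_binom q (snd x) (snd y) else 0)"

lemma lookup_A_mult: "lookup (A_mult q (basis_vec (x, y))) z = coef q x y z"
  by (auto simp: A_mult_def coef_def lookup_basis_vec case_prod_beta)

text \<open>The coaction multiplies the path components, so the matrix of \<open>z\<close> is a sum
  of Kronecker products weighted by structure constants. \<open>U\<close> and \<open>V\<close> may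
  be any finite sets containing the supports, which lets isomorphic comodules share one range of
  summation.\<close>

lemma comodule_tensor:
  fixes M :: "('b, 'k::field) comod" and N :: "('c, 'k) comod"
  assumes M: "precomodule M" and N: "precomodule N"
  shows "precomodule (comodule_tensor q M N)"
    and "finite U \<Longrightarrow> finite V \<Longrightarrow> (\<And>x. x \<notin> U \<Longrightarrow> cmat M x = (\<lambda>_ _. 0)) \<Longrightarrow>
      (\<And>y. y \<notin> V \<Longrightarrow> cmat N y = (\<lambda>_ _. 0)) \<Longrightarrow>
      cmat (comodule_tensor q M N) z (a, b) (a', b') =
      (\<Sum>x\<in>U. \<Sum>y\<in>V. coef q x y z * cmat M x a a' * cmat N y b b')"
proof -
  let ?B = "fst M" and ?C = "fst N"
  have fin: "finite ?B" "finite ?C" using M N by (auto simp: precomodule_def)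
  have fst: "fst (comodule_tensor q M N) = ?B \<times> ?C" by (simp add: comodule_tensor_def)
  define P where "P = (\<lambda>((b :: 'b, x), (c :: 'c, y)). vtensor (basis_vec (b, c)) (A_mult q (basis_vec (x, y))) :: _ \<Rightarrow>\<^sub>0 'k)"
  have snd: "snd (comodule_tensor q M N) w = lin_ext P (map_tensor (snd M) (snd N) w)" for w
    by (simp add: comodule_tensor_def P_def)
  have P: "lookup (P ((c, x), (d, y))) ((a, b), z) = (if a = c \<and> b = d then coef q x y z else 0)" for a b c d x y z
    by (simp add: P_def lookup_basis_vec lookup_A_mult)
  have keys: "keys (map_tensor (snd M) (snd N) w) \<subseteq>
      {((a, x), (b, y)) | a b x y. a \<in> ?B \<and> b \<in> ?C}" if w: "w \<in> vspace (?B \<times> ?C)" for w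
  proof
    fix z assume z: "z \<in> keys (map_tensor (snd M) (snd N) w)"
    obtain a x b y where zz: "z = ((a, x), (b, y))" by (metis surj_pair)
    have kw: "keys w \<subseteq> ?B \<times> ?C" using w by (simp add: vspace_def)
    have "(\<Sum>(a', b')\<in>?B \<times> ?C. lookup w (a', b') *
      (lookup (snd M (basis_vec a')) (a, x) * lookup (snd N (basis_vec b')) (b, y))) \<noteq> 0"
      using z unfolding zz in_keys_iff by (subst (asm) lookup_map_tensor[of "?B \<times> ?C"]) (use fin kw in auto)
    then obtain t where "t \<in> ?B \<times> ?C" "(case t of (a', b') \<Rightarrow> lookup w (a', b') *
      (lookup (snd M (basis_vec a')) (a, x) * lookup (snd N (basis_vec b')) (b, y))) \<noteq> 0"
      by (rule sum.not_neutral_contains_not_neutral)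
    then obtain a' b' where "a' \<in> ?B" "b' \<in> ?C" "lookup (snd M (basis_vec a')) (a, x) \<noteq> 0"
       "lookup (snd N (basis_vec b')) (b, y) \<noteq> 0"
      by (cases t) auto
    then have "cmat M x a a' \<noteq> 0" "cmat N y b b' \<noteq> 0"
      by (simp_all add: cmat_eq[OF M] cmat_eq[OF N])
    then have "a \<in> ?B" "b \<in> ?C"
      using msupp_cmat[of M x] msupp_cmat[of N y] unfolding msupp_def by blast+
    then show "z \<in> {((a, x), (b, y)) | a b x y. a \<in> ?B \<and> b \<in> ?C}" using zz by blast
  qed
  show pre: "precomodule (comodule_tensor q M N)"
    unfolding precomodule_def fst
  proof (intro conjI)
    show "linear_from (?B \<times> ?C) (snd (comodule_tensor q M N))"
      unfolding linear_from_def snd map_tensor_def by (simp add: lin_ext_add lin_ext_vscale)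
    show "snd (comodule_tensor q M N) ` vspace (?B \<times> ?C) \<subseteq> vspace ((?B \<times> ?C) \<times> UNIV)"
    proof (rule image_subsetI, rule vspaceI)
      fix w :: "'b \<times> 'c \<Rightarrow>\<^sub>0 'k" and z assume w: "w \<in> vspace (?B \<times> ?C)" and z: "z \<notin> (?B \<times> ?C) \<times> (UNIV :: path set)"
      obtain a b p where zz: "z = ((a, b), p)" by (metis surj_pair)
      show "lookup (snd (comodule_tensor q M N) w) z = 0"
        unfolding snd by (subst lookup_lin_ext[OF finite_keys order.refl], rule sum.neutral)
          (use keys[OF w] z zz in \<open>force simp: P\<close>)
    qed
  qed (use fin in auto)
  assume U: "finite U" "\<And>x. x \<notin> U \<Longrightarrow> cmat M x = (\<lambda>_ _. 0)"
    and V: "finite V" "\<And>y. y \<notin> V \<Longrightarrow> cmat N y = (\<lambda>_ _. 0)"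
  show "cmat (comodule_tensor q M N) z (a, b) (a', b') =
      (\<Sum>x\<in>U. \<Sum>y\<in>V. coef q x y z * cmat M x a a' * cmat N y b b')"
  proof (cases "a' \<in> ?B \<and> b' \<in> ?C")
    case True
    then have v: "basis_vec (a', b') \<in> vspace (?B \<times> ?C)" by simp
    let ?w = "map_tensor (snd M) (snd N) (basis_vec (a', b'))"
    have w: "lookup ?w ((c, x), (d, y)) = cmat M x c a' * cmat N y d b'" for c x d y
      by (subst lookup_map_tensor[of "{(a', b')}"]) (use True in \<open>auto simp: lookup_basis_vec cmat_eq[OF M] cmat_eq[OF N]\<close>)
    have kw: "keys ?w \<subseteq> (?B \<times> U) \<times> (?C \<times> V)"
    proof
      fix z assume z: "z \<in> keys ?w"
      obtain c x d y where zz: "z = ((c, x), (d, y))" by (metis surj_pair)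
      have "cmat M x c a' \<noteq> 0" "cmat N y d b' \<noteq> 0" using z unfolding zz in_keys_iff w by auto
      then show "z \<in> (?B \<times> U) \<times> (?C \<times> V)"
        using zz U(2)[of x] V(2)[of y] msupp_cmat[of M x] msupp_cmat[of N y] unfolding msupp_def by fastforce
    qed
    have "cmat (comodule_tensor q M N) z (a, b) (a', b') = lookup (lin_ext P ?w) ((a, b), z)"
      using True by (subst cmat_eq[OF pre]) (auto simp: fst snd)
    also have "\<dots> = (\<Sum>((c, x), (d, y))\<in>(?B \<times> U) \<times> (?C \<times> V). cmat M x c a' * cmat N y d b' * (if a = c \<and> b = d then coef q x y z else 0))"
      by (subst lookup_lin_ext[OF _ kw]) (use fin U V in \<open>auto simp: case_prod_beta w P intro!: sum.cong\<close>)
    also have "\<dots> = (\<Sum>c\<in>?B. \<Sum>x\<in>U. \<Sum>d\<in>?C. \<Sum>y\<in>V. cmat M x c a' * cmat N y d b' * (if a = c \<and> b = d then coef q x y z else 0))"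
      by (simp only: sum.cartesian_product' case_prod_conv)
    also have "\<dots> = (\<Sum>c\<in>?B. \<Sum>x\<in>U. \<Sum>d\<in>?C. if d = b then (if c = a then \<Sum>y\<in>V. cmat M x a a' * cmat N y b b' * coef q x y z else 0) else 0)"
      by (intro sum.cong) auto
    also have "\<dots> = (\<Sum>c\<in>?B. \<Sum>x\<in>U. if c = a then \<Sum>y\<in>V. cmat M x a a' * cmat N y b b' * coef q x y z else 0)"
      using fin msuppD[OF msupp_cmat, of b N] by (intro sum.cong) auto
    also have "\<dots> = (\<Sum>c\<in>?B. if c = a then \<Sum>x\<in>U. \<Sum>y\<in>V. cmat M x a a' * cmat N y b b' * coef q x y z else 0)"
      by (intro sum.cong) auto
    also have "\<dots> = (\<Sum>x\<in>U. \<Sum>y\<in>V. cmat M x a a' * cmat N y b b' * coef q x y z)"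
      using fin msuppD[OF msupp_cmat, of a M] by auto
    finally show ?thesis by (simp add: mult_ac)
  next
    case False
    then have "cmat (comodule_tensor q M N) z (a, b) (a', b') = 0" by (auto simp: cmat_def fst)
    moreover have "coef q x y z * cmat M x a a' * cmat N y b b' = 0" for x y using False by (auto simp: cmat_def)
    ultimately show ?thesis by (simp only: sum.neutral_const)
  qed
qed

lemma fst_comodule_tensor [simp]: "fst (comodule_tensor q M N) = fst M \<times> fst N"
  by (simp add: comodule_tensor_def)

lemma comodule_sum:
  fixes M :: "('b, 'k::field) comod" and N :: "('c, 'k) comod"
  assumes M: "precomodule M" and N: "precomodule N"
  shows "precomodule (comodule_sum M N)"
    and "cmat (comodule_sum M N) p (Inl a) (Inl a') = cmat M p a a'"
    and "cmat (comodule_sum M N) p (Inr b) (Inr b') = cmat N p b b'"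
    and "cmat (comodule_sum M N) p (Inl a) (Inr b) = 0"
    and "cmat (comodule_sum M N) p (Inr b) (Inl a) = 0"
proof -
  let ?B = "fst M" and ?C = "fst N"
  have fst: "fst (comodule_sum M N) = ?B <+> ?C" by (simp add: comodule_sum_def)
  have L: "lookup (snd (comodule_sum M N) (basis_vec (Inl b))) (Inl a, x) = lookup (snd M (basis_vec b)) (a, x)" for a b x
    using lookup_lin_ext_inj[of "\<lambda>z. (Inl (fst z), snd z)" "snd M (basis_vec b)" "(a, x)"]
    by (simp add: comodule_sum_def case_prod_unfold inj_def prod_eq_iff)
  have R: "lookup (snd (comodule_sum M N) (basis_vec (Inr b))) (Inr a, x) = lookup (snd N (basis_vec b)) (a, x)" for a b x
    using lookup_lin_ext_inj[of "\<lambda>z. (Inr (fst z), snd z)" "snd N (basis_vec b)" "(a, x)"]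
    by (simp add: comodule_sum_def case_prod_unfold inj_def prod_eq_iff)
  have LR: "lookup (snd (comodule_sum M N) (basis_vec (Inr b))) (Inl a, x) = 0"
    "lookup (snd (comodule_sum M N) (basis_vec (Inl b'))) (Inr a', x) = 0" for a b a' b' x
    unfolding comodule_sum_def snd_conv lin_ext_basis_vec sum.case
    by (subst lookup_lin_ext[OF finite_keys order.refl], simp add: case_prod_beta lookup_basis_vec)+
  show pre: "precomodule (comodule_sum M N)"
    unfolding precomodule_def fst
  proof (intro conjI)
    show lin: "linear_from (?B <+> ?C) (snd (comodule_sum M N))"
      by (simp add: comodule_sum_def linear_from_lin_ext)
    show fin: "finite (?B <+> ?C)" using M N by (auto simp: precomodule_def)
    show "snd (comodule_sum M N) ` vspace (?B <+> ?C) \<subseteq> vspace ((?B <+> ?C) \<times> UNIV)"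
    proof (rule image_subsetI, rule vspaceI)
      fix w :: "'b + 'c \<Rightarrow>\<^sub>0 'k" and z assume w: "w \<in> vspace (?B <+> ?C)" and z: "z \<notin> (?B <+> ?C) \<times> (UNIV :: path set)"
      obtain s p where zz: "z = (s, p)" by (cases z)
      have "lookup (snd (comodule_sum M N) (basis_vec t)) (s, p) = 0" if "t \<in> ?B <+> ?C" for t
      proof (cases s)
        case (Inl a)
        then have "a \<notin> ?B" using z zz by auto
        then show ?thesis
          using that Inl by (cases t) (auto simp: L LR cmat_eq[OF M, symmetric] msuppD[OF msupp_cmat])
      next
        case (Inr a)
        then have "a \<notin> ?C" using z zz by auto
        then show ?thesis
          using that Inr by (cases t) (auto simp: R LR cmat_eq[OF N, symmetric] msuppD[OF msupp_cmat])
      qed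
      then show "lookup (snd (comodule_sum M N) w) z = 0"
        unfolding zz lookup_linear_from[OF lin fin w] by simp
    qed
  qed
  show "cmat (comodule_sum M N) p (Inl a) (Inl a') = cmat M p a a'"
    "cmat (comodule_sum M N) p (Inr b) (Inr b') = cmat N p b b'"
    "cmat (comodule_sum M N) p (Inl a) (Inr b) = 0"
    "cmat (comodule_sum M N) p (Inr b) (Inl a) = 0"
    by (auto simp: cmat_def fst L R LR)
qed

lemma fst_comodule_sum [simp]: "fst (comodule_sum M N) = fst M <+> fst N"
  by (simp add: comodule_sum_def)

section \<open>Decomposition into interval comodules\<close>

text \<open>The path \<open>(i, l)\<close> stands for the indecomposable comodule with weights \<open>i, \<dots>, i + l\<close>.
  The pair \<open>(s, k)\<close> labels the vector of weight \<open>i + k\<close> in the \<open>s\<close>-th summand.\<close>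

definition seg_labels :: "path list \<Rightarrow> (nat \<times> nat) set"
  where "seg_labels ps = (SIGMA s:{..<length ps}. {..snd (ps ! s)})"

definition seg_mat :: "path list \<Rightarrow> path \<Rightarrow> nat \<times> nat \<Rightarrow> nat \<times> nat \<Rightarrow> 'k::field"
  where "seg_mat ps p a b = (if a \<in> seg_labels ps \<and> b \<in> seg_labels ps \<and> fst a = fst b \<and>
    snd a = snd b + snd p \<and> fst p = fst (ps ! fst b) + int (snd b) then 1 else 0)"

definition segments :: "path list \<Rightarrow> (nat \<times> nat, 'k::field) comod"
  where "segments ps = mat_comodule (seg_labels ps) (seg_mat ps)"

lemma finite_seg_labels [simp]: "finite (seg_labels ps)"
  by (simp add: seg_labels_def)

lemma seg_labels_Nil [simp]: "seg_labels [] = {}"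
  by (simp add: seg_labels_def)

lemma seg_labels_iff: "(s, k) \<in> seg_labels ps \<longleftrightarrow> s < length ps \<and> k \<le> snd (ps ! s)"
  by (simp add: seg_labels_def)

lemma msupp_seg_mat: "msupp (seg_labels ps) (seg_labels ps) (seg_mat ps p)"
  by (rule msuppI) (auto simp: seg_mat_def split: if_splits)

lemma path_rep_seg_mat: "path_rep (seg_labels ps) (seg_mat ps :: _ \<Rightarrow> _ \<Rightarrow> _ \<Rightarrow> 'k::field)"
  unfolding path_rep_def
proof (intro conjI allI)
  let ?L = "seg_labels ps" and ?D = "seg_mat ps :: _ \<Rightarrow> _ \<Rightarrow> _ \<Rightarrow> 'k"
  fix i l i' l'
  show "mmult ?L (?D (i', l')) (?D (i, l)) = (if i' = i + int l then ?D (i, l + l') else (\<lambda>_ _. 0))"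
  proof (intro ext)
    fix a b :: "nat \<times> nat"
    let ?c = "(fst b, snd b + l)"
    have "mmult ?L (?D (i', l')) (?D (i, l)) a b = (\<Sum>c\<in>?L. if c = ?c then ?D (i', l') a c * ?D (i, l) c b else 0)"
      unfolding mmult_def by (rule sum.cong) (auto simp: seg_mat_def prod_eq_iff)
    also have "\<dots> = (if ?c \<in> ?L then ?D (i', l') a ?c * ?D (i, l) ?c b else 0)"
      by simp
    also have "\<dots> = (if i' = i + int l then ?D (i, l + l') else (\<lambda>_ _. 0)) a b"
      by (cases a; cases b) (auto simp: seg_mat_def seg_labels_iff)
    finally show "mmult ?L (?D (i', l')) (?D (i, l)) a b = (if i' = i + int l then ?D (i, l + l') else (\<lambda>_ _. 0)) a b" .
  qed
next
  let ?L = "seg_labels ps" and ?D = "seg_mat ps :: _ \<Rightarrow> _ \<Rightarrow> _ \<Rightarrow> 'k"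
  define w where "w = (\<lambda>b. fst (ps ! fst b) + int (snd b))"
  show "\<exists>I. finite I \<and> (\<forall>i. i \<notin> I \<longrightarrow> ?D (i, 0) = (\<lambda>_ _. 0)) \<and> (\<lambda>a b. \<Sum>i\<in>I. ?D (i, 0) a b) = idmat ?L"
  proof (intro exI[of _ "w ` ?L"] conjI allI impI ext)
    fix i a b assume i: "i \<notin> w ` ?L"
    show "?D (i, 0) a b = 0"
      using i by (auto simp: seg_mat_def w_def)
  next
    fix a b
    have "(\<Sum>i\<in>w ` ?L. ?D (i, 0) a b) = (\<Sum>i\<in>w ` ?L. if i = w b then idmat ?L a b else 0)"
      by (rule sum.cong) (auto simp: seg_mat_def w_def idmat_def dest: prod_eqI)
    then show "(\<Sum>i\<in>w ` ?L. ?D (i, 0) a b) = idmat ?L a b"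
      by (auto simp: idmat_def)
  qed simp
qed (simp_all add: msupp_seg_mat)

lemma fst_segments [simp]: "fst (segments ps) = seg_labels ps"
  by (simp add: segments_def)

lemma cmat_segments [simp]: "cmat (segments ps) = seg_mat ps"
  and fd_segments: "fd_comodule (segments ps)"
  and precomodule_segments: "precomodule (segments ps)"
  using fd_mat_comodule[OF path_rep_seg_mat, of ps, where 'b = 'a]
    fd_mat_comodule[OF path_rep_seg_mat, of ps, where 'b = 'b]
    fd_mat_comodule[OF path_rep_seg_mat, of ps, where 'b = 'c]
  by (auto simp: segments_def fd_comodule_iff)

lemma sum_seg_labels_snoc:
  "(\<Sum>x\<in>seg_labels (ps @ [p]). f x) = (\<Sum>x\<in>seg_labels ps. f x) + (\<Sum>k\<le>snd p. f (length ps, k))"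
proof -
  have eq: "seg_labels (ps @ [p]) = seg_labels ps \<union> Pair (length ps) ` {..snd p}"
    by (auto simp: seg_labels_def nth_append less_Suc_eq split: if_splits)
  show ?thesis
    unfolding eq by (subst sum.union_disjoint) (auto simp: seg_labels_def sum.reindex inj_on_def)
qed

text \<open>A longest path \<open>(i, l)\<close> acting nontrivially on the image of \<open>e\<close>, together with a nonzero entry
  of its matrix, splits off one interval; maximality of \<open>l\<close> makes both maps equivariant.\<close>

lemma split_off_segment:
  fixes D :: "path \<Rightarrow> 'b \<Rightarrow> 'b \<Rightarrow> 'k::field"
  assumes rep: "path_rep B D" and e: "msupp B B e" "mmult B e e = e" "\<And>p. mmult B (D p) e = mmult B e (D p)"
    and nz: "e \<noteq> (\<lambda>_ _. 0)"
  shows "\<exists>i l A A'. msupp B {..l} A \<and> msupp {..l} B A' \<and> mmult B e A = A \<and> mmult B A' e = A' \<and>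
    mmult B A' A = idmat {..l} \<and>
    (\<forall>j n. mmult B (D (j, n)) A =
      mmult {..l} A (\<lambda>k'' k. if k \<le> l \<and> k'' = k + n \<and> j = i + int k then 1 else 0)) \<and>
    (\<forall>p. mmult B (D p) (mmult {..l} A A') = mmult B (mmult {..l} A A') (D p))"
proof -
  have fin: "finite B" and supp: "\<And>p. msupp B B (D p)"
    and mult: "\<And>i l i' l'. mmult B (D (i', l')) (D (i, l)) = (if i' = i + int l then D (i, l + l') else (\<lambda>_ _. 0))"
    using rep unfolding path_rep_def by blast+
  obtain I where I: "finite I" "(\<lambda>a b. \<Sum>i\<in>I. D (i, 0) a b) = idmat B"
    using rep unfolding path_rep_def by blast
  define m where "m = (\<lambda>x. mmult B (D x) e)"
  define Z where "Z = {p. m p \<noteq> (\<lambda>_ _. 0)}"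
  have "finite Z"
    by (rule finite_subset[OF _ path_rep_finite[OF rep]]) (auto simp: Z_def m_def)
  moreover have "Z \<noteq> {}"
  proof
    assume "Z = {}"
    then have "m p = (\<lambda>_ _. 0)" for p unfolding Z_def by blast
    then have "mmult B (\<lambda>a b. \<Sum>i\<in>I. D (i, 0) a b) e = (\<lambda>_ _. 0)"
      unfolding mmult_sum_left by (simp add: m_def)
    then show False
      using nz by (simp add: I(2) mmult_idmat_left[OF fin e(1)])
  qed
  ultimately have "Max (snd ` Z) \<in> snd ` Z" by (intro Max_in) auto
  then obtain i l where il: "(i, l) \<in> Z" "l = Max (snd ` Z)" by auto
  have max: "m (j, n) = (\<lambda>_ _. 0)" if "n > l" for j n
  proof (rule ccontr)
    assume "m (j, n) \<noteq> (\<lambda>_ _. 0)"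
    then have "snd (j, n) \<in> snd ` Z" unfolding Z_def by blast
    then have "n \<le> l" using Max_ge[of "snd ` Z" n] \<open>finite Z\<close> il(2) by simp
    then show False using that by simp
  qed
  have me: "mmult B (m x) e = m x" for x by (simp add: m_def mmult_assoc e(2))
  have em: "mmult B e (m x) = m x" for x by (metis e(2,3) m_def mmult_assoc)
  have Dm: "mmult B (D (i', l')) (m (i, l)) = (if i' = i + int l then m (i, l + l') else (\<lambda>_ _. 0))" for i l i' l'
    unfolding m_def mmult_assoc[symmetric] mult by simp
  have mD: "mmult B (m (i', l')) (D (i, l)) = (if i' = i + int l then m (i, l + l') else (\<lambda>_ _. 0))" for i l i' l'
    unfolding Dm[symmetric] by (simp only: m_def mmult_assoc e(3)[symmetric])
  have mm: "mmult B (m (i', l')) (m (i, l)) = (if i' = i + int l then m (i, l + l') else (\<lambda>_ _. 0))" for i l i' l'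
  proof -
    have "mmult B (m (i', l')) (m (i, l)) = mmult B (mmult B (m (i', l')) (D (i, l))) e"
      by (simp add: m_def mmult_assoc)
    then show ?thesis by (simp add: mD me)
  qed
  have suppm: "msupp B B (m x)" for x unfolding m_def by (rule msupp_mmult[OF supp e(1)])
  obtain a b where ab: "m (i, l) a b \<noteq> 0" using il(1) by (fastforce simp: Z_def)
  define c where "c = m (i, l) a b"
  have c: "c \<noteq> 0" using ab by (simp add: c_def)
  \<comment> \<open>\<open>A\<close> collects column \<open>b\<close> and \<open>A'\<close> row
    \<open>a\<close> of matrices of subpaths of \<open>(i, l)\<close>. The entry
    \<open>(k, k')\<close> of \<open>A' A\<close> comes from the path \<open>(i, k')\<close>
    followed by \<open>(i + k, l - k)\<close>. These compose only for \<open>k = k'\<close>, and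
    then give \<open>c\<close>, which the division in \<open>A\<close> normalizes to 1.\<close>
  define A where "A = (\<lambda>a' k. if k \<le> l then m (i, k) a' b / c else 0)"
  define A' where "A' = (\<lambda>k b'. if k \<le> l then m (i + int k, l - k) a b' else 0)"
  define S :: "path \<Rightarrow> nat \<Rightarrow> nat \<Rightarrow> 'k"
    where "S = (\<lambda>p k'' k. if k \<le> l \<and> k'' \<le> l \<and> k'' = k + snd p \<and> fst p = i + int k then 1 else 0)"
  have left: "mmult B P A a' k = (if k \<le> l then mmult B P (m (i, k)) a' b / c else 0)" for P :: "'z \<Rightarrow> 'b \<Rightarrow> 'k" and a' k
    by (simp add: mmult_def A_def sum_divide_distrib)
  have right: "mmult B A' P k b' = (if k \<le> l then mmult B (m (i + int k, l - k)) P a b' else 0)" for P :: "'b \<Rightarrow> 'z \<Rightarrow> 'k" and b' k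
    by (simp add: mmult_def A'_def)
  have "msupp B {..l} A" "msupp {..l} B A'"
    using suppm by (auto intro!: msuppI simp: A_def A'_def msupp_def split: if_splits)
  moreover have "mmult B e A = A"
    by (intro ext) (simp add: left em, simp add: A_def)
  moreover have "mmult B A' e = A'"
    by (intro ext) (simp add: right me, simp add: A'_def)
  moreover have "mmult B A' A = idmat {..l}"
  proof (intro ext)
    fix k k'
    show "mmult B A' A k k' = idmat {..l} k k'"
    proof (cases "k \<le> l \<and> k' \<le> l")
      case True
      then have "mmult B A' A k k' = mmult B A' (m (i, k')) k b / c" by (simp add: left)
      also have "\<dots> = mmult B (m (i + int k, l - k)) (m (i, k')) a b / c" using True by (simp add: right)
      finally have "mmult B A' A k k' = mmult B (m (i + int k, l - k)) (m (i, k')) a b / c" .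
      then show ?thesis using True c by (auto simp: mm idmat_def c_def)
    next
      case False
      then have "(\<forall>b. A' k b = 0) \<or> (\<forall>b. A b k' = 0)" by (auto simp: A_def A'_def)
      then have "mmult B A' A k k' = 0" by (auto simp: mmult_def)
      then show ?thesis using False by (auto simp: idmat_def)
    qed
  qed
  moreover have DA: "mmult B (D p) A = mmult {..l} A (S p)" for p
  proof (intro ext)
    fix a' k
    obtain j n where p: "p = (j, n)" by (cases p)
    have "mmult {..l} A (S p) a' k = (\<Sum>k''\<le>l. if k'' = k + n then A a' (k + n) * S p (k + n) k else 0)"
      unfolding mmult_def by (rule sum.cong) (auto simp: S_def p)
    also have "\<dots> = (if k + n \<le> l then A a' (k + n) * S p (k + n) k else 0)" by simp
    finally show "mmult B (D p) A a' k = mmult {..l} A (S p) a' k"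
      unfolding left p Dm using max[of "k + n" i] by (auto simp: S_def A_def)
  qed
  moreover have A'D: "mmult B A' (D p) = mmult {..l} (S p) A'" for p
  proof (intro ext)
    fix k b'
    obtain j n where p: "p = (j, n)" by (cases p)
    have "mmult {..l} (S p) A' k b' = (\<Sum>k''\<le>l. if k'' = k - n then S p k (k - n) * A' (k - n) b' else 0)"
      unfolding mmult_def by (rule sum.cong) (auto simp: S_def p)
    also have "\<dots> = (if k - n \<le> l then S p k (k - n) * A' (k - n) b' else 0)" by simp
    finally have R: "mmult {..l} (S p) A' k b' = (if k - n \<le> l then S p k (k - n) * A' (k - n) b' else 0)" .
    show "mmult B A' (D p) k b' = mmult {..l} (S p) A' k b'"
    proof (cases "k \<le> l \<and> i + int k = j + int n")
      case True
      show ?thesis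
      proof (cases "n \<le> k")
        case nk: True
        obtain r where r: "k = n + r" using nk by (auto simp: le_iff_add)
        obtain t where t: "l = n + r + t" using True r by (auto simp: le_iff_add)
        show ?thesis unfolding R right unfolding p mD using True by (simp add: S_def A'_def r t)
      next
        case False
        \<comment> \<open>Here the path starts \<open>n - k\<close> steps before \<open>i\<close>,
          so the composite is longer than \<open>l\<close> and vanishes by maximality.\<close>
        then have "m (j, n + (l - k)) = (\<lambda>_ _. 0)" using True by (intro max) auto
        then show ?thesis unfolding R right unfolding p mD using True False by (simp add: S_def)
      qed
    next
      case False
      then show ?thesis unfolding R right unfolding p mD by (auto simp: S_def A'_def of_nat_diff)
    qed
  qed
  have "mmult B (D p) (mmult {..l} A A') = mmult B (mmult {..l} A A') (D p)" for p
    by (simp add: mmult_assoc[symmetric] DA) (simp add: mmult_assoc A'D)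
  moreover have "mmult {..l} A (S (j, n)) =
      mmult {..l} A (\<lambda>k'' k. if k \<le> l \<and> k'' = k + n \<and> j = i + int k then 1 else 0)" for j n
    unfolding mmult_def by (intro ext sum.cong) (auto simp: S_def)
  ultimately show ?thesis by (intro exI[of _ i] exI[of _ l] exI[of _ A] exI[of _ A']) simp
qed

text \<open>Induction on the rank of an idempotent commuting with the action. Splitting off the
  interval \<open>(i, l)\<close> removes an idempotent of trace \<open>l + 1\<close>, and the trace
  of the remainder is again a natural number.\<close>

lemma idempotent_decomposition:
  fixes D :: "path \<Rightarrow> 'b \<Rightarrow> 'b \<Rightarrow> 'k::field_char_0"
  assumes rep: "path_rep B D"
  shows "msupp B B e \<Longrightarrow> mmult B e e = e \<Longrightarrow> (\<And>p. mmult B (D p) e = mmult B e (D p)) \<Longrightarrow>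
    mtrace B e = of_nat r \<Longrightarrow>
    \<exists>ps A A'. msupp B (seg_labels ps) A \<and> msupp (seg_labels ps) B A' \<and> mmult (seg_labels ps) A A' = e \<and>
      mmult B A' A = idmat (seg_labels ps) \<and> (\<forall>p. mmult B (D p) A = mmult (seg_labels ps) A (seg_mat ps p))"
proof (induction r arbitrary: e rule: less_induct)
  case (less r)
  have fin: "finite B" using rep by (simp add: path_rep_def)
  show ?case
  proof (cases "e = (\<lambda>_ _. 0)")
    case True
    show ?thesis
      by (rule exI[of _ "[]"], rule exI[of _ "\<lambda>_ _. 0"], rule exI[of _ "\<lambda>_ _. 0"])
        (simp add: True msupp_zero, simp add: idmat_def)
  next
    case False
    obtain i l A A' where
      A: "msupp B {..l} A" "msupp {..l} B A'" "mmult B e A = A" "mmult B A' e = A'"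
        "mmult B A' A = idmat {..l}"
      and DA: "\<And>j n. mmult B (D (j, n)) A = mmult {..l} A (\<lambda>k'' k. if k \<le> l \<and> k'' = k + n \<and> j = i + int k then 1 else 0)"
      and DAA: "\<And>p. mmult B (D p) (mmult {..l} A A') = mmult B (mmult {..l} A A') (D p)"
      using split_off_segment[OF rep less.prems(1-3) False] by blast
    define f where "f = mmult {..l} A A'"
    define e1 where "e1 = (\<lambda>a b. e a b - f a b)"
    have fA: "mmult B f A = A"
      by (simp add: f_def mmult_assoc A(5) mmult_idmat_right[OF _ A(1)])
    have A'f: "mmult B A' f = A'"
      unfolding f_def mmult_assoc[symmetric] A(5) by (simp add: mmult_idmat_left[OF _ A(2)])
    have ef: "mmult B e f = f" by (simp add: f_def mmult_assoc[symmetric] A(3))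
    have fe: "mmult B f e = f" by (simp add: f_def mmult_assoc A(4))
    have ff: "mmult B f f = f" by (metis fA f_def mmult_assoc)
    have e1A: "mmult B e1 A = (\<lambda>_ _. 0)" by (simp add: e1_def mmult_diff_left A(3) fA)
    have A'e1: "mmult B A' e1 = (\<lambda>_ _. 0)" by (simp add: e1_def mmult_diff_right A(4) A'f)
    have e1: "mmult B e1 e1 = e1"
      unfolding e1_def mmult_diff_left mmult_diff_right by (simp add: ef fe ff less.prems(2))
    have suppf: "msupp B B f" unfolding f_def by (rule msupp_mmult[OF A(1,2)])
    have supp1: "msupp B B e1"
    proof (rule msuppI, rule ccontr)
      fix a b assume "e1 a b \<noteq> 0" "\<not> (a \<in> B \<and> b \<in> B)"
      then show False
        using msuppD[OF less.prems(1), of a b] msuppD[OF suppf, of a b] by (auto simp: e1_def)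
    qed
    have "mtrace B f = of_nat (Suc l)"
      unfolding f_def by (subst mtrace_mmult_commute) (simp add: A(5) mtrace_idmat)
    then have tr: "mtrace B e1 = of_nat r - of_nat (Suc l)"
      unfolding e1_def mtrace_diff less.prems(4) by simp
    obtain r1 where r1: "mtrace B e1 = of_nat r1"
      using idempotent_trace_nat[OF fin supp1 e1] by blast
    \<comment> \<open>In characteristic 0 this equation in the field holds between the natural
      numbers themselves, so the rank has strictly dropped.\<close>
    have "of_nat (r1 + Suc l) = (of_nat r :: 'k)" using tr r1 by (simp add: algebra_simps)
    then have "r1 < r" by (simp only: of_nat_eq_iff)
    moreover have "mmult B (D p) e1 = mmult B e1 (D p)" for p
      unfolding e1_def mmult_diff_left mmult_diff_right less.prems(3) f_def DAA ..
    ultimately obtain ps P P' where P: "msupp B (seg_labels ps) P" "msupp (seg_labels ps) B P'"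
        "mmult (seg_labels ps) P P' = e1" "mmult B P' P = idmat (seg_labels ps)"
        "\<And>p. mmult B (D p) P = mmult (seg_labels ps) P (seg_mat ps p)"
      using less.IH[OF _ supp1 e1 _ r1] by blast
    have eP: "mmult B e1 P = P"
      unfolding P(3)[symmetric] mmult_assoc P(4) by (rule mmult_idmat_right[OF _ P(1)]) simp
    have Pe: "mmult B P' e1 = P'"
      unfolding P(3)[symmetric] mmult_assoc[symmetric] P(4) by (rule mmult_idmat_left[OF _ P(2)]) simp
    \<comment> \<open>The new interval is orthogonal to the others: \<open>P\<close> and
      \<open>P'\<close> are fixed by \<open>e1\<close>, which annihilates \<open>A\<close> and
      \<open>A'\<close>.\<close>
    have "mmult B A' P = mmult B (mmult B A' e1) P" by (simp only: mmult_assoc eP)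
    then have A'P: "mmult B A' P = (\<lambda>_ _. 0)" by (simp add: A'e1)
    have "mmult B P' A = mmult B P' (mmult B e1 A)" by (simp only: mmult_assoc[symmetric] Pe)
    then have P'A: "mmult B P' A = (\<lambda>_ _. 0)" by (simp add: e1A)
    let ?n = "length ps" and ?qs = "ps @ [(i, l)]"
    \<comment> \<open>The interval just split off becomes the last summand, with index
      \<open>length ps\<close>; the other summands keep their labels.\<close>
    define Q where "Q = (\<lambda>a x. if fst x < ?n then P a x else if fst x = ?n then A a (snd x) else 0)"
    define Q' where "Q' = (\<lambda>x b. if fst x < ?n then P' x b else if fst x = ?n then A' (snd x) b else 0)"
    have lab: "x \<in> seg_labels ?qs \<longleftrightarrow> x \<in> seg_labels ps \<or> fst x = ?n \<and> snd x \<le> l" for x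
      by (cases x) (auto simp: seg_labels_iff nth_append)
    have lt: "fst x < ?n" if "x \<in> seg_labels ps" for x
      using that by (cases x) (auto simp: seg_labels_iff)
    have "msupp B (seg_labels ?qs) Q" "msupp (seg_labels ?qs) B Q'"
      using P(1,2) A(1,2) by (auto intro!: msuppI simp: Q_def Q'_def lab msupp_def split: if_splits)
    moreover have "mmult (seg_labels ?qs) Q Q' = e"
    proof (intro ext)
      fix a b
      have "mmult (seg_labels ?qs) Q Q' a b = mmult (seg_labels ps) P P' a b + mmult {..l} A A' a b"
        unfolding mmult_def sum_seg_labels_snoc by (simp add: Q_def Q'_def lt)
      then show "mmult (seg_labels ?qs) Q Q' a b = e a b" by (simp add: P(3) e1_def f_def)
    qed
    moreover have "mmult B Q' Q = idmat (seg_labels ?qs)"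
    proof (intro ext)
      fix x y
      have 1: "mmult B P' P x y = idmat (seg_labels ps) x y" "mmult B A' A (snd x) (snd y) = idmat {..l} (snd x) (snd y)"
        "mmult B A' P (snd x) y = 0" "mmult B P' A x (snd y) = 0" using P(4) A(5) A'P P'A by simp_all
      have "mmult B Q' Q x y = (if fst x < ?n then (if fst y < ?n then mmult B P' P x y else if fst y = ?n then mmult B P' A x (snd y) else 0)
        else if fst x = ?n then (if fst y < ?n then mmult B A' P (snd x) y else if fst y = ?n then mmult B A' A (snd x) (snd y) else 0) else 0)"
        by (simp add: mmult_def Q_def Q'_def)
      then show "mmult B Q' Q x y = idmat (seg_labels ?qs) x y"
        unfolding 1 using lt[of x] lt[of y] by (auto simp: idmat_def lab prod_eq_iff)
    qed
    moreover have "mmult B (D p) Q = mmult (seg_labels ?qs) Q (seg_mat ?qs p)" for p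
    proof (intro ext)
      fix a y
      obtain j n where p: "p = (j, n)" by (cases p)
      have 1: "mmult B (D p) P a y = mmult (seg_labels ps) P (seg_mat ps p) a y" using P(5) by simp
      have 2: "mmult B (D p) A a (snd y) = (\<Sum>k\<le>l. A a k * (if snd y \<le> l \<and> k = snd y + n \<and> j = i + int (snd y) then 1 else 0))"
        unfolding p DA by (simp add: mmult_def)
      have L: "mmult B (D p) Q a y = (if fst y < ?n then mmult B (D p) P a y else if fst y = ?n then mmult B (D p) A a (snd y) else 0)"
        by (simp add: mmult_def Q_def)
      have R: "mmult (seg_labels ?qs) Q (seg_mat ?qs p) a y =
          (\<Sum>x\<in>seg_labels ps. P a x * seg_mat ?qs p x y) + (\<Sum>k\<le>l. A a k * seg_mat ?qs p (?n, k) y)"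
        unfolding mmult_def sum_seg_labels_snoc by (simp add: Q_def lt)
      consider "fst y < ?n" | "fst y = ?n" | "fst y > ?n" by linarith
      then show "mmult B (D p) Q a y = mmult (seg_labels ?qs) Q (seg_mat ?qs p) a y"
      proof cases
        case 1
        then have "seg_mat ?qs p x y = (seg_mat ps p x y :: 'k)" if "x \<in> seg_labels ps" for x
          using that lt by (auto simp: seg_mat_def lab nth_append)
        moreover have "seg_mat ?qs p (?n, k) y = (0 :: 'k)" for k
          using 1 by (simp add: seg_mat_def)
        ultimately show ?thesis using 1 unfolding L R \<open>mmult B (D p) P a y = _\<close> by (simp add: mmult_def)
      next
        case 2
        then have "seg_mat ?qs p x y = (0 :: 'k)" if "x \<in> seg_labels ps" for x
          using lt[OF that] by (simp add: seg_mat_def)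
        moreover have "seg_mat ?qs p (?n, k) y = (if snd y \<le> l \<and> k = snd y + n \<and> j = i + int (snd y) then 1 else 0 :: 'k)" if "k \<le> l" for k
          using 2 that lt[of y] by (auto simp: seg_mat_def lab p nth_append)
        ultimately show ?thesis using 2 unfolding L R \<open>mmult B (D p) A a (snd y) = _\<close> by simp
      next
        case 3
        then have "seg_mat ?qs p x y = (0 :: 'k)" for x
          using lt[of y] by (auto simp: seg_mat_def lab)
        then show ?thesis using 3 unfolding L R by simp
      qed
    qed
    ultimately show ?thesis by blast
  qed
qed

theorem comodule_decomposition:
  fixes M :: "('b, 'k::field_char_0) comod"
  assumes "fd_comodule M"
  obtains ps where "cm_iso (segments ps) M"
proof -
  have rep: "path_rep (fst M) (cmat M)" and fin: "finite (fst M)" and supp: "\<And>p. msupp (fst M) (fst M) (cmat M p)"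
    using assms by (auto simp: fd_comodule_iff path_rep_def)
  let ?e = "idmat (fst M) :: 'b \<Rightarrow> 'b \<Rightarrow> 'k"
  have "mmult (fst M) ?e ?e = ?e" by (rule mmult_idmat_left[OF fin msupp_idmat])
  moreover have "mmult (fst M) (cmat M p) ?e = mmult (fst M) ?e (cmat M p)" for p
    by (simp add: mmult_idmat_left[OF fin supp] mmult_idmat_right[OF fin supp])
  ultimately obtain ps A A' where "msupp (fst M) (seg_labels ps) A" "msupp (seg_labels ps) (fst M) A'"
      "mmult (seg_labels ps) A A' = ?e" "mmult (fst M) A' A = idmat (seg_labels ps)"
      "\<And>p. mmult (fst M) (cmat M p) A = mmult (seg_labels ps) A (seg_mat ps p)"
    using idempotent_decomposition[OF rep msupp_idmat _ _ mtrace_idmat] by metis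
  then have "cm_iso (segments ps) M" unfolding rep_iso_def by auto
  then show ?thesis by (rule that)
qed

section \<open>Ranks of block matrices and of interval comodules\<close>

text \<open>Generalized inverses of the blocks assemble to one of the whole matrix. The map
  \<open>\<beta>\<close> names the block of a label, and \<open>h j\<close> identifies block
  \<open>j\<close> with the index set of \<open>E j\<close>; with a single block this is a rule for
  relabelling.\<close>

lemma has_rank_blocks:
  fixes D :: "'b \<Rightarrow> 'b \<Rightarrow> 'k::comm_ring_1" and E :: "'j \<Rightarrow> 'c \<Rightarrow> 'c \<Rightarrow> 'k"
  assumes fin: "finite B" "finite J" and supp: "msupp B B D"
    and \<beta>: "\<And>a. a \<in> B \<Longrightarrow> \<beta> a \<in> J" and block: "\<And>a b. D a b \<noteq> 0 \<Longrightarrow> \<beta> a = \<beta> b"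
    and h: "\<And>j. j \<in> J \<Longrightarrow> bij_betw (h j) (C j) {a \<in> B. \<beta> a = j}"
    and eq: "\<And>j c c'. j \<in> J \<Longrightarrow> c \<in> C j \<Longrightarrow> c' \<in> C j \<Longrightarrow> D (h j c) (h j c') = E j c c'"
    and rank: "\<And>j. j \<in> J \<Longrightarrow> has_rank (C j) (E j) (t j)"
  shows "has_rank B D (\<Sum>j\<in>J. t j)"
proof -
  \<comment> \<open>\<open>blk P R\<close> says that \<open>P\<close> is block diagonal with blocks
    \<open>R\<close>. The relation respects products and traces and determines \<open>P\<close>, so
    the rank equations can be checked in each block.\<close>
  define blk :: "('b \<Rightarrow> 'b \<Rightarrow> 'k) \<Rightarrow> ('j \<Rightarrow> 'c \<Rightarrow> 'c \<Rightarrow> 'k) \<Rightarrow> bool"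
    where "blk = (\<lambda>P R. (\<forall>a b. P a b \<noteq> 0 \<longrightarrow> a \<in> B \<and> b \<in> B \<and> \<beta> a = \<beta> b) \<and>
      (\<forall>j\<in>J. \<forall>c\<in>C j. \<forall>c'\<in>C j. P (h j c) (h j c') = R j c c'))"
  have sum_block: "(\<Sum>b\<in>{a \<in> B. \<beta> a = j}. f b) = (\<Sum>c\<in>C j. f (h j c))" if "j \<in> J" for j and f :: "'b \<Rightarrow> 'k"
    using sum.reindex_bij_betw[OF h[OF that], of f] by simp
  have hB: "h j c \<in> B" "\<beta> (h j c) = j" if "j \<in> J" "c \<in> C j" for j c
    using h[OF that(1)] that(2) by (auto simp: bij_betw_def)
  have blk_mult: "blk (mmult B P P') (\<lambda>j. mmult (C j) (R j) (R' j))" if P: "blk P R" "blk P' R'" for P P' R R'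
    unfolding blk_def
  proof (intro conjI allI impI ballI)
    fix a b assume "mmult B P P' a b \<noteq> 0"
    then obtain c where "P a c * P' c b \<noteq> 0" unfolding mmult_def by (meson sum.neutral)
    then have "P a c \<noteq> 0" "P' c b \<noteq> 0" by auto
    then show "a \<in> B" "b \<in> B" "\<beta> a = \<beta> b" using P unfolding blk_def by metis+
  next
    fix j c c' assume j: "j \<in> J" "c \<in> C j" "c' \<in> C j"
    have "mmult B P P' (h j c) (h j c') = (\<Sum>b\<in>{a \<in> B. \<beta> a = j}. P (h j c) b * P' b (h j c'))"
      unfolding mmult_def
    proof (rule sum.mono_neutral_right)
      have "P (h j c) b = 0" if "\<beta> b \<noteq> j" for b
        using P(1) that hB(2)[OF j(1,2)] unfolding blk_def by metis
      then show "\<forall>b\<in>B - {a \<in> B. \<beta> a = j}. P (h j c) b * P' b (h j c') = 0" by auto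
    qed (use fin in auto)
    also have "\<dots> = mmult (C j) (R j) (R' j) c c'"
      unfolding sum_block[OF j(1)] mmult_def
      using P j by (intro sum.cong) (auto simp: blk_def)
    finally show "mmult B P P' (h j c) (h j c') = mmult (C j) (R j) (R' j) c c'" .
  qed
  have blk_eq: "P = P'" if P: "blk P R" "blk P' R" for P P' R
  proof (intro ext)
    fix a b
    show "P a b = P' a b"
    proof (cases "a \<in> B \<and> b \<in> B \<and> \<beta> a = \<beta> b")
      case True
      then have j: "\<beta> a \<in> J" using \<beta> by blast
      have "a \<in> h (\<beta> a) ` C (\<beta> a)" "b \<in> h (\<beta> a) ` C (\<beta> a)"
        using h[OF j] True by (auto simp: bij_betw_def)
      then obtain c c' where "c \<in> C (\<beta> a)" "c' \<in> C (\<beta> a)" "a = h (\<beta> a) c" "b = h (\<beta> a) c'"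
        by blast
      then show ?thesis using P j unfolding blk_def by metis
    next
      case False
      then have "P a b = 0" "P' a b = 0" using P unfolding blk_def by metis+
      then show ?thesis by simp
    qed
  qed
  have blk_trace: "mtrace B P = (\<Sum>j\<in>J. mtrace (C j) (R j))" if P: "blk P R" for P R
  proof -
    have "mtrace B P = (\<Sum>j\<in>J. \<Sum>b\<in>{a \<in> B. \<beta> a = j}. P b b)"
      unfolding mtrace_def using fin \<beta> by (intro sum.group[symmetric]) auto
    also have "\<dots> = (\<Sum>j\<in>J. mtrace (C j) (R j))"
      unfolding mtrace_def using P by (intro sum.cong refl) (simp add: sum_block blk_def)
    finally show ?thesis .
  qed
  obtain G where G: "\<And>j. j \<in> J \<Longrightarrow> mmult (C j) (mmult (C j) (E j) (G j)) (E j) = E j"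
    "\<And>j. j \<in> J \<Longrightarrow> mtrace (C j) (mmult (C j) (E j) (G j)) = t j"
    using rank unfolding has_rank_def by metis
  define g where "g = (\<lambda>a b. if a \<in> B \<and> b \<in> B \<and> \<beta> a = \<beta> b then
    G (\<beta> a) (inv_into (C (\<beta> a)) (h (\<beta> a)) a) (inv_into (C (\<beta> a)) (h (\<beta> a)) b) else 0)"
  have blkD: "blk D E" using supp block eq by (auto simp: blk_def msupp_def)
  have "inv_into (C j) (h j) (h j c) = c" if "j \<in> J" "c \<in> C j" for j c
    using h[OF that(1)] that(2) by (simp add: bij_betw_def)
  then have "blk g G" by (auto simp: blk_def g_def hB split: if_splits)
  then have "blk (mmult B D g) (\<lambda>j. mmult (C j) (E j) (G j))"
    by (rule blk_mult[OF blkD])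
  moreover from blk_mult[OF this blkD] have "blk (mmult B (mmult B D g) D) E"
    by (auto simp: blk_def G(1))
  then have "mmult B (mmult B D g) D = D" using blkD blk_eq by blast
  ultimately show ?thesis
    unfolding has_rank_def using blk_trace[of "mmult B D g"] G(2) by (intro exI[of _ g]) auto
qed

text \<open>The transpose is a generalized inverse, and \<open>D G\<close> is the coordinate
  projection onto \<open>Z\<close>.\<close>

lemma has_rank_partial_injection:
  fixes D :: "'b \<Rightarrow> 'b \<Rightarrow> 'k::comm_ring_1"
  assumes fin: "finite B" and Z: "Z \<subseteq> B" "f ` Z \<subseteq> B" "inj_on f Z"
    and D: "\<And>a b. D a b = (if a \<in> Z \<and> b = f a then 1 else 0)"
  shows "has_rank B D (of_nat (card Z))"
proof -
  define G :: "'b \<Rightarrow> 'b \<Rightarrow> 'k" where "G = (\<lambda>a b. D b a)"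
  have DG: "mmult B D G a b = (if a = b \<and> a \<in> Z then 1 else 0)" for a b
  proof -
    have "mmult B D G a b = (\<Sum>c\<in>B. if c = f a then (if a \<in> Z \<and> b \<in> Z \<and> f a = f b then 1 else 0) else 0)"
      unfolding mmult_def G_def D by (rule sum.cong) auto
    then show ?thesis using fin Z by (auto dest: inj_onD)
  qed
  have "mmult B (mmult B D G) D a b = D a b" for a b
  proof -
    have "mmult B (mmult B D G) D a b = (\<Sum>c\<in>B. if c = a then (if a \<in> Z then D a b else 0) else 0)"
      unfolding mmult_def[of B "mmult B D G"] DG by (rule sum.cong) auto
    then show ?thesis using fin Z by (auto simp: D)
  qed
  moreover have "mtrace B (mmult B D G) = of_nat (card Z)"
  proof -
    have "mtrace B (mmult B D G) = (\<Sum>a\<in>{a \<in> B. a \<in> Z}. 1)"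
      by (simp only: mtrace_def DG sum.inter_filter[OF fin]) simp
    moreover have "{a \<in> B. a \<in> Z} = Z" using Z by auto
    ultimately show ?thesis by simp
  qed
  ultimately show ?thesis unfolding has_rank_def by blast
qed

text \<open>The last hypothesis makes \<open>D\<close> the product of column \<open>c\<close> and
  row \<open>r\<close> divided by the pivot. The inverse of the pivot in the transposed position is
  then a generalized inverse.\<close>

lemma has_rank_1:
  fixes D :: "'b \<Rightarrow> 'b \<Rightarrow> 'k::field"
  assumes fin: "finite B" and rc: "r \<in> B" "c \<in> B" "D r c \<noteq> 0"
    and D: "\<And>a b. D a b * D r c = D a c * D r b"
  shows "has_rank B D 1"
proof -
  define G :: "'b \<Rightarrow> 'b \<Rightarrow> 'k" where "G = (\<lambda>a b. if a = c \<and> b = r then inverse (D r c) else 0)"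
  have DG: "mmult B D G a b = (if b = r then D a c / D r c else 0)" for a b
  proof -
    have "mmult B D G a b = (\<Sum>d\<in>B. if d = c then (if b = r then D a c / D r c else 0) else 0)"
      unfolding mmult_def G_def by (rule sum.cong) (auto simp: divide_inverse)
    then show ?thesis using fin rc by simp
  qed
  have "mmult B (mmult B D G) D a b = D a b" for a b
  proof -
    have "mmult B (mmult B D G) D a b = (\<Sum>d\<in>B. if d = r then D a c / D r c * D r b else 0)"
      unfolding mmult_def[of B "mmult B D G"] DG by (rule sum.cong) auto
    moreover have "D a b = D a c / D r c * D r b" using rc D[of a b] by (simp add: field_simps)
    ultimately show ?thesis using fin rc by simp
  qed
  moreover have "mtrace B (mmult B D G) = 1"
    unfolding mtrace_def DG using fin rc by simp
  ultimately show ?thesis unfolding has_rank_def by blast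
qed

text \<open>All nonzero entries lie in a lower triangular two by two block with nonzero diagonal.
  \<open>G\<close> is the inverse of that block; its third case is the off-diagonal entry.\<close>

lemma has_rank_2:
  fixes D :: "'b \<Rightarrow> 'b \<Rightarrow> 'k::field"
  assumes fin: "finite B" and rc: "r1 \<in> B" "r2 \<in> B" "c1 \<in> B" "c2 \<in> B" "r1 \<noteq> r2" "c1 \<noteq> c2"
    and D: "\<And>a b. D a b \<noteq> 0 \<Longrightarrow> (a = r1 \<or> a = r2) \<and> (b = c1 \<or> b = c2)"
    and tri: "D r1 c1 \<noteq> 0" "D r2 c2 \<noteq> 0" "D r1 c2 = 0"
  shows "has_rank B D 2"
proof -
  define G :: "'b \<Rightarrow> 'b \<Rightarrow> 'k" where "G = (\<lambda>a b.
    if a = c1 \<and> b = r1 then inverse (D r1 c1)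
    else if a = c2 \<and> b = r2 then inverse (D r2 c2)
    else if a = c2 \<and> b = r1 then - D r2 c1 / (D r1 c1 * D r2 c2) else 0)"
  have DG: "mmult B D G a b = (if a = b \<and> (a = r1 \<or> a = r2) then 1 else 0)" for a b
  proof -
    have "mmult B D G a b = (\<Sum>d\<in>{c1, c2}. D a d * G d b)"
      unfolding mmult_def by (rule sum.mono_neutral_right) (use fin rc D in \<open>auto simp: G_def\<close>)
    also have "\<dots> = D a c1 * G c1 b + D a c2 * G c2 b" using rc by simp
    also have "\<dots> = (if a = b \<and> (a = r1 \<or> a = r2) then 1 else 0)"
    proof -
      consider "a = r1" | "a = r2" | "D a c1 = 0" "D a c2 = 0" "a \<noteq> r1" "a \<noteq> r2"
        using D[of a c1] D[of a c2] by blast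
      then show ?thesis
        using rc tri by cases (auto simp: G_def field_simps)
    qed
    finally show ?thesis .
  qed
  have "mmult B (mmult B D G) D a b = D a b" for a b
  proof -
    have "mmult B (mmult B D G) D a b = (\<Sum>d\<in>B. if d = a then (if a = r1 \<or> a = r2 then D a b else 0) else 0)"
      unfolding mmult_def[of B "mmult B D G"] DG by (rule sum.cong) auto
    then show ?thesis using fin rc D[of a b] by auto
  qed
  moreover have "mtrace B (mmult B D G) = 2"
  proof -
    have "mtrace B (mmult B D G) = (\<Sum>a\<in>{r1, r2}. 1)"
      unfolding mtrace_def DG by (rule sum.mono_neutral_cong_right) (use fin rc in auto)
    then show ?thesis using rc by simp
  qed
  ultimately show ?thesis unfolding has_rank_def by blast
qed

text \<open>A path acts on an interval with rank one if it runs inside it and as zero otherwise. The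
  same order bounds the intervals that occur in a product.\<close>

definition subpath :: "path \<Rightarrow> path \<Rightarrow> bool"
  where "subpath x p \<longleftrightarrow> fst p \<le> fst x \<and> fst x + int (snd x) \<le> fst p + int (snd p)"

lemma has_rank_seg_mat:
  "has_rank (seg_labels ps) (seg_mat ps x) (\<Sum>s<length ps. if subpath x (ps ! s) then 1 else 0 :: 'k::field)"
proof -
  obtain i l where x: "x = (i, l)" by (cases x)
  \<comment> \<open>The labels at which \<open>x\<close> can end; the start lies \<open>l\<close>
    steps below in the same summand, so the matrix is a partial injection.\<close>
  define Z where "Z = {a \<in> seg_labels ps. l \<le> snd a \<and> i = fst (ps ! fst a) + int (snd a - l)}"
  define W where "W = {s. s < length ps \<and> subpath x (ps ! s)}"
  have "has_rank (seg_labels ps) (seg_mat ps x) (of_nat (card Z) :: 'k)"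
  proof (rule has_rank_partial_injection[where f = "\<lambda>a. (fst a, snd a - l)"])
    show "(\<lambda>a. (fst a, snd a - l)) ` Z \<subseteq> seg_labels ps"
      by (auto simp: Z_def seg_labels_iff)
    show "inj_on (\<lambda>a. (fst a, snd a - l)) Z"
      by (auto simp: inj_on_def Z_def prod_eq_iff)
    fix a b :: "nat \<times> nat"
    show "seg_mat ps x a b = (if a \<in> Z \<and> b = (fst a, snd a - l) then 1 else 0 :: 'k)"
      by (cases a; cases b) (auto simp: seg_mat_def x Z_def seg_labels_iff)
  qed (auto simp: Z_def)
  moreover have "Z = (\<lambda>s. (s, nat (i - fst (ps ! s)) + l)) ` W"
    by (force simp: Z_def W_def seg_labels_def subpath_def x image_iff)
  then have "card Z = card W" by (simp add: card_image inj_on_def)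
  moreover have "of_nat (card W) = (\<Sum>s<length ps. if subpath x (ps ! s) then 1 else 0 :: 'k)"
  proof -
    have W: "W = {s \<in> {..<length ps}. subpath x (ps ! s)}" by (auto simp: W_def)
    show ?thesis unfolding W by (simp add: sum.inter_filter[symmetric])
  qed
  ultimately show ?thesis by simp
qed

section \<open>Tensor products\<close>

definition seg_weight :: "path list \<Rightarrow> nat \<times> nat \<Rightarrow> int"
  where "seg_weight ps a = fst (ps ! fst a) + int (snd a)"

lemma seg_mat_alt:
  "seg_mat ps x a b = (if a \<in> seg_labels ps \<and> b \<in> seg_labels ps \<and> fst a = fst b \<and> snd b \<le> snd a \<and>
    x = (seg_weight ps b, snd a - snd b) then 1 else 0)"
  by (cases x) (auto simp: seg_mat_def seg_weight_def)

definition seg_le :: "path list \<Rightarrow> nat \<times> nat \<Rightarrow> nat \<times> nat \<Rightarrow> bool"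
  where "seg_le ps b a \<longleftrightarrow> a \<in> seg_labels ps \<and> b \<in> seg_labels ps \<and> fst a = fst b \<and> snd b \<le> snd a"

text \<open>In each factor only the path from the source label to the target label contributes, so
  the double sum collapses to a single structure constant.\<close>

lemma cmat_tensor_segments:
  fixes q :: "'k::field"
  shows "cmat (comodule_tensor q (segments ps) (segments qs)) z (a1, a2) (b1, b2) =
    (if seg_le ps b1 a1 \<and> seg_le qs b2 a2 \<and> fst z = seg_weight ps b1 + seg_weight qs b2 \<and>
        snd z = (snd a1 - snd b1) + (snd a2 - snd b2)
     then q powi (seg_weight ps b1 * int (snd a2 - snd b2)) * gauss_binom q (snd a1 - snd b1) (snd a2 - snd b2)
     else 0)"
proof -
  let ?x = "(seg_weight ps b1, snd a1 - snd b1)" and ?y = "(seg_weight qs b2, snd a2 - snd b2)"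
  let ?M = "segments ps :: (_, 'k) comod" and ?N = "segments qs :: (_, 'k) comod"
  define U where "U = insert ?x {x. cmat ?M x \<noteq> (\<lambda>_ _. 0)}"
  define V where "V = insert ?y {x. cmat ?N x \<noteq> (\<lambda>_ _. 0)}"
  have UV: "finite U" "finite V"
    unfolding U_def V_def by (simp_all only: finite_insert precomodule_finite precomodule_segments)
  have "cmat (comodule_tensor q ?M ?N) z (a1, a2) (b1, b2) =
    (\<Sum>x\<in>U. \<Sum>y\<in>V. coef q x y z * cmat ?M x a1 b1 * cmat ?N y a2 b2)"
    by (rule comodule_tensor(2)[OF precomodule_segments precomodule_segments UV]) (auto simp: U_def V_def)
  also have "\<dots> = (\<Sum>x\<in>U. if x = ?x then (\<Sum>y\<in>V. if y = ?y then
      (if seg_le ps b1 a1 \<and> seg_le qs b2 a2 then coef q ?x ?y z else 0) else 0) else 0)"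
    by (intro sum.cong refl) (auto simp: seg_mat_alt seg_le_def intro!: sum.neutral sum.cong)
  also have "\<dots> = (if seg_le ps b1 a1 \<and> seg_le qs b2 a2 then coef q ?x ?y z else 0)"
    using UV by (simp add: U_def V_def)
  finally show ?thesis by (auto simp: coef_def prod_eq_iff)
qed

text \<open>Composing two paths in the tensor product sums over all ways to share the first
  \<open>l\<close> steps between the factors, and this sum is the q-Vandermonde identity.
  Compatibility of product and coproduct is thus verified on interval labels only.\<close>

lemma fd_tensor_segments:
  fixes q :: "'k::field"
  assumes q: "q \<noteq> 0"
  shows "fd_comodule (comodule_tensor q (segments ps) (segments qs))"
proof -
  let ?M = "comodule_tensor q (segments ps) (segments qs)"
  let ?L = "seg_labels ps \<times> seg_labels qs"
  let ?w = "\<lambda>b. seg_weight ps (fst b) + seg_weight qs (snd b)"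
  have pre: "precomodule ?M" by (rule comodule_tensor(1)[OF precomodule_segments precomodule_segments])
  define le where "le = (\<lambda>b a. seg_le ps (fst b) (fst a) \<and> seg_le qs (snd b) (snd a))"
  define n1 where "n1 = (\<lambda>(a :: (nat \<times> nat) \<times> nat \<times> nat) (b :: (nat \<times> nat) \<times> nat \<times> nat). snd (fst a) - snd (fst b) :: nat)"
  define n2 where "n2 = (\<lambda>(a :: (nat \<times> nat) \<times> nat \<times> nat) (b :: (nat \<times> nat) \<times> nat \<times> nat). snd (snd a) - snd (snd b) :: nat)"
  define g where "g = (\<lambda>a b. q powi (seg_weight ps (fst b) * int (n2 a b)) * gauss_binom q (n1 a b) (n2 a b))"
  have D: "cmat ?M z a b = (if le b a \<and> fst z = ?w b \<and> snd z = n1 a b + n2 a b then g a b else 0)" for z a b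
    by (cases a; cases b) (simp add: cmat_tensor_segments le_def n1_def n2_def g_def)
  have mult: "mmult ?L (cmat ?M (i', l')) (cmat ?M (i, l)) a b = (if i' = i + int l then cmat ?M (i, l + l') a b else 0)"
    for i l i' l' a b
  proof -
    define S where "S = {c \<in> ?L. le b c \<and> le c a \<and> i = ?w b \<and> l = n1 c b + n2 c b \<and> i' = ?w c \<and> l' = n1 a c + n2 a c}"
    have S: "mmult ?L (cmat ?M (i', l')) (cmat ?M (i, l)) a b = (\<Sum>c\<in>S. g a c * g c b)"
      unfolding mmult_def S_def by (rule sum.mono_neutral_cong_right) (auto simp: D)
    have Sw: "i' = i + int l \<and> le b a \<and> l + l' = n1 a b + n2 a b \<and> i = ?w b" if "c \<in> S" for c
      using that by (auto simp: S_def le_def seg_le_def n1_def n2_def seg_weight_def)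
    show ?thesis
    proof (cases "i' = i + int l \<and> le b a \<and> l + l' = n1 a b + n2 a b \<and> i = ?w b")
      case False
      then have "S = {}" using Sw by blast
      then show ?thesis using False unfolding S D by auto
    next
      case True
      obtain s k t m where b: "b = ((s, k), (t, m))" by (metis surj_pair)
      define A where "A = n1 a b"
      define B where "B = n2 a b"
      have a: "a = ((s, k + A), (t, m + B))"
        using True b by (cases a) (auto simp: A_def B_def n1_def n2_def le_def seg_le_def prod_eq_iff)
      have lab: "s < length ps" "k + A \<le> snd (ps ! s)" "t < length qs" "m + B \<le> snd (qs ! t)"
        using True unfolding a b le_def seg_le_def by (auto simp: seg_labels_iff)
      \<comment> \<open>Of the first \<open>l\<close> steps, \<open>u\<close> are taken in the left
        factor and \<open>l - u\<close> in the right one.\<close>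
      define c where "c = (\<lambda>u. ((s, k + u), (t, m + l - u)))"
      let ?U = "{u. u \<le> A \<and> u \<le> l \<and> l \<le> u + B}"
      have "S = c ` ?U"
      proof
        show "S \<subseteq> c ` ?U"
        proof
          fix d assume "d \<in> S"
          then have d: "le b d" "le d a" "l = n1 d b + n2 d b" by (auto simp: S_def)
          then have "d = c (n1 d b)" "n1 d b \<in> ?U"
            unfolding a b c_def by (cases d; auto simp: le_def seg_le_def n1_def n2_def)+
          then show "d \<in> c ` ?U" by blast
        qed
        show "c ` ?U \<subseteq> S"
        proof
          fix d assume "d \<in> c ` ?U"
          then obtain u where u: "u \<le> A" "u \<le> l" "l \<le> u + B" "d = c u" by auto
          obtain v where v: "l = u + v" using u by (auto simp: le_iff_add)
          have "l + l' = A + B" using True by (simp add: A_def B_def)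
          then have l': "l' = A + B - l" by linarith
          show "d \<in> S"
            using True lab u unfolding S_def u(4) c_def a b v l'
            by (auto simp: le_def seg_le_def seg_labels_iff n1_def n2_def seg_weight_def)
        qed
      qed
      moreover have "inj_on c ?U" by (auto simp: inj_on_def c_def)
      ultimately have "(\<Sum>c\<in>S. g a c * g c b) = (\<Sum>u\<in>?U. g a (c u) * g (c u) b)"
        by (simp add: sum.reindex)
      also have "\<dots> = (\<Sum>u\<in>?U. q powi (seg_weight ps (s, k) * int B) *
          (q ^ (u * (B + u - l)) * gauss_binom q u (l - u) * gauss_binom q (A - u) (B + u - l)))"
      proof (rule sum.cong)
        fix u assume u: "u \<in> ?U"
        then obtain v where v: "l = u + v" by (auto simp: le_iff_add)
        then obtain r where r: "B = v + r" using u by (auto simp: le_iff_add)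
        let ?W = "seg_weight ps (s, k)"
        have "g a (c u) = q powi ((?W + int u) * int r) * gauss_binom q (A - u) r"
          unfolding g_def a c_def v r by (simp add: n1_def n2_def seg_weight_def algebra_simps)
        moreover have "g (c u) b = q powi (?W * int v) * gauss_binom q u v"
          unfolding g_def b c_def v r by (simp add: n1_def n2_def)
        \<comment> \<open>After \<open>u\<close> steps the left weight has grown by
          \<open>u\<close>, so the remaining \<open>r\<close> steps on the right pick up the extra
          power of \<open>q\<close> in the Vandermonde sum.\<close>
        moreover have "q powi ((?W + int u) * int r) * q powi (?W * int v) = q powi (?W * int B) * q ^ (u * r)"
        proof -
          have "(?W + int u) * int r + ?W * int v = ?W * int B + int (u * r)"
            by (simp add: r algebra_simps)
          then show ?thesis by (metis power_int_add power_int_of_nat q)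
        qed
        ultimately show "g a (c u) * g (c u) b = q powi (?W * int B) *
          (q ^ (u * (B + u - l)) * gauss_binom q u (l - u) * gauss_binom q (A - u) (B + u - l))"
          by (simp add: v r mult_ac)
      qed simp
      also have "\<dots> = q powi (seg_weight ps (s, k) * int B) * gauss_binom q A B"
        unfolding sum_distrib_left[symmetric]
        by (subst gauss_binom_vandermonde) (use True A_def B_def in auto)
      also have "\<dots> = g a b" by (simp add: g_def A_def B_def b)
      finally show ?thesis unfolding S D using True by simp
    qed
  qed
  have "path_rep (fst ?M) (cmat ?M)"
    unfolding path_rep_def
  proof (intro conjI allI)
    show "finite (fst ?M)" by simp
    show "msupp (fst ?M) (fst ?M) (cmat ?M p)" for p by (rule msupp_cmat)
    show "mmult (fst ?M) (cmat ?M (i', l')) (cmat ?M (i, l)) =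
        (if i' = i + int l then cmat ?M (i, l + l') else (\<lambda>_ _. 0))" for i l i' l'
      by (intro ext) (simp add: mult)
    show "\<exists>I. finite I \<and> (\<forall>i. i \<notin> I \<longrightarrow> cmat ?M (i, 0) = (\<lambda>_ _. 0)) \<and>
        (\<lambda>a b. \<Sum>i\<in>I. cmat ?M (i, 0) a b) = idmat (fst ?M)"
    proof (intro exI[of _ "?w ` ?L"] conjI allI impI ext)
      fix i a b assume i: "i \<notin> ?w ` ?L"
      have "le b a \<Longrightarrow> b \<in> ?L" by (auto simp: le_def seg_le_def mem_Times_iff)
      then have "\<not> (le b a \<and> i = ?w b)" using i by blast
      then show "cmat ?M (i, 0) a b = 0" unfolding D by auto
    next
      fix a b
      have "(\<Sum>i\<in>?w ` ?L. cmat ?M (i, 0) a b) = (\<Sum>i\<in>?w ` ?L. if i = ?w b then idmat ?L a b else 0)"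
      proof (rule sum.cong)
        fix i
        obtain a1 a2 a3 a4 where a: "a = ((a1, a2), (a3, a4))" by (metis surj_pair)
        obtain b1 b2 b3 b4 where b: "b = ((b1, b2), (b3, b4))" by (metis surj_pair)
        have "le b a \<and> 0 = n1 a b + n2 a b \<longleftrightarrow> a = b \<and> a \<in> ?L"
          by (auto simp: a b le_def seg_le_def n1_def n2_def)
        moreover have "g a a = 1" by (simp add: g_def n1_def n2_def)
        ultimately show "cmat ?M (i, 0) a b = (if i = ?w b then idmat ?L a b else 0)"
          unfolding D by (auto simp: idmat_def)
      qed simp
      also have "\<dots> = idmat (fst ?M) a b"
        by (auto simp: idmat_def)
      finally show "(\<Sum>i\<in>?w ` ?L. cmat ?M (i, 0) a b) = idmat (fst ?M) a b" .
    qed simp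
  qed
  with pre show ?thesis by (simp only: fd_comodule_iff)
qed

section \<open>Kronecker products and the invariance of tensor products under isomorphism\<close>

definition kron :: "('a \<Rightarrow> 'b \<Rightarrow> 'k::comm_ring_1) \<Rightarrow> ('c \<Rightarrow> 'd \<Rightarrow> 'k) \<Rightarrow> 'a \<times> 'c \<Rightarrow> 'b \<times> 'd \<Rightarrow> 'k"
  where "kron P Q = (\<lambda>a b. P (fst a) (fst b) * Q (snd a) (snd b))"

lemma mmult_kron: "mmult (B \<times> C) (kron P Q) (kron P' Q') = kron (mmult B P P') (mmult C Q Q')"
proof (intro ext)
  fix a b
  have "mmult (B \<times> C) (kron P Q) (kron P' Q') a b =
    (\<Sum>c\<in>B. \<Sum>d\<in>C. P (fst a) c * Q (snd a) d * (P' c (fst b) * Q' d (snd b)))"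
    by (simp add: mmult_def kron_def sum.cartesian_product')
  also have "\<dots> = (\<Sum>c\<in>B. \<Sum>d\<in>C. (P (fst a) c * P' c (fst b)) * (Q (snd a) d * Q' d (snd b)))"
    by (intro sum.cong refl) (simp only: mult_ac)
  also have "\<dots> = kron (mmult B P P') (mmult C Q Q') a b"
    by (simp add: mmult_def kron_def sum_product)
  finally show "mmult (B \<times> C) (kron P Q) (kron P' Q') a b = kron (mmult B P P') (mmult C Q Q') a b" .
qed

lemma kron_idmat: "kron (idmat B) (idmat C) = idmat (B \<times> C)"
  by (intro ext) (auto simp: kron_def idmat_def prod_eq_iff mem_Times_iff)

lemma msupp_kron: "msupp A B P \<Longrightarrow> msupp C D Q \<Longrightarrow> msupp (A \<times> C) (B \<times> D) (kron P Q)"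
proof (rule msuppI)
  fix a b assume P: "msupp A B P" "msupp C D Q" and "kron P Q a b \<noteq> 0"
  then have "P (fst a) (fst b) \<noteq> 0" "Q (snd a) (snd b) \<noteq> 0" by (auto simp: kron_def)
  then show "a \<in> A \<times> C \<and> b \<in> B \<times> D" using P unfolding msupp_def mem_Times_iff by blast
qed

lemma mmult_scale_left: "mmult B (\<lambda>a b. c * P a b) Q = (\<lambda>a b. c * mmult B P Q a b)"
  by (simp add: mmult_def sum_distrib_left mult.assoc)

lemma mmult_scale_right: "mmult B Q (\<lambda>a b. c * P a b) = (\<lambda>a b. c * mmult B Q P a b)"
  by (simp add: mmult_def sum_distrib_left mult_ac)

lemma cmat_tensor:
  assumes M: "precomodule M" and N: "precomodule N"
    and U: "finite U" "\<And>x. x \<notin> U \<Longrightarrow> cmat M x = (\<lambda>_ _. 0)"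
    and V: "finite V" "\<And>y. y \<notin> V \<Longrightarrow> cmat N y = (\<lambda>_ _. 0)"
  shows "cmat (comodule_tensor q M N) z =
    (\<lambda>a b. \<Sum>x\<in>U. \<Sum>y\<in>V. coef q x y z * kron (cmat M x) (cmat N y) a b)"
proof (intro ext)
  fix a b
  show "cmat (comodule_tensor q M N) z a b = (\<Sum>x\<in>U. \<Sum>y\<in>V. coef q x y z * kron (cmat M x) (cmat N y) a b)"
    using comodule_tensor(2)[OF M N U(1) V(1) U(2) V(2), of q z "fst a" "snd a" "fst b" "snd b"]
    by (simp add: kron_def mult.assoc)
qed

text \<open>\<open>F\<close> and \<open>H\<close> intertwine the matrix of each single path, so
  \<open>kron F H\<close> intertwines every term of the sum that makes up the tensor
  coaction.\<close>

lemma cm_iso_tensor: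
  assumes pre: "precomodule M" "precomodule M'" "precomodule N" "precomodule N'"
    and iso: "cm_iso M M'" "cm_iso N N'"
  shows "cm_iso (comodule_tensor q M N) (comodule_tensor q M' N')"
proof -
  obtain F F' where F: "msupp (fst M') (fst M) F" "msupp (fst M) (fst M') F'"
      "mmult (fst M') F' F = idmat (fst M)" "mmult (fst M) F F' = idmat (fst M')"
      "\<And>p. mmult (fst M') (cmat M' p) F = mmult (fst M) F (cmat M p)"
    using iso(1) unfolding rep_iso_def by blast
  obtain H H' where H: "msupp (fst N') (fst N) H" "msupp (fst N) (fst N') H'"
      "mmult (fst N') H' H = idmat (fst N)" "mmult (fst N) H H' = idmat (fst N')"
      "\<And>p. mmult (fst N') (cmat N' p) H = mmult (fst N) H (cmat N p)"
    using iso(2) unfolding rep_iso_def by blast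
  define U where "U = {x. cmat M x \<noteq> (\<lambda>_ _. 0)} \<union> {x. cmat M' x \<noteq> (\<lambda>_ _. 0)}"
  define V where "V = {x. cmat N x \<noteq> (\<lambda>_ _. 0)} \<union> {x. cmat N' x \<noteq> (\<lambda>_ _. 0)}"
  have UV: "finite U" "finite V"
    unfolding U_def V_def by (simp_all add: precomodule_finite pre)
  have out: "x \<notin> U \<Longrightarrow> cmat M x = (\<lambda>_ _. 0)" "x \<notin> U \<Longrightarrow> cmat M' x = (\<lambda>_ _. 0)"
    "x \<notin> V \<Longrightarrow> cmat N x = (\<lambda>_ _. 0)" "x \<notin> V \<Longrightarrow> cmat N' x = (\<lambda>_ _. 0)" for x
    unfolding U_def V_def by auto
  have T: "cmat (comodule_tensor q M N) z = (\<lambda>a b. \<Sum>x\<in>U. \<Sum>y\<in>V. coef q x y z * kron (cmat M x) (cmat N y) a b)" for z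
    by (rule cmat_tensor[OF pre(1,3)]) (use UV out in auto)
  have T': "cmat (comodule_tensor q M' N') z = (\<lambda>a b. \<Sum>x\<in>U. \<Sum>y\<in>V. coef q x y z * kron (cmat M' x) (cmat N' y) a b)" for z
    by (rule cmat_tensor[OF pre(2,4)]) (use UV out in auto)
  have "mmult (fst M' \<times> fst N') (cmat (comodule_tensor q M' N') z) (kron F H) =
      mmult (fst M \<times> fst N) (kron F H) (cmat (comodule_tensor q M N) z)" for z
  proof -
    have "mmult (fst M' \<times> fst N') (cmat (comodule_tensor q M' N') z) (kron F H) = (\<lambda>a b. \<Sum>x\<in>U. \<Sum>y\<in>V.
        coef q x y z * kron (mmult (fst M') (cmat M' x) F) (mmult (fst N') (cmat N' y) H) a b)"
      by (simp only: T' mmult_sum_left mmult_scale_left mmult_kron)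
    also have "\<dots> = mmult (fst M \<times> fst N) (kron F H) (cmat (comodule_tensor q M N) z)"
      by (simp only: T mmult_sum_right mmult_scale_right mmult_kron F(5) H(5))
    finally show ?thesis .
  qed
  moreover have "mmult (fst M' \<times> fst N') (kron F' H') (kron F H) = idmat (fst M \<times> fst N)"
    "mmult (fst M \<times> fst N) (kron F H) (kron F' H') = idmat (fst M' \<times> fst N')"
    unfolding mmult_kron F H kron_idmat by auto
  ultimately show ?thesis
    unfolding rep_iso_def fst_comodule_tensor
    by (intro exI[of _ "kron F H"] exI[of _ "kron F' H'"]) (simp add: msupp_kron F(1,2) H(1,2))
qed

text \<open>Decomposition of both factors reduces the comodule axioms of an arbitrary tensor product
  to those for intervals.\<close>

lemma fd_comodule_tensor:
  fixes M :: "('b, 'k::field_char_0) comod" and N :: "('c, 'k) comod"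
  assumes q: "q \<noteq> 0" and M: "fd_comodule M" and N: "fd_comodule N"
  shows "fd_comodule (comodule_tensor q M N)"
proof -
  obtain ps where M': "cm_iso (segments ps) M" by (rule comodule_decomposition[OF M])
  obtain qs where N': "cm_iso (segments qs) N" by (rule comodule_decomposition[OF N])
  have pre: "precomodule M" "precomodule N" using M N by (auto simp: fd_comodule_iff)
  show ?thesis
    by (rule fd_comodule_iso[OF fd_tensor_segments[OF q] comodule_tensor(1)[OF pre]
          cm_iso_tensor[OF precomodule_segments pre(1) precomodule_segments pre(2) M' N']])
qed

text \<open>The tensor product of two direct sums of intervals is block diagonal, with one block for
  each pair of summands.\<close>

lemma has_rank_tensor:
  fixes M :: "('b, 'k::field) comod" and N :: "('c, 'k) comod"
  assumes M: "precomodule M" "cm_iso (segments ps) M" and N: "precomodule N" "cm_iso (segments qs) N"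
    and rank: "\<And>p r. p \<in> set ps \<Longrightarrow> r \<in> set qs \<Longrightarrow>
      has_rank (seg_labels [p] \<times> seg_labels [r]) (cmat (comodule_tensor q (segments [p]) (segments [r])) x) (t p r)"
  shows "has_rank (fst M \<times> fst N) (cmat (comodule_tensor q M N) x)
    (\<Sum>i<length ps. \<Sum>j<length qs. t (ps ! i) (qs ! j))"
proof -
  let ?S = "comodule_tensor q (segments ps) (segments qs) :: (_, 'k) comod"
  let ?L = "seg_labels ps \<times> seg_labels qs"
  have "has_rank ?L (cmat ?S x) (\<Sum>u\<in>{..<length ps} \<times> {..<length qs}. t (ps ! fst u) (qs ! snd u))"
  proof (rule has_rank_blocks[where \<beta> = "\<lambda>a. (fst (fst a), fst (snd a))" and
      h = "\<lambda>u c. ((fst u, snd (fst c)), (snd u, snd (snd c)))" and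
      C = "\<lambda>u. seg_labels [ps ! fst u] \<times> seg_labels [qs ! snd u]" and
      E = "\<lambda>u. cmat (comodule_tensor q (segments [ps ! fst u]) (segments [qs ! snd u])) x"])
    show "msupp ?L ?L (cmat ?S x)" using msupp_cmat[of ?S x] by simp
    show "(fst (fst a), fst (snd a)) \<in> {..<length ps} \<times> {..<length qs}" if "a \<in> ?L" for a
      using that by (auto simp: seg_labels_def)
    show "(fst (fst a), fst (snd a)) = (fst (fst b), fst (snd b))" if "cmat ?S x a b \<noteq> 0" for a b
    proof -
      obtain a1 a2 b1 b2 where ab: "a = (a1, a2)" "b = (b1, b2)" by (metis surj_pair)
      then have "seg_le ps b1 a1 \<and> seg_le qs b2 a2"
        using that by (simp only: ab cmat_tensor_segments split: if_splits) simp
      then show ?thesis by (simp add: ab seg_le_def)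
    qed
    fix u assume u: "u \<in> {..<length ps} \<times> {..<length qs}"
    let ?h = "\<lambda>c :: (nat \<times> nat) \<times> nat \<times> nat. ((fst u, snd (fst c)), (snd u, snd (snd c)))"
    show "bij_betw ?h (seg_labels [ps ! fst u] \<times> seg_labels [qs ! snd u])
        {a \<in> ?L. (fst (fst a), fst (snd a)) = u}"
      using u by (intro bij_betw_byWitness[of _ "\<lambda>a. ((0, snd (fst a)), (0, snd (snd a)))"])
        (auto simp: seg_labels_def)
    show "has_rank (seg_labels [ps ! fst u] \<times> seg_labels [qs ! snd u])
        (cmat (comodule_tensor q (segments [ps ! fst u]) (segments [qs ! snd u])) x) (t (ps ! fst u) (qs ! snd u))"
      using u by (intro rank) auto
    fix c c' assume c: "c \<in> seg_labels [ps ! fst u] \<times> seg_labels [qs ! snd u]"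
      "c' \<in> seg_labels [ps ! fst u] \<times> seg_labels [qs ! snd u]"
    have "seg_le ps (fst u, snd (fst c')) (fst u, snd (fst c)) \<longleftrightarrow> seg_le [ps ! fst u] (fst c') (fst c)"
      "seg_le qs (snd u, snd (snd c')) (snd u, snd (snd c)) \<longleftrightarrow> seg_le [qs ! snd u] (snd c') (snd c)"
      "seg_weight ps (fst u, snd (fst c')) = seg_weight [ps ! fst u] (fst c')"
      "seg_weight qs (snd u, snd (snd c')) = seg_weight [qs ! snd u] (snd c')"
      using c u by (auto simp: seg_le_def seg_labels_def seg_weight_def)
    then show "cmat ?S x (?h c) (?h c') = cmat (comodule_tensor q (segments [ps ! fst u]) (segments [qs ! snd u])) x c c'"
      by (cases c, cases c') (simp only: cmat_tensor_segments fst_conv snd_conv)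
  qed simp_all
  then have "has_rank (fst M \<times> fst N) (cmat (comodule_tensor q M N) x)
      (\<Sum>u\<in>{..<length ps} \<times> {..<length qs}. t (ps ! fst u) (qs ! snd u))"
    using has_rank_rep_iso[OF cm_iso_tensor[OF precomodule_segments M(1) precomodule_segments N(1) M(2) N(2)]
        _ _ msupp_cmat msupp_cmat] M(1) N(1)
    by (simp only: fst_comodule_tensor fst_segments precomodule_def finite_cartesian_product finite_seg_labels)
  then show ?thesis by (simp add: sum.cartesian_product')
qed

text \<open>Associativity of path multiplication, in structure constants; \<open>q\<close> is
  nonzero so that its integer exponents add.\<close>

lemma coef_assoc:
  fixes q :: "'k::field"
  assumes q: "q \<noteq> 0"
  shows "coef q (w1, n1) (w2 + w3, n2 + n3) z * coef q (w2, n2) (w3, n3) (w2 + w3, n2 + n3) =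
    coef q (w1 + w2, n1 + n2) (w3, n3) z * coef q (w1, n1) (w2, n2) (w1 + w2, n1 + n2)"
proof (cases "z = (w1 + w2 + w3, n1 + n2 + n3)")
  case True
  define e1 where "e1 = q powi ((w1 + w2) * int n3)"
  define e2 where "e2 = q powi (w1 * int n2)"
  define e3 where "e3 = q powi (w1 * int (n2 + n3))"
  define e4 where "e4 = q powi (w2 * int n3)"
  have "e1 * e2 = q powi ((w1 + w2) * int n3 + w1 * int n2)"
    using q by (simp add: e1_def e2_def power_int_add)
  also have "(w1 + w2) * int n3 + w1 * int n2 = w1 * int (n2 + n3) + w2 * int n3"
    by (simp add: algebra_simps)
  also have "q powi \<dots> = e3 * e4"
    using q by (simp add: e3_def e4_def power_int_add del: of_nat_add)
  finally have e: "e1 * e2 = e3 * e4" .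
  have "coef q (w1, n1) (w2 + w3, n2 + n3) z * coef q (w2, n2) (w3, n3) (w2 + w3, n2 + n3) =
      e3 * gauss_binom q n1 (n2 + n3) * (e4 * gauss_binom q n2 n3)"
    by (simp only: True coef_def fst_conv snd_conv e3_def e4_def add.assoc simp_thms if_True)
  also have "\<dots> = (e3 * e4) * (gauss_binom q n2 n3 * gauss_binom q n1 (n2 + n3))"
    by (simp only: mult_ac)
  also have "\<dots> = (e1 * e2) * (gauss_binom q n1 n2 * gauss_binom q (n1 + n2) n3)"
    by (simp only: e gauss_binom_assoc)
  also have "\<dots> = e1 * gauss_binom q (n1 + n2) n3 * (e2 * gauss_binom q n1 n2)"
    by (simp only: mult_ac)
  also have "\<dots> = coef q (w1 + w2, n1 + n2) (w3, n3) z * coef q (w1, n1) (w2, n2) (w1 + w2, n1 + n2)"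
    by (simp only: True coef_def fst_conv snd_conv e1_def e2_def simp_thms if_True)
  finally show ?thesis .
next
  case False
  then show ?thesis by (auto simp: coef_def add.assoc)
qed

text \<open>Associativity is needed only for ranks, so relabelling the bases suffices.\<close>

lemma has_rank_tensor_assoc:
  fixes q :: "'k::field"
  assumes q: "q \<noteq> 0"
    and rank: "has_rank ((seg_labels [p] \<times> seg_labels [r]) \<times> seg_labels [s])
      (cmat (comodule_tensor q (comodule_tensor q (segments [p]) (segments [r])) (segments [s])) x) t"
  shows "has_rank (seg_labels [p] \<times> (seg_labels [r] \<times> seg_labels [s]))
      (cmat (comodule_tensor q (segments [p]) (comodule_tensor q (segments [r]) (segments [s]))) x) t"
proof -
  let ?P = "segments [p] :: (_, 'k) comod" and ?R = "segments [r] :: (_, 'k) comod" and ?S = "segments [s] :: (_, 'k) comod"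
  let ?PR = "comodule_tensor q ?P ?R" and ?RS = "comodule_tensor q ?R ?S"
  let ?A = "comodule_tensor q ?PR ?S" and ?B = "comodule_tensor q ?P ?RS"
  have pre: "precomodule ?PR" "precomodule ?RS" "precomodule ?A" "precomodule ?B"
    by (simp_all add: comodule_tensor(1) precomodule_segments)
  have eq: "cmat ?B z (a1, (a2, a3)) (b1, (b2, b3)) = cmat ?A z ((a1, a2), a3) ((b1, b2), b3)" for z a1 a2 a3 b1 b2 b3
  proof -
    let ?w1 = "seg_weight [p] b1" and ?w2 = "seg_weight [r] b2" and ?w3 = "seg_weight [s] b3"
    let ?n1 = "snd a1 - snd b1" and ?n2 = "snd a2 - snd b2" and ?n3 = "snd a3 - snd b3"
    let ?c = "seg_le [p] b1 a1 \<and> seg_le [r] b2 a2 \<and> seg_le [s] b3 a3"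
    let ?x = "(?w1, ?n1)" and ?y = "(?w2, ?n2)" and ?v = "(?w3, ?n3)"
    let ?xy = "(?w1 + ?w2, ?n1 + ?n2)" and ?yv = "(?w2 + ?w3, ?n2 + ?n3)"
    define U where "U = insert ?xy {x. cmat ?PR x \<noteq> (\<lambda>_ _. 0)}"
    define U' where "U' = insert ?yv {x. cmat ?RS x \<noteq> (\<lambda>_ _. 0)}"
    define V where "V = insert ?v {x. cmat ?S x \<noteq> (\<lambda>_ _. 0)}"
    define V' where "V' = insert ?x {x. cmat ?P x \<noteq> (\<lambda>_ _. 0)}"
    have fin: "finite U" "finite U'" "finite V" "finite V'"
      unfolding U_def U'_def V_def V'_def
      by (simp_all only: finite_insert precomodule_finite pre precomodule_segments)
    have eqs: "cmat ?P u a1 b1 = (if seg_le [p] b1 a1 \<and> u = ?x then 1 else 0)"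
      "cmat ?S u a3 b3 = (if seg_le [s] b3 a3 \<and> u = ?v then 1 else 0)" for u
      by (simp_all add: seg_mat_alt seg_le_def)
    have PR: "cmat ?PR u (a1, a2) (b1, b2) =
        (if seg_le [p] b1 a1 \<and> seg_le [r] b2 a2 \<and> u = ?xy then coef q ?x ?y ?xy else 0)" for u
      by (cases u) (simp add: cmat_tensor_segments coef_def)
    have RS: "cmat ?RS u (a2, a3) (b2, b3) =
        (if seg_le [r] b2 a2 \<and> seg_le [s] b3 a3 \<and> u = ?yv then coef q ?y ?v ?yv else 0)" for u
      by (cases u) (simp add: cmat_tensor_segments coef_def)
    have "cmat ?A z ((a1, a2), a3) ((b1, b2), b3) =
      (\<Sum>x\<in>U. \<Sum>y\<in>V. coef q x y z * cmat ?PR x (a1, a2) (b1, b2) * cmat ?S y a3 b3)"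
      by (rule comodule_tensor(2)[OF pre(1) precomodule_segments fin(1,3)]) (auto simp: U_def V_def)
    also have "\<dots> = (\<Sum>x\<in>U. \<Sum>y\<in>V. if y = ?v then (if x = ?xy then
        (if ?c then coef q ?xy ?v z * coef q ?x ?y ?xy else 0) else 0) else 0)"
      unfolding PR eqs by (intro sum.cong refl) simp
    also have "\<dots> = (if ?c then coef q ?xy ?v z * coef q ?x ?y ?xy else 0)"
      using fin by (simp add: U_def V_def)
    finally have A: "cmat ?A z ((a1, a2), a3) ((b1, b2), b3) = (if ?c then coef q ?xy ?v z * coef q ?x ?y ?xy else 0)" .
    have "cmat ?B z (a1, (a2, a3)) (b1, (b2, b3)) =
      (\<Sum>x\<in>V'. \<Sum>y\<in>U'. coef q x y z * cmat ?P x a1 b1 * cmat ?RS y (a2, a3) (b2, b3))"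
      by (rule comodule_tensor(2)[OF precomodule_segments pre(2) fin(4,2)]) (auto simp: U'_def V'_def)
    also have "\<dots> = (\<Sum>x\<in>V'. \<Sum>y\<in>U'. if y = ?yv then (if x = ?x then
        (if ?c then coef q ?x ?yv z * coef q ?y ?v ?yv else 0) else 0) else 0)"
      unfolding RS eqs by (intro sum.cong refl) simp
    also have "\<dots> = (if ?c then coef q ?x ?yv z * coef q ?y ?v ?yv else 0)"
      using fin by (simp add: U'_def V'_def)
    finally have B: "cmat ?B z (a1, (a2, a3)) (b1, (b2, b3)) = (if ?c then coef q ?x ?yv z * coef q ?y ?v ?yv else 0)" .
    have "coef q ?x ?yv z * coef q ?y ?v ?yv = coef q ?xy ?v z * coef q ?x ?y ?xy"
      by (rule coef_assoc[OF q])
    then show ?thesis unfolding A B by simp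
  qed
  define h :: "((nat \<times> nat) \<times> nat \<times> nat) \<times> nat \<times> nat \<Rightarrow> (nat \<times> nat) \<times> (nat \<times> nat) \<times> nat \<times> nat"
    where "h = (\<lambda>((a, b), c). (a, (b, c)))"
  have iso: "cm_iso ?A ?B"
  proof (rule rep_iso_relabel[where h = h])
    show "bij_betw h (fst ?A) (fst ?B)"
      unfolding h_def by (intro bij_betw_byWitness[of _ "\<lambda>(a, (b, c)). ((a, b), c)"]) auto
    show "finite (fst ?A)" by simp
    show "msupp (fst ?A) (fst ?A) (cmat ?A z)" "msupp (fst ?B) (fst ?B) (cmat ?B z)" for z
      by (rule msupp_cmat)+
    fix z and a b :: "((nat \<times> nat) \<times> nat \<times> nat) \<times> nat \<times> nat"
    obtain a1 a2 a3 where a: "a = ((a1, a2), a3)" by (metis surj_pair)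
    obtain b1 b2 b3 where b: "b = ((b1, b2), b3)" by (metis surj_pair)
    show "cmat ?B z (h a) (h b) = cmat ?A z a b"
      by (simp only: h_def a b prod.case eq)
  qed
  have fin: "finite (fst ?A)" "finite (fst ?B)" by simp_all
  have "has_rank (fst ?A) (cmat ?A x) t"
    using rank by (simp only: fst_comodule_tensor fst_segments)
  from has_rank_rep_iso[OF iso fin msupp_cmat msupp_cmat this] show ?thesis
    by (simp only: fst_comodule_tensor fst_segments)
qed

subsection \<open>Products of two intervals\<close>

text \<open>\<open>cmat_tensor_segments\<close> for one interval in each factor, with the summand
  index 0 dropped from the labels.\<close>

definition pair_mat :: "'k::field \<Rightarrow> path \<Rightarrow> path \<Rightarrow> path \<Rightarrow> nat \<times> nat \<Rightarrow> nat \<times> nat \<Rightarrow> 'k"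
  where "pair_mat q p r z a b =
    (if fst b \<le> fst a \<and> fst a \<le> snd p \<and> snd b \<le> snd a \<and> snd a \<le> snd r \<and>
        fst z = fst p + int (fst b) + fst r + int (snd b) \<and> snd z = (fst a - fst b) + (snd a - snd b)
     then q powi ((fst p + int (fst b)) * int (snd a - snd b)) * gauss_binom q (fst a - fst b) (snd a - snd b)
     else 0)"

lemma has_rank_pair:
  fixes q :: "'k::field"
  assumes "has_rank ({..snd p} \<times> {..snd r}) (pair_mat q p r z) t"
  shows "has_rank (seg_labels [p] \<times> seg_labels [r]) (cmat (comodule_tensor q (segments [p]) (segments [r])) z) t"
proof -
  let ?M = "comodule_tensor q (segments [p]) (segments [r]) :: (_, 'k) comod"
  let ?L = "seg_labels [p] \<times> seg_labels [r]"
  have "has_rank ?L (cmat ?M z) (\<Sum>j\<in>{()}. t)"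
  \<comment> \<open>There is only one block; the lemma serves to rename the labels.\<close>
  proof (rule has_rank_blocks[where \<beta> = "\<lambda>_. ()" and h = "\<lambda>_ c. ((0, fst c), (0, snd c))" and
      C = "\<lambda>_. {..snd p} \<times> {..snd r}" and E = "\<lambda>_. pair_mat q p r z"])
    show "msupp ?L ?L (cmat ?M z)" using msupp_cmat[of ?M z] by simp
    show "bij_betw (\<lambda>c. ((0, fst c), (0, snd c))) ({..snd p} \<times> {..snd r}) {a \<in> ?L. () = j}" for j
      by (intro bij_betw_byWitness[of _ "\<lambda>a. (snd (fst a), snd (snd a))"]) (auto simp: seg_labels_def)
    fix c c' :: "nat \<times> nat" assume "c \<in> {..snd p} \<times> {..snd r}" "c' \<in> {..snd p} \<times> {..snd r}"
    then show "cmat ?M z ((0, fst c), (0, snd c)) ((0, fst c'), (0, snd c')) = pair_mat q p r z c c'"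
      unfolding cmat_tensor_segments pair_mat_def
      by (auto simp: seg_le_def seg_labels_def seg_weight_def)
  qed (use assms in auto)
  then show ?thesis by simp
qed

text \<open>The weights of the tensor product fill the interval from \<open>fst p + fst r\<close> of
  length \<open>snd p + snd r\<close>, and a path leaving it has zero matrix.\<close>

lemma has_rank_pair_outside:
  assumes "\<not> subpath z (fst p + fst r, snd p + snd r)"
  shows "has_rank ({..snd p} \<times> {..snd r}) (pair_mat q p r z) 0"
proof -
  have "pair_mat q p r z a b = 0" for a b
    using assms by (auto simp: pair_mat_def subpath_def)
  then have "pair_mat q p r z = (\<lambda>_ _. 0)" by (intro ext)
  then show ?thesis using has_rank_zero by simp
qed

text \<open>The longest path can only lead from the lowest label to the highest, so its matrix has a
  single entry: a power of \<open>q\<close> times the Gaussian binomial.\<close>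

lemma has_rank_pair_top:
  assumes q: "q \<noteq> 0" and g: "gauss_binom q (snd p) (snd r) \<noteq> 0"
  shows "has_rank ({..snd p} \<times> {..snd r}) (pair_mat q p r (fst p + fst r, snd p + snd r)) 1"
proof (rule has_rank_1[of _ "(snd p, snd r)" "(0, 0)"])
  let ?D = "pair_mat q p r (fst p + fst r, snd p + snd r)"
  show "?D (snd p, snd r) (0, 0) \<noteq> 0" using q g by (simp add: pair_mat_def)
  have "?D a b = 0" if "a \<noteq> (snd p, snd r) \<or> b \<noteq> (0, 0)" for a b
    using that by (cases a; cases b) (auto simp: pair_mat_def)
  then show "?D a b * ?D (snd p, snd r) (0, 0) = ?D a (0, 0) * ?D (snd p, snd r) b" for a b
    by (metis mult.commute mult_zero_left)
qed auto

lemma has_rank_pair_point_left: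
  assumes q: "q \<noteq> 0"
  shows "has_rank ({..snd (c, 0 :: nat)} \<times> {..l}) (pair_mat q (c, 0) (i, l) z)
    (if subpath z (c + i, l) then 1 else 0)"
proof (cases "subpath z (c + i, l)")
  case False
  then show ?thesis using has_rank_pair_outside[of z "(c, 0)" "(i, l)" q] by simp
next
  case True
  let ?D = "pair_mat q (c, 0) (i, l) z"
  define k where "k = nat (fst z - c - i)"
  have k: "fst z = c + i + int k" "k + snd z \<le> l" using True by (auto simp: subpath_def k_def)
  have "has_rank ({..snd (c, 0 :: nat)} \<times> {..l}) ?D 1"
  proof (rule has_rank_1[of _ "(0, k + snd z)" "(0, k)"])
    show "?D (0, k + snd z) (0, k) \<noteq> 0" using q k by (simp add: pair_mat_def)
    have "?D a b = 0" if "a \<noteq> (0, k + snd z) \<or> b \<noteq> (0, k)" for a b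
      using that k by (cases a; cases b) (auto simp: pair_mat_def)
    then show "?D a b * ?D (0, k + snd z) (0, k) = ?D a (0, k) * ?D (0, k + snd z) b" for a b
      by (metis mult.commute mult_zero_left)
  qed (use k in auto)
  then show ?thesis using True by simp
qed

lemma has_rank_pair_point_right:
  assumes q: "q \<noteq> 0"
  shows "has_rank ({..l} \<times> {..snd (c, 0 :: nat)}) (pair_mat q (i, l) (c, 0) z)
    (if subpath z (c + i, l) then 1 else 0)"
proof (cases "subpath z (c + i, l)")
  case False
  then show ?thesis using has_rank_pair_outside[of z "(i, l)" "(c, 0)" q] by (simp add: add.commute)
next
  case True
  let ?D = "pair_mat q (i, l) (c, 0) z"
  define k where "k = nat (fst z - c - i)"
  have k: "fst z = c + i + int k" "k + snd z \<le> l" using True by (auto simp: subpath_def k_def)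
  have "has_rank ({..l} \<times> {..snd (c, 0 :: nat)}) ?D 1"
  proof (rule has_rank_1[of _ "(k + snd z, 0)" "(k, 0)"])
    show "?D (k + snd z, 0) (k, 0) \<noteq> 0" using q k by (simp add: pair_mat_def)
    have "?D a b = 0" if "a \<noteq> (k + snd z, 0) \<or> b \<noteq> (k, 0)" for a b
      using that k by (cases a; cases b) (auto simp: pair_mat_def)
    then show "?D a b * ?D (k + snd z, 0) (k, 0) = ?D a (k, 0) * ?D (k + snd z, 0) b" for a b
      by (metis mult.commute mult_zero_left)
  qed (use k in auto)
  then show ?thesis using True by simp
qed

text \<open>The rank of \<open>z\<close> on the expected decomposition of \<open>(0, 1)\<close>
  times \<open>(0, m)\<close> for \<open>m \<ge> 1\<close>. The generic case is a Clebsch-Gordan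
  rule; when the q-integer of \<open>m + 1\<close> vanishes, the full interval is lost and two
  intervals of length \<open>m\<close> appear.\<close>

definition arrow_rank :: "'k::field \<Rightarrow> nat \<Rightarrow> path \<Rightarrow> 'k"
  where "arrow_rank q m z =
    (if q_int q (Suc m) = 0
     then (if subpath z (0, m) then 1 else 0) + (if subpath z (1, m) then 1 else 0)
     else (if subpath z (0, Suc m) then 1 else 0) + (if subpath z (1, m - 1) then 1 else 0))"

text \<open>The hypotheses on \<open>D\<close> are loose enough to cover both orders of the factors.
  A path starting at 0 meets one column, a path ending at \<open>m + 1\<close> one row, and a path
  in between a triangular two by two block; vanishing of a q-integer matters only for the full path
  \<open>(0, m + 1)\<close>.\<close>

lemma has_rank_arrow:
  fixes D :: "nat \<times> nat \<Rightarrow> nat \<times> nat \<Rightarrow> 'k::field"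
  assumes m: "m \<ge> 1"
    and supp: "\<And>a b. D a b \<noteq> 0 \<Longrightarrow> fst b \<le> fst a \<and> fst a \<le> Suc 0 \<and> snd b \<le> snd a \<and> snd a \<le> m \<and>
      fst z = int (fst b) + int (snd b) \<and> snd z = (fst a - fst b) + (snd a - snd b)"
    and diag: "\<And>a b. fst a = fst b \<Longrightarrow> fst a \<le> Suc 0 \<Longrightarrow> snd b \<le> snd a \<Longrightarrow> snd a \<le> m \<Longrightarrow>
      fst z = int (fst b) + int (snd b) \<Longrightarrow> snd z = snd a - snd b \<Longrightarrow> D a b \<noteq> 0"
    and top: "z = (0, Suc m) \<Longrightarrow> D (Suc 0, m) (0, 0) = q_int q (Suc m)"
  shows "has_rank ({..Suc 0} \<times> {..m}) D (arrow_rank q m z)"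
proof -
  let ?B = "{..Suc 0} \<times> {..m}"
  have supp0: "D a b = 0" if "\<not> (fst b \<le> fst a \<and> fst a \<le> Suc 0 \<and> snd b \<le> snd a \<and> snd a \<le> m \<and>
      fst z = int (fst b) + int (snd b) \<and> snd z = (fst a - fst b) + (snd a - snd b))" for a b
    using supp that by blast
  consider "\<not> subpath z (0, Suc m)" | "subpath z (0, Suc m)" "fst z = 0"
    | "subpath z (0, Suc m)" "fst z \<ge> 1" "fst z + int (snd z) \<le> int m"
    | "fst z \<ge> 1" "fst z + int (snd z) = int (Suc m)"
    by (auto simp: subpath_def) linarith
  then show ?thesis
  proof cases
    case 1
    then have "arrow_rank q m z = 0" using m by (auto simp: arrow_rank_def subpath_def)
    moreover have "D a b = 0" for a b
      using 1 by (intro supp0) (auto simp: subpath_def)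
    then have "D = (\<lambda>_ _. 0)" by (intro ext)
    ultimately show ?thesis using has_rank_zero by simp
  next
    case 2
    obtain n where z: "z = (0, n)" using 2 by (cases z) auto
    have n: "n \<le> Suc m" using 2 by (auto simp: subpath_def z)
    have col: "D a b = 0" if "b \<noteq> (0, 0)" for a b
      using that by (cases b) (auto intro!: supp0 simp: z)
    have R: "arrow_rank q m z = (if n = Suc m \<and> q_int q (Suc m) = 0 then 0 else 1)"
      using n m by (auto simp: arrow_rank_def subpath_def z)
    have rank: "has_rank ?B D 1" if "r \<in> ?B" "D r (0, 0) \<noteq> 0" for r
    proof (rule has_rank_1[of _ r "(0, 0)"])
      show "D a b * D r (0, 0) = D a (0, 0) * D r b" for a b
        by (cases "b = (0, 0)") (simp_all add: col)
    qed (use that in auto)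
    show ?thesis
    proof (cases "n \<le> m")
      case True
      then have "has_rank ?B D 1" by (intro rank[of "(0, n)"] diag) (auto simp: z)
      then show ?thesis using True by (simp add: R)
    next
      case False
      then have nm: "n = Suc m" using n by simp
      have row: "D a b = 0" if "a \<noteq> (Suc 0, m)" for a b
        using that by (cases a; cases b) (auto intro!: supp0 simp: z nm)
      show ?thesis
      proof (cases "q_int q (Suc m) = 0")
        case True
        have "D a b = 0" for a b
          using True top row col by (cases "a = (Suc 0, m)"; cases "b = (0, 0)") (auto simp: z nm)
        then have "D = (\<lambda>_ _. 0)" by (intro ext)
        then show ?thesis using has_rank_zero True nm by (simp add: R)
      next
        case False
        then have "has_rank ?B D 1" using top by (intro rank[of "(Suc 0, m)"]) (auto simp: z nm)
        then show ?thesis using False by (simp add: R)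
      qed
    qed
  next
    case 3
    obtain k n where z: "z = (int (Suc k), n)"
      using 3 by (cases z) (metis fst_conv int_one_le_iff_zero_less zero_less_imp_eq_int gr0_implies_Suc)
    have kn: "Suc k + n \<le> m" using 3 by (simp add: z)
    \<comment> \<open>There are two sources of weight \<open>k + 1\<close> and two targets.
      Coordinates never decrease along a path, so the entry from \<open>(1, k)\<close> to
      \<open>(0, k + 1 + n)\<close> is zero and the block is triangular.\<close>
    have "has_rank ?B D 2"
    proof (rule has_rank_2[of _ "(0, Suc k + n)" "(Suc 0, k + n)" "(0, Suc k)" "(Suc 0, k)"])
      show "(a = (0, Suc k + n) \<or> a = (Suc 0, k + n)) \<and> (b = (0, Suc k) \<or> b = (Suc 0, k))" if "D a b \<noteq> 0" for a b
        using supp[OF that] by (cases a; cases b) (auto simp: z le_Suc_eq)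
      show "D (0, Suc k + n) (0, Suc k) \<noteq> 0" "D (Suc 0, k + n) (Suc 0, k) \<noteq> 0"
        using kn by (intro diag; simp add: z)+
      show "D (0, Suc k + n) (Suc 0, k) = 0" by (intro supp0) simp
    qed (use kn in auto)
    moreover have "arrow_rank q m z = 2"
      using kn by (auto simp: arrow_rank_def subpath_def z)
    ultimately show ?thesis by simp
  next
    case 4
    obtain k n where z: "z = (int (Suc k), n)"
      using 4 by (cases z) (metis fst_conv int_one_le_iff_zero_less zero_less_imp_eq_int gr0_implies_Suc)
    have kn: "k + n = m" using 4 by (simp add: z)
    have row: "D a b = 0" if "a \<noteq> (Suc 0, m)" for a b
      using that kn by (cases a; cases b) (auto intro!: supp0 simp: z)
    have "has_rank ?B D 1"
    proof (rule has_rank_1[of _ "(Suc 0, m)" "(Suc 0, k)"])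
      show "D (Suc 0, m) (Suc 0, k) \<noteq> 0" using kn by (intro diag) (auto simp: z)
      show "D a b * D (Suc 0, m) (Suc 0, k) = D a (Suc 0, k) * D (Suc 0, m) b" for a b
        by (cases "a = (Suc 0, m)") (simp_all add: row mult.commute)
    qed (use kn in auto)
    moreover have "arrow_rank q m z = 1"
      using kn m by (auto simp: arrow_rank_def subpath_def z)
    ultimately show ?thesis by simp
  qed
qed

lemma has_rank_arrow_left:
  assumes q: "q \<noteq> 0" and m: "m \<ge> 1"
  shows "has_rank ({..Suc 0} \<times> {..m}) (pair_mat q (0, Suc 0) (0, m) z) (arrow_rank q m z)"
proof (rule has_rank_arrow[OF m])
  show "pair_mat q (0, Suc 0) (0, m) z (Suc 0, m) (0, 0) = q_int q (Suc m)" if "z = (0, Suc m)"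
    using gauss_binom_1_left[of q m] that by (simp add: pair_mat_def q_int_def del: sum.lessThan_Suc)
qed (use q in \<open>auto simp: pair_mat_def split: if_splits\<close>)

lemma has_rank_arrow_right:
  assumes q: "q \<noteq> 0" and m: "m \<ge> 1"
  shows "has_rank ({..m} \<times> {..Suc 0}) (pair_mat q (0, m) (0, Suc 0) z) (arrow_rank q m z)"
proof -
  let ?D = "pair_mat q (0, m) (0, Suc 0) z"
  \<comment> \<open>Exchanging the coordinates gives a matrix of the same shape; the powers of
    \<open>q\<close> on its diagonal entries differ, but only their being nonzero matters.\<close>
  define E where "E = (\<lambda>a b. ?D (prod.swap a) (prod.swap b))"
  have E: "has_rank ({..Suc 0} \<times> {..m}) E (arrow_rank q m z)"
  proof (rule has_rank_arrow[OF m])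
    show "E (Suc 0, m) (0, 0) = q_int q (Suc m)" if "z = (0, Suc m)"
      using gauss_binom_1_right[of q m] that by (simp add: E_def pair_mat_def q_int_def del: sum.lessThan_Suc)
  qed (use q in \<open>auto simp: E_def pair_mat_def split: if_splits\<close>)
  have "has_rank ({..m} \<times> {..Suc 0}) ?D (\<Sum>j\<in>{()}. arrow_rank q m z)"
  proof (rule has_rank_blocks[where \<beta> = "\<lambda>_. ()" and h = "\<lambda>_. prod.swap" and
      C = "\<lambda>_. {..Suc 0} \<times> {..m}" and E = "\<lambda>_. E"])
    show "msupp ({..m} \<times> {..Suc 0}) ({..m} \<times> {..Suc 0}) ?D"
      by (rule msuppI) (auto simp: pair_mat_def split: if_splits)
    show "bij_betw prod.swap ({..Suc 0} \<times> {..m}) {a \<in> {..m} \<times> {..Suc 0}. () = j}" for j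
      by (rule bij_betw_byWitness[of _ prod.swap]) auto
  qed (use E in \<open>auto simp: E_def\<close>)
  then show ?thesis by simp
qed

section \<open>Classes of comodules\<close>

text \<open>The rank of the path \<open>x\<close> on a comodule in which the interval \<open>p\<close> has multiplicity \<open>u p\<close>.\<close>

definition rank_of :: "(path \<Rightarrow>\<^sub>0 int) \<Rightarrow> path \<Rightarrow> 'k::field_char_0"
  where "rank_of u x = of_int (\<Sum>p\<in>keys u. lookup u p * (if subpath x p then 1 else 0))"

lemma rank_of_superset:
  assumes "finite S" "keys u \<subseteq> S"
  shows "rank_of u x = of_int (\<Sum>p\<in>S. lookup u p * (if subpath x p then 1 else 0))"
  unfolding rank_of_def using assms
  by (intro arg_cong[where f = of_int] sum.mono_neutral_left) (auto simp: in_keys_iff)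

lemma rank_of_zero [simp]: "rank_of 0 x = 0"
  by (simp add: rank_of_def)

lemma rank_of_frag_of: "rank_of (frag_of p) x = (if subpath x p then 1 else 0)"
  by (simp add: rank_of_superset[of "{p}"])

lemma rank_of_add: "rank_of (u + v) x = rank_of u x + rank_of v x"
proof -
  let ?S = "keys u \<union> keys v"
  have S: "finite ?S" "keys (u + v) \<subseteq> ?S"
    by (auto dest: subsetD[OF Poly_Mapping.keys_add])
  then show ?thesis
    by (simp add: rank_of_superset[of ?S] lookup_add distrib_right sum.distrib)
qed

lemma rank_of_sum: "rank_of (\<Sum>i\<in>I. f i) x = (\<Sum>i\<in>I. rank_of (f i) x)"
  by (induction I rule: infinite_finite_induct) (simp_all add: rank_of_add)

text \<open>Inclusion-exclusion: from the intervals containing \<open>(i, l)\<close>, those that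
  reach further left and those that reach further right are removed, and those doing both are added
  back. What remains is \<open>(i, l)\<close> itself.\<close>

lemma lookup_from_rank:
  "of_int (lookup u (i, l)) = rank_of u (i, l) - rank_of u (i - 1, Suc l)
    - rank_of u (i, Suc l) + (rank_of u (i - 1, Suc (Suc l)) :: 'k::field_char_0)"
proof -
  let ?c = "\<lambda>x p. if subpath x p then 1 else 0 :: int"
  have "rank_of u (i, l) - rank_of u (i - 1, Suc l) - rank_of u (i, Suc l) + rank_of u (i - 1, Suc (Suc l)) =
    (of_int (\<Sum>p\<in>keys u. lookup u p *
      (?c (i, l) p - ?c (i - 1, Suc l) p - ?c (i, Suc l) p + ?c (i - 1, Suc (Suc l)) p)) :: 'k)"
    unfolding rank_of_def by (simp only: of_int_add[symmetric] of_int_diff[symmetric] sum.distrib[symmetric]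
      sum_subtractf[symmetric] distrib_left right_diff_distrib)
  also have "(\<Sum>p\<in>keys u. lookup u p *
      (?c (i, l) p - ?c (i - 1, Suc l) p - ?c (i, Suc l) p + ?c (i - 1, Suc (Suc l)) p)) =
    (\<Sum>p\<in>keys u. if p = (i, l) then lookup u (i, l) else 0)"
  proof (rule sum.cong)
    fix p :: path
    show "lookup u p * (?c (i, l) p - ?c (i - 1, Suc l) p - ?c (i, Suc l) p + ?c (i - 1, Suc (Suc l)) p) =
      (if p = (i, l) then lookup u (i, l) else 0)"
      by (cases p) (auto simp: subpath_def)
  qed simp
  also have "\<dots> = lookup u (i, l)" by (auto simp: in_keys_iff)
  finally show ?thesis by simp
qed

lemma rank_of_inject:
  assumes "\<And>x. rank_of u x = (rank_of v x :: 'k::field_char_0)"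
  shows "u = v"
proof (rule poly_mapping_eqI)
  fix p :: path
  obtain i l where p: "p = (i, l)" by (cases p)
  have "of_int (lookup u p) = (of_int (lookup v p) :: 'k)"
    unfolding p lookup_from_rank assms ..
  then show "lookup u p = lookup v p" by simp
qed

definition seg_class :: "path list \<Rightarrow> (path \<Rightarrow>\<^sub>0 int)"
  where "seg_class ps = (\<Sum>s<length ps. frag_of (ps ! s))"

text \<open>The decomposition is chosen arbitrarily; independence of the choice follows from
  \<open>cm_class_eqI\<close>.\<close>

definition cm_class :: "('b, 'k::field_char_0) comod \<Rightarrow> (path \<Rightarrow>\<^sub>0 int)"
  where "cm_class M = seg_class (SOME ps. cm_iso (segments ps) M)"

lemma seg_class_snoc: "seg_class (ps @ [p]) = seg_class ps + frag_of p"
  by (simp add: seg_class_def nth_append)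

lemma has_rank_segments:
  assumes M: "precomodule M" and iso: "cm_iso (segments ps) M"
  shows "has_rank (fst M) (cmat M x) (rank_of (seg_class ps) x :: 'k::field_char_0)"
proof -
  have "has_rank (seg_labels ps) (seg_mat ps x) (rank_of (seg_class ps) x :: 'k)"
    using has_rank_seg_mat[of ps x, where 'k = 'k] by (simp add: seg_class_def rank_of_sum rank_of_frag_of)
  then show ?thesis
    using M by (intro has_rank_rep_iso[OF iso]) (auto simp: precomodule_def msupp_cmat msupp_seg_mat)
qed

lemma cm_class_rank:
  fixes M :: "('b, 'k::field_char_0) comod"
  assumes "fd_comodule M"
  shows "has_rank (fst M) (cmat M x) (rank_of (cm_class M) x)"
proof -
  obtain ps where "cm_iso (segments ps) M" by (rule comodule_decomposition[OF assms])
  then have "cm_iso (segments (SOME ps. cm_iso (segments ps) M)) M" by (rule someI)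
  with assms show ?thesis unfolding cm_class_def by (intro has_rank_segments) (auto simp: fd_comodule_iff)
qed

text \<open>Uniqueness of ranks, and of multiplicities given the ranks, replaces Krull-Schmidt: to
  identify a class it suffices to exhibit ranks.\<close>

lemma cm_class_eqI:
  fixes M :: "('b, 'k::field_char_0) comod"
  assumes "fd_comodule M" "\<And>x. has_rank (fst M) (cmat M x) (rank_of u x)"
  shows "cm_class M = u"
  by (rule rank_of_inject[where 'k = 'k]) (rule has_rank_unique[OF cm_class_rank[OF assms(1)] assms(2)])

lemma cm_class_segments:
  assumes "fd_comodule M" "cm_iso (segments ps) M"
  shows "cm_class M = seg_class ps"
  using assms by (intro cm_class_eqI) (auto intro: has_rank_segments simp: fd_comodule_iff)

lemma cm_class_iso:
  assumes "fd_comodule M" "fd_comodule N" "cm_iso M N"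
  shows "cm_class M = cm_class N"
proof -
  have pre: "precomodule M" "precomodule N" using assms by (auto simp: fd_comodule_iff)
  obtain ps where ps: "cm_iso (segments ps) M" by (rule comodule_decomposition[OF assms(1)])
  then have "cm_iso (segments ps) N" using cm_iso_trans[OF pre(1)] assms(3) by blast
  then show ?thesis using ps assms cm_class_segments by metis
qed

section \<open>The multiplication of classes in the basis of intervals\<close>

definition pair_class :: "'k::field_char_0 \<Rightarrow> path \<Rightarrow> path \<Rightarrow> (path \<Rightarrow>\<^sub>0 int)"
  where "pair_class q p r = cm_class (comodule_tensor q (segments [p]) (segments [r]))"

definition class_mult :: "'k::field_char_0 \<Rightarrow> (path \<Rightarrow>\<^sub>0 int) \<Rightarrow> (path \<Rightarrow>\<^sub>0 int) \<Rightarrow> (path \<Rightarrow>\<^sub>0 int)"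
  where "class_mult q u v = frag_extend (\<lambda>p. frag_extend (pair_class q p) v) u"

text \<open>Differences appear because the induction on free abelian groups builds elements by
  subtraction; agreement at 0 is a consequence.\<close>

lemma frag_additive_eqI:
  assumes "\<And>a b. f (a - b) = f a - f b" "\<And>a b. g (a - b) = g a - g b" "\<And>p. f (frag_of p) = g (frag_of p)"
  shows "f (c :: 'a \<Rightarrow>\<^sub>0 int) = (g c :: 'b::ab_group_add)"
proof -
  have "f 0 = g 0" using assms(1)[of 0 0] assms(2)[of 0 0] by simp
  have "keys c \<subseteq> UNIV" by simp
  then show ?thesis
    by (induction c rule: frag_induction) (simp_all add: assms \<open>f 0 = g 0\<close>)
qed

lemma class_mult_frag_of: "class_mult q (frag_of p) (frag_of r) = pair_class q p r"
  by (simp add: class_mult_def)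

lemma class_mult_diff_left: "class_mult q (u - u') v = class_mult q u v - class_mult q u' v"
  by (simp add: class_mult_def frag_extend_diff)

lemma class_mult_diff_right: "class_mult q u (v - v') = class_mult q u v - class_mult q u v'"
  by (rule frag_additive_eqI[of "\<lambda>u. class_mult q u (v - v')" "\<lambda>u. class_mult q u v - class_mult q u v'"])
    (simp_all add: class_mult_diff_left, simp add: class_mult_def frag_extend_diff)

lemma class_mult_zero_left [simp]: "class_mult q 0 v = 0"
  by (simp add: class_mult_def)

lemma class_mult_zero_right [simp]: "class_mult q u 0 = 0"
  using class_mult_diff_right[of q u 0 0] by simp

lemma class_mult_add_left: "class_mult q (u + u') v = class_mult q u v + class_mult q u' v"
  by (simp add: class_mult_def frag_extend_add)

lemma class_mult_add_right: "class_mult q u (v + v') = class_mult q u v + class_mult q u v'"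
  using class_mult_diff_right[of q u "v + v'" v'] by simp

lemma class_mult_sum_left: "class_mult q (\<Sum>i\<in>I. f i) v = (\<Sum>i\<in>I. class_mult q (f i) v)"
  by (induction I rule: infinite_finite_induct) (simp_all add: class_mult_add_left)

lemma class_mult_sum_right: "class_mult q u (\<Sum>i\<in>I. f i) = (\<Sum>i\<in>I. class_mult q u (f i))"
  by (induction I rule: infinite_finite_induct) (simp_all add: class_mult_add_right)

lemma pair_class_rank:
  assumes "q \<noteq> 0"
  shows "has_rank (seg_labels [p] \<times> seg_labels [r]) (cmat (comodule_tensor q (segments [p]) (segments [r])) x)
    (rank_of (pair_class q p r) x)"
  using cm_class_rank[OF fd_tensor_segments[OF assms, of "[p]" "[r]"], of x] by (simp add: pair_class_def)

text \<open>By \<open>has_rank_tensor\<close> the ranks of a product are bilinear in the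
  multiplicities of the factors, so the class of the product depends on the classes of the factors
  alone.\<close>

theorem cm_class_tensor:
  fixes M :: "('b, 'k::field_char_0) comod" and N :: "('c, 'k) comod"
  assumes q: "q \<noteq> 0" and M: "fd_comodule M" and N: "fd_comodule N"
  shows "cm_class (comodule_tensor q M N) = class_mult q (cm_class M) (cm_class N)"
proof -
  obtain ps where ps: "cm_iso (segments ps) M" by (rule comodule_decomposition[OF M])
  obtain qs where qs: "cm_iso (segments qs) N" by (rule comodule_decomposition[OF N])
  have pre: "precomodule M" "precomodule N" using M N by (auto simp: fd_comodule_iff)
  show ?thesis
  proof (rule cm_class_eqI[OF fd_comodule_tensor[OF q M N]])
    fix x
    have "rank_of (class_mult q (cm_class M) (cm_class N)) x =
      (\<Sum>i<length ps. \<Sum>j<length qs. rank_of (pair_class q (ps ! i) (qs ! j)) x :: 'k)"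
      unfolding cm_class_segments[OF M ps] cm_class_segments[OF N qs]
      by (subst sum.swap) (simp add: seg_class_def class_mult_sum_left class_mult_sum_right class_mult_frag_of rank_of_sum)
    then show "has_rank (fst (comodule_tensor q M N)) (cmat (comodule_tensor q M N) x)
        (rank_of (class_mult q (cm_class M) (cm_class N)) x)"
      using has_rank_tensor[OF pre(1) ps pre(2) qs pair_class_rank[OF q]] by simp
  qed
qed

lemma cm_class_segments_single: "cm_class (segments [p] :: (_, 'k::field_char_0) comod) = frag_of p"
  using cm_class_segments[OF fd_segments cm_iso_refl[OF precomodule_segments], of "[p]", where 'b = 'k]
  by (simp add: seg_class_def)

text \<open>On intervals this is the equality of ranks for the two bracketings; the rest is
  trilinear extension, one argument at a time.\<close>

lemma class_mult_assoc:
  assumes q: "q \<noteq> (0 :: 'k::field_char_0)"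
  shows "class_mult q (class_mult q u v) w = class_mult q u (class_mult q v w)"
proof -
  have 1: "class_mult q (class_mult q (frag_of p) (frag_of r)) (frag_of s) =
      class_mult q (frag_of p) (class_mult q (frag_of r) (frag_of s))" for p r s
  proof -
    let ?P = "segments [p] :: (_, 'k) comod" and ?R = "segments [r] :: (_, 'k) comod" and ?S = "segments [s] :: (_, 'k) comod"
    have fd: "fd_comodule (comodule_tensor q ?P ?R)" "fd_comodule (comodule_tensor q ?R ?S)"
      by (simp_all add: fd_tensor_segments q)
    let ?A = "comodule_tensor q (comodule_tensor q ?P ?R) ?S" and ?B = "comodule_tensor q ?P (comodule_tensor q ?R ?S)"
    have A: "cm_class ?A = class_mult q (pair_class q p r) (frag_of s)"
      unfolding cm_class_tensor[OF q fd(1) fd_segments] cm_class_segments_single pair_class_def ..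
    have B: "cm_class ?B = class_mult q (frag_of p) (pair_class q r s)"
      unfolding cm_class_tensor[OF q fd_segments fd(2)] cm_class_segments_single pair_class_def ..
    have "cm_class ?B = cm_class ?A"
    proof (rule cm_class_eqI[OF fd_comodule_tensor[OF q fd_segments fd(2)]])
      fix x
      show "has_rank (fst ?B) (cmat ?B x) (rank_of (cm_class ?A) x)"
        using has_rank_tensor_assoc[OF q, of p r s x] cm_class_rank[OF fd_comodule_tensor[OF q fd(1) fd_segments], of "[s]" x]
        by simp
    qed
    then show ?thesis by (simp add: A B class_mult_frag_of)
  qed
  have 2: "class_mult q (class_mult q (frag_of p) (frag_of r)) w = class_mult q (frag_of p) (class_mult q (frag_of r) w)" for p r
    by (rule frag_additive_eqI[where c = w]) (simp_all add: class_mult_diff_right 1)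
  have 3: "class_mult q (class_mult q (frag_of p) v) w = class_mult q (frag_of p) (class_mult q v w)" for p
    by (rule frag_additive_eqI[where c = v]) (simp_all add: class_mult_diff_right class_mult_diff_left 2)
  show ?thesis
    by (rule frag_additive_eqI[where c = u]) (simp_all add: class_mult_diff_left 3)
qed

lemma pair_class_eqI:
  assumes "q \<noteq> (0 :: 'k::field_char_0)"
    and "\<And>x. has_rank ({..snd p} \<times> {..snd r}) (pair_mat q p r x) (rank_of u x)"
  shows "pair_class q p r = u"
  unfolding pair_class_def using assms
  by (intro cm_class_eqI[OF fd_tensor_segments]) (simp_all add: has_rank_pair)

lemma pair_class_point:
  assumes "q \<noteq> (0 :: 'k::field_char_0)"
  shows "pair_class q (c, 0) (i, l) = frag_of (c + i, l)" "pair_class q (i, l) (c, 0) = frag_of (c + i, l)"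
  using has_rank_pair_point_left[OF assms, of c l i] has_rank_pair_point_right[OF assms, of l c i]
  by (auto intro!: pair_class_eqI[OF assms] simp: rank_of_frag_of)

lemma pair_class_arrow:
  assumes q: "q \<noteq> (0 :: 'k::field_char_0)" and m: "m \<ge> 1"
  shows "pair_class q (0, Suc 0) (0, m) = (if q_int q (Suc m) = 0 then frag_of (0, m) + frag_of (1, m)
      else frag_of (0, Suc m) + frag_of (1, m - 1))"
    and "pair_class q (0, m) (0, Suc 0) = pair_class q (0, Suc 0) (0, m)"
proof -
  let ?u = "if q_int q (Suc m) = 0 then frag_of (0, m) + frag_of (1, m) else frag_of (0, Suc m) + frag_of (1, m - 1)"
  have "rank_of ?u x = arrow_rank q m x" for x
    by (auto simp: arrow_rank_def rank_of_add rank_of_frag_of)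
  then have *: "pair_class q (0, Suc 0) (0, m) = ?u" "pair_class q (0, m) (0, Suc 0) = ?u"
    using has_rank_arrow_left[OF q m] has_rank_arrow_right[OF q m]
    by (auto intro!: pair_class_eqI[OF q])
  show "pair_class q (0, Suc 0) (0, m) = ?u" "pair_class q (0, m) (0, Suc 0) = pair_class q (0, Suc 0) (0, m)"
    using * by simp_all
qed

lemma pair_class_outside:
  assumes q: "q \<noteq> (0 :: 'k::field_char_0)" and "\<not> subpath x (fst p + fst r, snd p + snd r)"
  shows "rank_of (pair_class q p r) x = (0 :: 'k)"
  by (rule has_rank_unique[OF pair_class_rank[OF q] has_rank_pair[OF has_rank_pair_outside[OF assms(2)]]])

text \<open>If \<open>s\<close> does not fit inside the bounding interval, neither do its extensions
  to the left, to the right or to both sides, so all four ranks in \<open>lookup_from_rank\<close>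
  vanish.\<close>

lemma pair_class_keys:
  assumes q: "q \<noteq> (0 :: 'k::field_char_0)" and s: "s \<in> keys (pair_class q p r)"
  shows "subpath s (fst p + fst r, snd p + snd r)"
proof (rule ccontr)
  assume s': "\<not> subpath s (fst p + fst r, snd p + snd r)"
  obtain i l where il: "s = (i, l)" by (cases s)
  have "of_int (lookup (pair_class q p r) s) = (0 :: 'k)"
    unfolding il lookup_from_rank
    by (subst (1 2 3 4) pair_class_outside[OF q]) (use s' il in \<open>auto simp: subpath_def\<close>)
  then show False using s by (simp add: in_keys_iff)
qed

text \<open>Every proper extension of the full path lies outside, so only one of the four ranks
  survives.\<close>

lemma pair_class_top:
  assumes q: "q \<noteq> (0 :: 'k::field_char_0)" and g: "gauss_binom q (snd p) (snd r) \<noteq> 0"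
  shows "lookup (pair_class q p r) (fst p + fst r, snd p + snd r) = 1"
proof -
  have "rank_of (pair_class q p r) (fst p + fst r, snd p + snd r) = (1 :: 'k)"
    by (rule has_rank_unique[OF pair_class_rank[OF q] has_rank_pair[OF has_rank_pair_top[OF q g]]])
  then have "of_int (lookup (pair_class q p r) (fst p + fst r, snd p + snd r)) = (1 :: 'k)"
    unfolding lookup_from_rank by (subst (2 3 4) pair_class_outside[OF q]) (auto simp: subpath_def)
  then show ?thesis by simp
qed

lemma class_mult_one_left:
  assumes "q \<noteq> (0 :: 'k::field_char_0)"
  shows "class_mult q (frag_of (0, 0)) u = u"
  by (rule frag_additive_eqI[where c = u])
    (auto simp: class_mult_diff_right class_mult_frag_of pair_class_point[OF assms])

section \<open>The homomorphism from \<open>\<int>[x, x\<^sup>-\<^sup>1, y, z]\<close>\<close>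

text \<open>Monomials act by iterated left multiplication, so no commutativity of
  \<open>class_mult\<close> is presupposed. As \<open>x\<close> to any integer power
  \<open>a\<close> is the class of \<open>(a, 0)\<close>, negative exponents need no separate
  treatment.\<close>

definition mono_act :: "'k::field_char_0 \<Rightarrow> nat \<Rightarrow> int \<times> nat \<times> nat \<Rightarrow> (path \<Rightarrow>\<^sub>0 int) \<Rightarrow> (path \<Rightarrow>\<^sub>0 int)"
  where "mono_act q d m u = class_mult q (frag_of (fst m, 0))
    ((class_mult q (frag_of (0, Suc 0)) ^^ fst (snd m)) ((class_mult q (frag_of (0, d)) ^^ snd (snd m)) u))"

definition laurent_class :: "'k::field_char_0 \<Rightarrow> nat \<Rightarrow> laurent_xyz \<Rightarrow> (path \<Rightarrow>\<^sub>0 int)"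
  where "laurent_class q d = frag_extend (\<lambda>m. mono_act q d m (frag_of (0, 0)))"

lemma funpow_commute:
  assumes "\<And>u. f (g u) = g (f u)"
  shows "(f ^^ n) ((g ^^ m) u) = (g ^^ m) ((f ^^ n) u)"
proof -
  have 1: "f ((g ^^ m) u) = (g ^^ m) (f u)" for u
    by (induction m) (simp_all add: assms)
  show ?thesis by (induction n) (simp_all add: 1)
qed

text \<open>By associativity two left multiplications commute once their elements do. For
  \<open>x\<close> this follows from the products with points in both orders, for \<open>y\<close>
  and \<open>z\<close> from the second part of \<open>pair_class_arrow\<close>.\<close>

lemma mono_act_add:
  assumes q: "q \<noteq> (0 :: 'k::field_char_0)" and d: "d \<ge> 1"
  shows "mono_act q d (m + m') u = mono_act q d m (mono_act q d m' u)"
proof -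
  let ?X = "\<lambda>a. class_mult q (frag_of (a, 0))"
  let ?Y = "class_mult q (frag_of (0, Suc 0))" and ?Z = "class_mult q (frag_of (0, d))"
  have comm: "class_mult q u (class_mult q v w) = class_mult q v (class_mult q u w)"
    if "class_mult q u v = class_mult q v u" for u v w
    using that by (metis class_mult_assoc[OF q])
  have XX: "?X a (?X b u) = ?X (a + b) u" for a b u
    by (simp add: class_mult_assoc[OF q, symmetric] class_mult_frag_of pair_class_point[OF q] add.commute)
  have XY: "?Y (?X a u) = ?X a (?Y u)" for a u
    by (rule comm) (simp add: class_mult_frag_of pair_class_point[OF q])
  have XZ: "?Z (?X a u) = ?X a (?Z u)" for a u
    by (rule comm) (simp add: class_mult_frag_of pair_class_point[OF q])
  have YZ: "?Z (?Y u) = ?Y (?Z u)" for u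
    by (rule comm) (use pair_class_arrow(2)[OF q d] in \<open>simp add: class_mult_frag_of\<close>)
  have XY': "(?Y ^^ n) (?X a u) = ?X a ((?Y ^^ n) u)" for n a u
    by (induction n) (simp_all add: XY)
  have XZ': "(?Z ^^ n) (?X a u) = ?X a ((?Z ^^ n) u)" for n a u
    by (induction n) (simp_all add: XZ)
  have YZ': "(?Z ^^ n) ((?Y ^^ k) u) = (?Y ^^ k) ((?Z ^^ n) u)" for n k u
    by (rule funpow_commute) (rule YZ)
  show ?thesis
    by (cases m; cases m') (simp add: mono_act_def funpow_add XY' XZ' YZ' XX)
qed

lemma mono_act_class_mult:
  assumes q: "q \<noteq> (0 :: 'k::field_char_0)"
  shows "mono_act q d m (class_mult q u v) = class_mult q (mono_act q d m u) v"
proof -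
  have "(class_mult q w ^^ n) (class_mult q u v) = class_mult q ((class_mult q w ^^ n) u) v" for n w u
    by (induction n) (simp_all add: class_mult_assoc[OF q])
  then show ?thesis by (simp add: mono_act_def class_mult_assoc[OF q])
qed

lemma laurent_class_diff: "laurent_class q d (f - g) = laurent_class q d f - laurent_class q d g"
  by (simp add: laurent_class_def frag_extend_diff)

lemma laurent_class_add: "laurent_class q d (f + g) = laurent_class q d f + laurent_class q d g"
  by (simp add: laurent_class_def frag_extend_add)

lemma laurent_class_mult:
  assumes q: "q \<noteq> (0 :: 'k::field_char_0)" and d: "d \<ge> 1"
  shows "laurent_class q d (f * g) = class_mult q (laurent_class q d f) (laurent_class q d g)"
proof -
  let ?h = "laurent_class q d" and ?e = "frag_of (0, 0) :: path \<Rightarrow>\<^sub>0 int"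
  have 1: "?h (frag_of m * frag_of m') = class_mult q (?h (frag_of m)) (?h (frag_of m'))" for m m'
  proof -
    \<comment> \<open>Writing the inner class as the unit times itself lets
      \<open>mono_act_class_mult\<close> turn a composition of actions into a product of
      classes.\<close>
    have "mono_act q d (m + m') ?e = mono_act q d m (class_mult q ?e (mono_act q d m' ?e))"
      by (simp add: mono_act_add[OF q d] class_mult_one_left[OF q])
    then show ?thesis by (simp add: mult_single laurent_class_def mono_act_class_mult[OF q])
  qed
  have 2: "?h (frag_of m * g) = class_mult q (?h (frag_of m)) (?h g)" for m
    by (rule frag_additive_eqI[where c = g]) (simp_all add: right_diff_distrib laurent_class_diff class_mult_diff_right 1)
  show ?thesis
    by (rule frag_additive_eqI[where c = f]) (simp_all add: left_diff_distrib laurent_class_diff class_mult_diff_left 2)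
qed

lemma laurent_class_vars:
  assumes q: "q \<noteq> (0 :: 'k::field_char_0)"
  shows "laurent_class q d 1 = frag_of (0, 0)" "laurent_class q d var_x = frag_of (1, 0)"
    "laurent_class q d var_y = frag_of (0, Suc 0)"
proof -
  have "laurent_class q d (frag_of (0, 0, 0)) = frag_of (0, 0)"
    by (simp add: laurent_class_def mono_act_def class_mult_one_left[OF q])
  moreover have "frag_of (0, 0, 0) = (1 :: laurent_xyz)" by (metis single_one zero_prod_def)
  ultimately show "laurent_class q d 1 = frag_of (0, 0)" by (simp only:)
  show "laurent_class q d var_x = frag_of (1, 0)" "laurent_class q d var_y = frag_of (0, Suc 0)"
    by (simp_all add: var_x_def var_y_def laurent_class_def mono_act_def class_mult_one_left[OF q]
        class_mult_frag_of pair_class_point[OF q])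
qed

text \<open>The polynomial \<open>cheb x y m\<close> is a homogenized Chebyshev polynomial of the second kind; its value
  is the class of the interval of length \<open>m < d\<close> starting at \<open>0\<close>.\<close>

definition cheb :: "'a::comm_ring_1 \<Rightarrow> 'a \<Rightarrow> nat \<Rightarrow> 'a"
  where "cheb x y m = (\<Sum>i=0..m div 2. (-1) ^ i * of_nat ((m - i) choose i) * x ^ i * y ^ (m - 2 * i))"

lemma cheb_0: "cheb x y 0 = 1" and cheb_1: "cheb x y (Suc 0) = y"
  by (simp_all add: cheb_def)

text \<open>Term by term this is Pascal's rule. The sums are first extended to a common range, where
  the additional binomial coefficients are zero.\<close>

lemma cheb_rec: "cheb x y (Suc (Suc m)) = y * cheb x y (Suc m) - x * cheb x y m"
proof -
  define t where "t = (\<lambda>m i. (-1) ^ i * of_nat ((m - i) choose i) * x ^ i * y ^ (m - 2 * i))"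
  have C: "cheb x y m = (\<Sum>i\<le>N. t m i)" if "m div 2 \<le> N" for m N
    unfolding cheb_def t_def
  proof (rule sum.mono_neutral_left)
    show "\<forall>i\<in>{..N} - {0..m div 2}. (- 1) ^ i * of_nat ((m - i) choose i) * x ^ i * y ^ (m - 2 * i) = 0"
      by (auto simp: binomial_eq_0)
  qed (use that in auto)
  have t: "t (Suc (Suc m)) (Suc j) = y * t (Suc m) (Suc j) - x * t m j" if "j \<le> m" for j
  proof -
    have "(Suc (Suc m) - Suc j) choose Suc j = ((m - j) choose j) + ((m - j) choose Suc j)"
      using that by (simp add: Suc_diff_le)
    \<comment> \<open>A factor \<open>y\<close> can be pulled out as long as
      \<open>2 * j < m\<close>; otherwise the exponents truncate, but the binomial coefficient is
      zero.\<close>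
    moreover have "of_nat ((m - j) choose Suc j) * y ^ (m - 2 * j) = y * (of_nat ((m - j) choose Suc j) * y ^ (Suc m - 2 * Suc j))"
    proof (cases "Suc (2 * j) \<le> m")
      case True
      then have "m - 2 * j = Suc (Suc m - 2 * Suc j)" by simp
      then show ?thesis by (simp add: mult_ac)
    next
      case False
      then show ?thesis by (simp add: binomial_eq_0)
    qed
    ultimately show ?thesis by (simp add: t_def algebra_simps)
  qed
  have "cheb x y (Suc (Suc m)) = t (Suc (Suc m)) 0 + (\<Sum>j\<le>m. t (Suc (Suc m)) (Suc j))"
    by (subst C[of _ "Suc m"]) (simp_all add: sum.atMost_Suc_shift del: sum.atMost_Suc)
  also have "\<dots> = y * t (Suc m) 0 + (\<Sum>j\<le>m. y * t (Suc m) (Suc j)) - (\<Sum>j\<le>m. x * t m j)"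
    by (simp add: t sum_subtractf) (simp add: t_def)
  also have "\<dots> = y * (\<Sum>i\<le>Suc m. t (Suc m) i) - x * (\<Sum>j\<le>m. t m j)"
    by (simp add: sum.atMost_Suc_shift sum_distrib_left distrib_left del: sum.atMost_Suc)
  also have "\<dots> = y * cheb x y (Suc m) - x * cheb x y m"
    by (simp add: C[of "Suc m" "Suc m"] C[of m m] del: sum.atMost_Suc)
  finally show ?thesis .
qed

lemma green_relation_cheb: "green_relation d = (var_y - var_x - 1) * cheb var_x var_y (d - 1)"
  by (simp add: green_relation_def cheb_def)

locale root_of_unity =
  fixes q :: "'k::field_char_0" and d :: nat
  assumes d: "d \<ge> 2" and qd: "q ^ d = 1" and prim: "\<And>m. 0 < m \<Longrightarrow> m < d \<Longrightarrow> q ^ m \<noteq> 1"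
begin

lemma q0: "q \<noteq> 0"
  using qd d by (auto simp: power_0_left)

lemma d1: "d \<ge> 1"
  using d by simp

lemma q_int_0_iff: "q_int q n = 0 \<longleftrightarrow> d dvd n"
  by (rule q_int_eq_0_iff[OF qd _ d]) (rule prim)

text \<open>Below length \<open>d\<close> the relevant q-integers do not vanish, and the generic
  rule for products with \<open>y\<close> is the recurrence of \<open>cheb\<close>.\<close>

lemma laurent_class_cheb:
  "m < d \<Longrightarrow> laurent_class q d (cheb var_x var_y m) = frag_of (0, m)"
proof (induction m rule: less_induct)
  case (less m)
  consider "m = 0" | "m = Suc 0" | k where "m = Suc (Suc k)" by (metis not0_implies_Suc)
  then show ?case
  proof cases
    case 3
    have "\<not> d dvd Suc (Suc k)" using less.prems 3 by (auto dest: dvd_imp_le)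
    then have "q_int q (Suc (Suc k)) \<noteq> 0" using q_int_0_iff by blast
    then show ?thesis
      using less.IH[of k] less.IH[of "Suc k"] less.prems
      by (simp add: 3 cheb_rec laurent_class_diff laurent_class_mult[OF q0 d1] laurent_class_vars[OF q0]
          class_mult_frag_of pair_class_point[OF q0] pair_class_arrow(1)[OF q0])
  qed (simp_all add: cheb_0 cheb_1 laurent_class_vars[OF q0])
qed

text \<open>At length \<open>d - 1\<close> the q-integer of \<open>d\<close> vanishes, and the
  product of \<open>y\<close> with the interval \<open>(0, d - 1)\<close> is that interval plus its
  shift by \<open>x\<close>.\<close>

lemma laurent_class_relation: "laurent_class q d (green_relation d) = 0"
proof -
  have "q_int q (Suc (d - 1)) = 0" using q_int_0_iff[of d] d by simp
  moreover have "laurent_class q d (cheb var_x var_y (d - 1)) = frag_of (0, d - 1)"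
    using d by (intro laurent_class_cheb) simp
  ultimately show ?thesis
    using d by (simp add: green_relation_cheb laurent_class_mult[OF q0 d1] laurent_class_diff
        laurent_class_vars[OF q0] class_mult_diff_left class_mult_frag_of pair_class_point[OF q0] pair_class_arrow(1)[OF q0])
qed

section \<open>Leading intervals of monomials and surjectivity\<close>

definition shorter :: "nat \<Rightarrow> (path \<Rightarrow>\<^sub>0 int) set"
  where "shorter n = {u. \<forall>p\<in>keys u. snd p < n}"

text \<open>The coefficient of \<open>p\<close> is then exactly 1, so the passage from monomials to
  intervals is unitriangular and can be inverted over the integers.\<close>

definition leads :: "(path \<Rightarrow>\<^sub>0 int) \<Rightarrow> path \<Rightarrow> bool"
  where "leads u p \<longleftrightarrow> u - frag_of p \<in> shorter (snd p)"

lemma shorter_add: "u \<in> shorter n \<Longrightarrow> v \<in> shorter n \<Longrightarrow> u + v \<in> shorter n"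
  unfolding shorter_def using Poly_Mapping.keys_add[of u v] by auto

lemma class_mult_shorter:
  assumes "u \<in> shorter n" shows "class_mult q (frag_of p) u \<in> shorter (snd p + n)"
proof -
  have "keys (class_mult q (frag_of p) u) \<subseteq> (\<Union>r\<in>keys u. keys (pair_class q p r))"
    unfolding class_mult_def frag_extend_of by (rule keys_frag_extend)
  moreover have "snd s < snd p + n" if "r \<in> keys u" "s \<in> keys (pair_class q p r)" for r s
    using assms that(1) pair_class_keys[OF q0 that(2)] unfolding shorter_def subpath_def by force
  ultimately show ?thesis unfolding shorter_def by blast
qed

text \<open>All intervals in the product of \<open>p\<close> and \<open>r\<close> lie inside the
  full one. Only the full one has the full length, and a nonzero Gaussian binomial gives it
  multiplicity 1.\<close>

lemma leads_mult:
  assumes u: "leads u r" and g: "gauss_binom q (snd p) (snd r) \<noteq> 0"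
  shows "leads (class_mult q (frag_of p) u) (fst p + fst r, snd p + snd r)"
proof -
  let ?t = "(fst p + fst r, snd p + snd r)"
  have "pair_class q p r - frag_of ?t \<in> shorter (snd p + snd r)"
    unfolding shorter_def
  proof (intro CollectI ballI)
    fix s assume s: "s \<in> keys (pair_class q p r - frag_of ?t)"
    have "s \<noteq> ?t" using s pair_class_top[OF q0 g] by (auto simp: in_keys_iff lookup_minus)
    then have "s \<in> keys (pair_class q p r)" using s by (auto simp: in_keys_iff lookup_minus)
    then have "subpath s ?t" by (rule pair_class_keys[OF q0])
    then show "snd s < snd p + snd r" using \<open>s \<noteq> ?t\<close> by (cases s) (auto simp: subpath_def)
  qed
  moreover have "class_mult q (frag_of p) (u - frag_of r) \<in> shorter (snd p + snd r)"
    using u unfolding leads_def by (rule class_mult_shorter)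
  ultimately have "(pair_class q p r - frag_of ?t) + class_mult q (frag_of p) (u - frag_of r) \<in> shorter (snd p + snd r)"
    by (rule shorter_add)
  moreover have "(pair_class q p r - frag_of ?t) + class_mult q (frag_of p) (u - frag_of r) =
      class_mult q (frag_of p) u - frag_of ?t"
    by (simp add: class_mult_diff_right class_mult_frag_of)
  ultimately show ?thesis unfolding leads_def by simp
qed

text \<open>The powers of \<open>z\<close> act first and reach length \<open>d * c\<close>. Each
  factor \<open>y\<close> then adds 1; going on from length \<open>b + d * c\<close> fails only if
  \<open>d\<close> divides \<open>b + d * c + 1\<close>, which does not happen while
  \<open>b + 1 < d\<close>.\<close>

lemma leads_mono:
  assumes "b < d"
  shows "leads (mono_act q d (a, b, c) (frag_of (0, 0))) (a, b + d * c)"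
proof -
  let ?Z = "(class_mult q (frag_of (0, d)) ^^ c) (frag_of (0, 0))"
  have "leads ?Z (0, d * c)"
  proof (induction c)
    case 0
    show ?case by (simp add: leads_def shorter_def)
  next
    case (Suc c)
    have "gauss_binom q d (d * c) = of_nat (c + 1)"
      unfolding Suc_eq_plus1[symmetric] by (rule gauss_binom_root_of_unity[OF qd _ d]) (rule prim)
    then have "gauss_binom q d (d * c) \<noteq> 0" by (simp only: of_nat_eq_0_iff)
    then show ?case using leads_mult[OF Suc, of "(0, d)"] by simp
  qed
  then have "b < d \<Longrightarrow> leads ((class_mult q (frag_of (0, Suc 0)) ^^ b) ?Z) (0, b + d * c)"
  proof (induction b)
    case (Suc b)
    have "\<not> d dvd Suc (b + d * c)"
    proof
      assume "d dvd Suc (b + d * c)"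
      then have "d dvd Suc b" by (metis add_Suc dvd_add_left_iff dvd_triv_left)
      then show False using Suc.prems by (auto dest: dvd_imp_le)
    qed
    then have "gauss_binom q (Suc 0) (b + d * c) \<noteq> 0"
      using gauss_binom_1_left[of q "b + d * c"] q_int_0_iff[of "Suc (b + d * c)"] by (simp add: q_int_def)
    then show ?case using leads_mult[OF Suc.IH, of "(0, Suc 0)"] Suc.prems by simp
  qed simp
  then have "leads (class_mult q (frag_of (a, 0)) ((class_mult q (frag_of (0, Suc 0)) ^^ b) ?Z)) (a, b + d * c)"
    using leads_mult[of _ "(0, b + d * c)" "(a, 0)"] assms by simp
  then show ?thesis by (simp add: mono_act_def)
qed

lemma laurent_class_surj: "\<exists>f. laurent_class q d f = u"
proof -
  have 1: "\<exists>f. laurent_class q d f = v" if v: "keys v \<subseteq> S" and S: "\<And>p. p \<in> S \<Longrightarrow> \<exists>f. laurent_class q d f = frag_of p" for v S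
    using v
  proof (induction v rule: frag_induction)
    case zero
    have "laurent_class q d 0 = 0" by (simp add: laurent_class_def)
    then show ?case ..
  next
    case (one p)
    then show ?case by (rule S)
  next
    case (diff v w)
    then show ?case by (metis laurent_class_diff)
  qed
  have 2: "\<exists>f. laurent_class q d f = frag_of (i, l)" for i l
  proof (induction l arbitrary: i rule: less_induct)
    case (less l)
    \<comment> \<open>The exponents are forced by the length: \<open>b < d\<close> and
      \<open>b + d * c = l\<close>.\<close>
    let ?m = "(i, l mod d, l div d)"
    let ?v = "laurent_class q d (frag_of ?m) - frag_of (i, l)"
    have "leads (laurent_class q d (frag_of ?m)) (i, l)"
      using leads_mono[of "l mod d" i "l div d"] d by (simp add: laurent_class_def)
    then have "keys ?v \<subseteq> {p. snd p < l}" by (auto simp: leads_def shorter_def)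
    moreover have "\<exists>f. laurent_class q d f = frag_of p" if "p \<in> {p. snd p < l}" for p
      using less.IH[of "snd p" "fst p"] that by simp
    ultimately obtain g where "laurent_class q d g = ?v" using 1 by blast
    then have "laurent_class q d (frag_of ?m - g) = frag_of (i, l)" by (simp add: laurent_class_diff)
    then show ?case ..
  qed
  show ?thesis by (rule 1[of u UNIV]) (use 2 in auto)
qed

section \<open>Division by the relation and injectivity\<close>

definition ydeg_less :: "nat \<Rightarrow> laurent_xyz set"
  where "ydeg_less n = {f. \<forall>m\<in>keys f. fst (snd m) < n}"

lemma ydeg_less_diff: "f \<in> ydeg_less n \<Longrightarrow> g \<in> ydeg_less n \<Longrightarrow> f - g \<in> ydeg_less n"
  unfolding ydeg_less_def using keys_diff[of f g] by auto

lemma ydeg_less_add: "f \<in> ydeg_less n \<Longrightarrow> g \<in> ydeg_less n \<Longrightarrow> f + g \<in> ydeg_less n"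
  unfolding ydeg_less_def using Poly_Mapping.keys_add[of f g] by auto

lemma ydeg_less_frag_mult:
  assumes "f \<in> ydeg_less n" shows "frag_of m * f \<in> ydeg_less (fst (snd m) + n)"
  unfolding ydeg_less_def
proof (intro CollectI ballI)
  fix k assume "k \<in> keys (frag_of m * f)"
  then obtain m' where "m' \<in> keys f" "k = m + m'"
    using keys_mult[of "frag_of m" f] by auto
  then show "fst (snd k) < fst (snd m) + n" using assms by (auto simp: ydeg_less_def)
qed

lemma ydeg_less_mono: "f \<in> ydeg_less n \<Longrightarrow> n \<le> n' \<Longrightarrow> f \<in> ydeg_less n'"
  by (auto simp: ydeg_less_def)

lemma var_y_power: "var_y ^ n = frag_of (0, n, 0)"
proof (induction n)
  case 0
  show ?case by (metis power_0 single_one zero_prod_def)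
qed (simp add: var_y_def mult_single)

lemma ydeg_less_var_x: "f \<in> ydeg_less n \<Longrightarrow> var_x * f \<in> ydeg_less n"
  using ydeg_less_frag_mult[of f n "(1, 0, 0)"] by (simp add: var_x_def)

lemma ydeg_less_var_y: "f \<in> ydeg_less n \<Longrightarrow> var_y * f \<in> ydeg_less (Suc n)"
  using ydeg_less_frag_mult[of f n "(0, 1, 0)"] by (simp add: var_y_def)

lemma ydeg_less_cancel: "f - g \<in> ydeg_less n \<Longrightarrow> g \<in> ydeg_less n \<Longrightarrow> f \<in> ydeg_less n"
  using ydeg_less_add[of "f - g" n g] by simp

text \<open>The strict degree bound makes \<open>ydeg_less 0\<close> contain only zero, so the case
  \<open>m = 0\<close> fits the same statement.\<close>

lemma cheb_monic: "cheb var_x var_y m - var_y ^ m \<in> ydeg_less m"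
proof (induction m rule: less_induct)
  case (less m)
  consider "m = 0" | "m = Suc 0" | k where "m = Suc (Suc k)" by (metis not0_implies_Suc)
  then show ?case
  proof cases
    case 3
    have "var_y ^ k \<in> ydeg_less (Suc k)" by (simp add: var_y_power ydeg_less_def)
    moreover have "cheb var_x var_y k - var_y ^ k \<in> ydeg_less (Suc k)"
      by (rule ydeg_less_mono[OF less.IH]) (simp_all add: 3)
    ultimately have "cheb var_x var_y k \<in> ydeg_less (Suc k)" by (rule ydeg_less_cancel[rotated])
    then have "cheb var_x var_y k \<in> ydeg_less (Suc (Suc k))" by (rule ydeg_less_mono) simp
    then have "var_x * cheb var_x var_y k \<in> ydeg_less (Suc (Suc k))" by (rule ydeg_less_var_x)
    moreover have "var_y * (cheb var_x var_y (Suc k) - var_y ^ Suc k) \<in> ydeg_less (Suc (Suc k))"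
      by (rule ydeg_less_var_y[OF less.IH]) (simp add: 3)
    ultimately have "var_y * (cheb var_x var_y (Suc k) - var_y ^ Suc k) - var_x * cheb var_x var_y k \<in> ydeg_less m"
      unfolding 3 by (intro ydeg_less_diff)
    moreover have "var_y * (cheb var_x var_y (Suc k) - var_y ^ Suc k) - var_x * cheb var_x var_y k =
        cheb var_x var_y m - var_y ^ m"
      by (simp add: 3 cheb_rec right_diff_distrib)
    ultimately show ?thesis by simp
  qed (simp_all add: cheb_0 cheb_1 ydeg_less_def)
qed

lemma green_relation_monic: "green_relation d - var_y ^ d \<in> ydeg_less d"
proof -
  let ?W = "cheb var_x var_y (d - 1)"
  have "var_y ^ (d - 1) \<in> ydeg_less d" using d by (simp add: var_y_power ydeg_less_def)
  moreover have "?W - var_y ^ (d - 1) \<in> ydeg_less d"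
    by (rule ydeg_less_mono[OF cheb_monic]) simp
  ultimately have W: "?W \<in> ydeg_less d" by (rule ydeg_less_cancel[rotated])
  have "var_y * (?W - var_y ^ (d - 1)) \<in> ydeg_less d"
    using ydeg_less_var_y[OF cheb_monic[of "d - 1"]] d by simp
  then have "var_y * (?W - var_y ^ (d - 1)) - var_x * ?W - ?W \<in> ydeg_less d"
    using W ydeg_less_var_x[OF W] by (intro ydeg_less_diff)
  moreover have "var_y ^ d = var_y * var_y ^ (d - 1)" using d by (cases d) simp_all
  then have "var_y * (?W - var_y ^ (d - 1)) - var_x * ?W - ?W = green_relation d - var_y ^ d"
    by (simp add: green_relation_cheb right_diff_distrib left_diff_distrib)
  ultimately show ?thesis by simp
qed

text \<open>The coefficient of \<open>y ^ d\<close> in the relation is 1, so division in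
  \<open>y\<close> needs no denominators although the other variables and the integers serve as
  coefficients.\<close>

lemma laurent_division: "\<exists>h g. f = h * green_relation d + g \<and> g \<in> ydeg_less d"
proof -
  define P where "P = (\<lambda>f. \<exists>h g. f = h * green_relation d + g \<and> g \<in> ydeg_less d)"
  have Pdiff: "P (f - f')" if "P f" "P f'" for f f'
  proof -
    obtain h g h' g' where "f = h * green_relation d + g" "g \<in> ydeg_less d"
      "f' = h' * green_relation d + g'" "g' \<in> ydeg_less d" using \<open>P f\<close> \<open>P f'\<close> unfolding P_def by blast
    then have "f - f' = (h - h') * green_relation d + (g - g')" "g - g' \<in> ydeg_less d"
      by (simp_all add: algebra_simps ydeg_less_diff)
    then show ?thesis unfolding P_def by blast
  qed
  have Pspan: "P f" if f: "keys f \<subseteq> S" and S: "\<And>m. m \<in> S \<Longrightarrow> P (frag_of m)" for f S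
    using f
  proof (induction f rule: frag_induction)
    case zero
    have "0 = 0 * green_relation d + 0" "0 \<in> ydeg_less d" by (simp_all add: ydeg_less_def)
    then show ?case unfolding P_def by blast
  qed (use S Pdiff in auto)
  have Pmono: "P (frag_of (a, b, c))" for a b c
  proof (induction b arbitrary: a c rule: less_induct)
    case (less b)
    show ?case
    proof (cases "b < d")
      case True
      then have "frag_of (a, b, c) = 0 * green_relation d + frag_of (a, b, c)" "frag_of (a, b, c) \<in> ydeg_less d"
        by (simp_all add: ydeg_less_def)
      then show ?thesis unfolding P_def by blast
    next
      case False
      let ?m = "(a, b - d, c)"
      let ?R = "green_relation d - var_y ^ d"
      have "frag_of (a, b, c) = frag_of ?m * var_y ^ d"
        using False by (simp add: var_y_power mult_single)
      \<comment> \<open>The power \<open>y ^ d\<close> is traded for the relation minus its tail,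
        which has smaller degree in \<open>y\<close>.\<close>
      then have eq: "frag_of (a, b, c) = frag_of ?m * green_relation d - frag_of ?m * ?R"
        by (simp add: algebra_simps)
      have "frag_of ?m * ?R \<in> ydeg_less b"
        using ydeg_less_frag_mult[OF green_relation_monic, of ?m] False by simp
      then have "keys (frag_of ?m * ?R) \<subseteq> {m. fst (snd m) < b}" by (auto simp: ydeg_less_def)
      then have "P (frag_of ?m * ?R)"
        by (rule Pspan) (use less.IH in auto)
      moreover have "P (frag_of ?m * green_relation d)"
      proof -
        have "frag_of ?m * green_relation d = frag_of ?m * green_relation d + 0" "0 \<in> ydeg_less d"
          by (simp_all add: ydeg_less_def)
        then show ?thesis unfolding P_def by blast
      qed
      ultimately show ?thesis unfolding eq using Pdiff by blast
    qed
  qed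
  have "P f" by (rule Pspan[of f UNIV]) (use Pmono in auto)
  then show ?thesis unfolding P_def .
qed

text \<open>Take a monomial of \<open>f\<close> whose leading interval is longest. Distinct reduced
  monomials have distinct leading intervals, since remainder and quotient of the length modulo
  \<open>d\<close> recover the exponents of \<open>y\<close> and \<open>z\<close>. Hence no other
  monomial contributes to this interval, and its coefficient in the image is that of the
  monomial.\<close>

lemma laurent_class_inj_reduced:
  assumes f: "f \<in> ydeg_less d" and 0: "laurent_class q d f = 0"
  shows "f = 0"
proof (rule ccontr)
  assume nz: "f \<noteq> 0"
  \<comment> \<open>The length of the leading interval of a monomial, by
    \<open>leads_mono\<close>.\<close>
  define len where "len = (\<lambda>m :: int \<times> nat \<times> nat. fst (snd m) + d * snd (snd m))"
  have "finite (len ` keys f)" "len ` keys f \<noteq> {}" using nz by auto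
  then have "Max (len ` keys f) \<in> len ` keys f" by (rule Max_in)
  then obtain m where m: "m \<in> keys f" "len m = Max (len ` keys f)" by auto
  have max: "len m' \<le> len m" if "m' \<in> keys f" for m'
    unfolding m(2) using that by (intro Max_ge) auto
  let ?p = "(fst m, len m)"
  have lead: "lookup (mono_act q d m' (frag_of (0, 0))) ?p = (if m' = m then 1 else 0)"
    if m': "m' \<in> keys f" for m'
  proof -
    let ?u = "mono_act q d m' (frag_of (0, 0))"
    have "leads ?u (fst m', len m')"
      using leads_mono[of "fst (snd m')" "fst m'" "snd (snd m')"] f m' by (simp add: ydeg_less_def len_def)
    then have "?p \<notin> keys (?u - frag_of (fst m', len m'))"
      using max[OF m'] by (auto simp: leads_def shorter_def)
    then have "lookup ?u ?p = (if ?p = (fst m', len m') then 1 else 0)"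
      by (auto simp: in_keys_iff lookup_minus)
    moreover have "?p = (fst m', len m') \<longleftrightarrow> m' = m"
    proof
      assume eq: "?p = (fst m', len m')"
      have b: "fst (snd m) < d" "fst (snd m') < d" using f m m' by (auto simp: ydeg_less_def)
      have "len m mod d = fst (snd m)" "len m' mod d = fst (snd m')" "len m div d = snd (snd m)" "len m' div d = snd (snd m')"
        using b by (simp_all add: len_def)
      then show "m' = m" using eq by (metis prod.inject prod.collapse)
    qed auto
    ultimately show ?thesis by simp
  qed
  have "0 = lookup (laurent_class q d f) ?p" by (simp add: 0)
  also have "\<dots> = (\<Sum>m'\<in>keys f. lookup f m' * lookup (mono_act q d m' (frag_of (0, 0))) ?p)"
    by (simp add: laurent_class_def frag_extend_def lookup_sum)
  also have "\<dots> = (\<Sum>m'\<in>keys f. if m' = m then lookup f m else 0)"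
    by (rule sum.cong) (auto simp: lead)
  also have "\<dots> = lookup f m" using m by simp
  finally show False using m by (simp add: in_keys_iff)
qed

lemma laurent_class_eq_0_iff: "laurent_class q d f = 0 \<longleftrightarrow> (\<exists>h. f = h * green_relation d)"
proof
  assume f: "laurent_class q d f = 0"
  obtain h g where fg: "f = h * green_relation d + g" "g \<in> ydeg_less d" using laurent_division by blast
  have "laurent_class q d g = 0"
    using f by (simp add: fg(1) laurent_class_add laurent_class_mult[OF q0 d1] laurent_class_relation)
  then have "g = 0" by (rule laurent_class_inj_reduced[OF fg(2)])
  then show "\<exists>h. f = h * green_relation d" using fg(1) by auto
next
  assume "\<exists>h. f = h * green_relation d"
  then show "laurent_class q d f = 0"
    by (auto simp: laurent_class_mult[OF q0 d1] laurent_class_relation)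
qed

end

section \<open>The Green ring\<close>

subsection \<open>Direct sums\<close>

definition bsum :: "('a \<Rightarrow> 'b \<Rightarrow> 'k::comm_ring_1) \<Rightarrow> ('c \<Rightarrow> 'd \<Rightarrow> 'k) \<Rightarrow> 'a + 'c \<Rightarrow> 'b + 'd \<Rightarrow> 'k"
  where "bsum P Q s t = (case s of
      Inl a \<Rightarrow> (case t of Inl b \<Rightarrow> P a b | Inr _ \<Rightarrow> 0)
    | Inr c \<Rightarrow> (case t of Inl _ \<Rightarrow> 0 | Inr d \<Rightarrow> Q c d))"

lemma mmult_bsum:
  assumes "finite B" "finite C"
  shows "mmult (B <+> C) (bsum P Q) (bsum P' Q') = bsum (mmult B P P') (mmult C Q Q')"
proof (intro ext)
  fix s t
  show "mmult (B <+> C) (bsum P Q) (bsum P' Q') s t = bsum (mmult B P P') (mmult C Q Q') s t"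
    unfolding mmult_def using assms by (cases s; cases t) (simp_all add: sum.Plus bsum_def)
qed

lemma bsum_idmat: "bsum (idmat B) (idmat C) = idmat (B <+> C)"
  by (intro ext) (auto simp: bsum_def idmat_def split: sum.split)

lemma msupp_bsum:
  assumes "msupp A B P" "msupp C D Q" shows "msupp (A <+> C) (B <+> D) (bsum P Q)"
proof (rule msuppI)
  fix s t assume "bsum P Q s t \<noteq> 0"
  then show "s \<in> A <+> C \<and> t \<in> B <+> D"
    using assms by (cases s; cases t) (auto simp: bsum_def msupp_def)
qed

lemma cmat_sum:
  assumes "precomodule M" "precomodule N"
  shows "cmat (comodule_sum M N) p = bsum (cmat M p) (cmat N p)"
proof (intro ext)
  fix s t
  show "cmat (comodule_sum M N) p s t = bsum (cmat M p) (cmat N p) s t"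
    using comodule_sum[OF assms] by (cases s; cases t) (simp_all add: bsum_def)
qed

lemma cm_iso_sum:
  assumes pre: "precomodule M" "precomodule M'" "precomodule N" "precomodule N'"
    and iso: "cm_iso M M'" "cm_iso N N'"
  shows "cm_iso (comodule_sum M N) (comodule_sum M' N')"
proof -
  have fin: "finite (fst M)" "finite (fst M')" "finite (fst N)" "finite (fst N')"
    using pre by (auto simp: precomodule_def)
  obtain F F' where F: "msupp (fst M') (fst M) F" "msupp (fst M) (fst M') F'"
      "mmult (fst M') F' F = idmat (fst M)" "mmult (fst M) F F' = idmat (fst M')"
      "\<And>p. mmult (fst M') (cmat M' p) F = mmult (fst M) F (cmat M p)"
    using iso(1) unfolding rep_iso_def by blast
  obtain H H' where H: "msupp (fst N') (fst N) H" "msupp (fst N) (fst N') H'"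
      "mmult (fst N') H' H = idmat (fst N)" "mmult (fst N) H H' = idmat (fst N')"
      "\<And>p. mmult (fst N') (cmat N' p) H = mmult (fst N) H (cmat N p)"
    using iso(2) unfolding rep_iso_def by blast
  show ?thesis
    unfolding rep_iso_def fst_comodule_sum
  proof (intro exI conjI allI)
    show "msupp (fst M' <+> fst N') (fst M <+> fst N) (bsum F H)" by (rule msupp_bsum[OF F(1) H(1)])
    show "msupp (fst M <+> fst N) (fst M' <+> fst N') (bsum F' H')" by (rule msupp_bsum[OF F(2) H(2)])
    show "mmult (fst M' <+> fst N') (bsum F' H') (bsum F H) = idmat (fst M <+> fst N)"
      by (simp only: mmult_bsum[OF fin(2,4)] F(3) H(3) bsum_idmat)
    show "mmult (fst M <+> fst N) (bsum F H) (bsum F' H') = idmat (fst M' <+> fst N')"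
      by (simp only: mmult_bsum[OF fin(1,3)] F(4) H(4) bsum_idmat)
    show "mmult (fst M' <+> fst N') (cmat (comodule_sum M' N') p) (bsum F H) =
        mmult (fst M <+> fst N) (bsum F H) (cmat (comodule_sum M N) p)" for p
      by (simp only: cmat_sum[OF pre(1,3)] cmat_sum[OF pre(2,4)] mmult_bsum[OF fin(2,4)] mmult_bsum[OF fin(1,3)] F(5) H(5))
  qed
qed

lemma cm_iso_segments_append:
  "cm_iso (segments (ps @ qs)) (comodule_sum (segments ps) (segments qs :: (_, 'k::field) comod))"
proof -
  let ?S = "comodule_sum (segments ps) (segments qs) :: (_, 'k) comod" and ?n = "length ps"
  have pre: "precomodule ?S" by (intro comodule_sum(1) precomodule_segments)
  define h where "h = (\<lambda>x :: nat \<times> nat. if fst x < ?n then Inl x else Inr (fst x - ?n, snd x) :: nat \<times> nat + nat \<times> nat)"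
  have lab: "x \<in> seg_labels (ps @ qs) \<longleftrightarrow> (if fst x < ?n then x \<in> seg_labels ps else (fst x - ?n, snd x) \<in> seg_labels qs)" for x
    by (cases x) (auto simp: seg_labels_iff nth_append)
  have lt: "fst x < ?n" if "x \<in> seg_labels ps" for x
    using that by (cases x) (auto simp: seg_labels_iff)
  show ?thesis
  proof (rule rep_iso_relabel[where h = h])
    show "bij_betw h (fst (segments (ps @ qs) :: (_, 'k) comod)) (fst ?S)"
    proof (rule bij_betw_byWitness[of _ "\<lambda>s. case s of Inl x \<Rightarrow> x | Inr x \<Rightarrow> (fst x + ?n, snd x)"])
      show "\<forall>a\<in>fst (segments (ps @ qs) :: (_, 'k) comod). (case h a of Inl x \<Rightarrow> x | Inr x \<Rightarrow> (fst x + ?n, snd x)) = a"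
        by (auto simp: h_def)
      show "\<forall>s\<in>fst ?S. h (case s of Inl x \<Rightarrow> x | Inr x \<Rightarrow> (fst x + ?n, snd x)) = s"
        by (auto simp: h_def dest: lt)
      show "h ` fst (segments (ps @ qs) :: (_, 'k) comod) \<subseteq> fst ?S"
        by (auto simp: h_def lab split: if_splits)
      show "(\<lambda>s. case s of Inl x \<Rightarrow> x | Inr x \<Rightarrow> (fst x + ?n, snd x)) ` fst ?S \<subseteq> fst (segments (ps @ qs) :: (_, 'k) comod)"
        by (auto simp: seg_labels_iff nth_append)
    qed
    show "msupp (fst (segments (ps @ qs) :: (_, 'k) comod)) (fst (segments (ps @ qs) :: (_, 'k) comod)) (cmat (segments (ps @ qs)) p :: _ \<Rightarrow> _ \<Rightarrow> 'k)"
      "msupp (fst ?S) (fst ?S) (cmat ?S p)" for p by (rule msupp_cmat)+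
    fix p a b
    assume "a \<in> fst (segments (ps @ qs) :: (_, 'k) comod)" "b \<in> fst (segments (ps @ qs) :: (_, 'k) comod)"
    then show "cmat ?S p (h a) (h b) = cmat (segments (ps @ qs)) p a b"
      unfolding cmat_sum[OF precomodule_segments precomodule_segments]
      by (auto simp: h_def bsum_def seg_mat_def lab nth_append split: if_splits)
  qed simp
qed

lemma cm_iso_sum_segments:
  assumes pre: "precomodule M" "precomodule N" and iso: "cm_iso (segments ps) M" "cm_iso (segments qs) N"
  shows "cm_iso (segments (ps @ qs)) (comodule_sum M N)"
proof -
  have "precomodule (comodule_sum (segments ps) (segments qs) :: (_, 'b) comod)"
    by (intro comodule_sum(1) precomodule_segments)
  then show ?thesis
    by (rule cm_iso_trans[OF _ cm_iso_segments_append
          cm_iso_sum[OF precomodule_segments pre(1) precomodule_segments pre(2) iso]])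
qed

lemma fd_comodule_sum:
  fixes M :: "('b, 'k::field_char_0) comod" and N :: "('c, 'k) comod"
  assumes M: "fd_comodule M" and N: "fd_comodule N"
  shows "fd_comodule (comodule_sum M N)"
    and "cm_class (comodule_sum M N) = cm_class M + cm_class N"
proof -
  obtain ps where ps: "cm_iso (segments ps) M" by (rule comodule_decomposition[OF M])
  obtain qs where qs: "cm_iso (segments qs) N" by (rule comodule_decomposition[OF N])
  have pre: "precomodule M" "precomodule N" using M N by (auto simp: fd_comodule_iff)
  have iso: "cm_iso (segments (ps @ qs)) (comodule_sum M N)" by (rule cm_iso_sum_segments[OF pre ps qs])
  show fd: "fd_comodule (comodule_sum M N)"
    by (rule fd_comodule_iso[OF fd_segments comodule_sum(1)[OF pre] iso])
  have "seg_class (ps @ qs) = seg_class ps + seg_class qs"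
    by (induction qs rule: rev_induct) (simp_all add: seg_class_snoc append_assoc[symmetric] del: append_assoc, simp add: seg_class_def)
  then show "cm_class (comodule_sum M N) = cm_class M + cm_class N"
    by (simp only: cm_class_segments[OF fd iso] cm_class_segments[OF M ps] cm_class_segments[OF N qs])
qed

subsection \<open>Isomorphism classes\<close>

type_synonym 'k iso_frag = "(nat, 'k) comod set \<Rightarrow>\<^sub>0 int"

lemma fd_precomodule: "fd_comodule M \<Longrightarrow> precomodule M"
  by (simp add: fd_comodule_iff)

lemma iso_class_iff:
  assumes "fd_comodule M" shows "N \<in> iso_class M \<longleftrightarrow> fd_comodule N \<and> cm_iso N M"
proof -
  have "comodule_iso N M \<longleftrightarrow> cm_iso N M" if "fd_comodule N"
    by (rule comodule_iso_iff[OF fd_precomodule[OF that] fd_precomodule[OF assms]])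
  then show ?thesis unfolding iso_class_def mem_Collect_eq by (rule conj_cong[OF refl])
qed

lemma iso_class_eq:
  fixes M :: "('b, 'k::field) comod" and N :: "('c, 'k) comod"
  assumes M: "fd_comodule M" and N: "fd_comodule N" and iso: "cm_iso M N"
  shows "iso_class M = iso_class N"
proof -
  note pre = fd_precomodule[OF M] fd_precomodule[OF N]
  have *: "cm_iso K M \<longleftrightarrow> cm_iso K N" for K :: "(nat, 'k) comod"
    by (rule iffI) (erule cm_iso_trans[OF pre(1) _ iso], erule cm_iso_trans[OF pre(2) _ cm_iso_sym[OF pre iso]])
  show ?thesis
  proof (rule Set.set_eqI)
    fix K :: "(nat, 'k) comod"
    show "K \<in> iso_class M \<longleftrightarrow> K \<in> iso_class N"
      by (simp only: iso_class_iff[OF M] iso_class_iff[OF N] *)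
  qed
qed

lemma iso_class_member:
  fixes M :: "('b, 'k::field) comod"
  assumes "fd_comodule M"
  obtains N where "N \<in> iso_class M" "fd_comodule N" "iso_class M = iso_class N"
proof -
  obtain N :: "(nat, 'k) comod" where N: "fd_comodule N" "cm_iso M N"
    by (rule fd_comodule_nat_copy[OF assms])
  have "cm_iso N M" by (rule cm_iso_sym[OF fd_precomodule[OF assms] fd_precomodule[OF N(1)] N(2)])
  then have "N \<in> iso_class M" using N(1) by (simp only: iso_class_iff[OF assms])
  then show ?thesis by (rule that[OF _ N(1) iso_class_eq[OF assms N]])
qed

lemma iso_class_in: "fd_comodule M \<Longrightarrow> iso_class M \<in> iso_classes"
  by (rule iso_class_member[of M], assumption) (auto simp: iso_classes_def)

definition class_value :: "(nat, 'k::field_char_0) comod set \<Rightarrow> (path \<Rightarrow>\<^sub>0 int)"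
  where "class_value C = cm_class (SOME N. N \<in> C)"

lemma class_value_iso_class:
  fixes M :: "('b, 'k::field_char_0) comod"
  assumes M: "fd_comodule M"
  shows "class_value (iso_class M) = cm_class M"
proof -
  obtain N where "N \<in> iso_class M" by (rule iso_class_member[OF M])
  then have "(SOME N. N \<in> iso_class M) \<in> iso_class M" by (rule someI)
  then show ?thesis
    unfolding class_value_def using cm_class_iso[OF _ M] iso_class_iff[OF M] by blast
qed

text \<open>Tensoring respects isomorphism, so the union over all representatives is a union of
  equal sets.\<close>

lemma class_tensor_iso_class:
  fixes M :: "(nat, 'k::field_char_0) comod" and N :: "(nat, 'k) comod"
  assumes q: "q \<noteq> 0" and M: "fd_comodule M" and N: "fd_comodule N"
  shows "class_tensor q (iso_class M) (iso_class N) = iso_class (comodule_tensor q M N)"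
proof -
  have "iso_class (comodule_tensor q M' N') = iso_class (comodule_tensor q M N)"
    if "M' \<in> iso_class M" "N' \<in> iso_class N" for M' N'
  proof -
    have *: "fd_comodule M'" "cm_iso M' M" "fd_comodule N'" "cm_iso N' N"
      using that by (auto simp: iso_class_iff[OF M] iso_class_iff[OF N])
    show ?thesis
      by (rule iso_class_eq[OF fd_comodule_tensor[OF q *(1,3)] fd_comodule_tensor[OF q M N]
            cm_iso_tensor[OF fd_precomodule[OF *(1)] fd_precomodule[OF M] fd_precomodule[OF *(3)] fd_precomodule[OF N] *(2,4)]])
  qed
  moreover have "M \<in> iso_class M" "N \<in> iso_class N"
    using M N by (simp_all add: iso_class_iff cm_iso_refl fd_precomodule)
  ultimately show ?thesis unfolding class_tensor_def by blast
qed

lemma comodule_unit: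
  "fd_comodule (comodule_unit :: (unit, 'k::field_char_0) comod)" (is "fd_comodule ?U")
  "cm_class (comodule_unit :: (unit, 'k) comod) = frag_of (0, 0)"
proof -
  have fst: "fst ?U = {()}" by (auto simp: comodule_unit_def)
  have snd: "snd ?U v = vtensor v A_unit" for v by (simp add: comodule_unit_def)
  have L: "lookup (snd ?U v) (u, x) = lookup v () * (if x = (0, 0) then 1 else 0)" for u v x
    by (simp add: snd A_unit_def lookup_basis_vec)
  have pre: "precomodule ?U"
    unfolding precomodule_def
  proof (intro conjI)
    show "linear_from (fst ?U) (snd ?U)"
      unfolding linear_from_def
    proof (intro conjI ballI allI)
      fix u v :: "unit \<Rightarrow>\<^sub>0 'k" and c :: 'k
      show "snd ?U (u + v) = snd ?U u + snd ?U v"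
        by (rule poly_mapping_eqI) (auto simp: L lookup_add distrib_right)
      show "snd ?U (vscale c v) = vscale c (snd ?U v)"
        by (rule poly_mapping_eqI) (auto simp: L)
    qed
  qed (auto simp: fst vspace_def)
  have mat: "cmat ?U p a b = (if p = (0, 0) then 1 else 0)" for p a b
    by (subst cmat_eq[OF pre]) (simp_all add: fst L lookup_basis_vec)
  have iso: "cm_iso (segments [(0, 0)]) ?U"
  proof (rule rep_iso_relabel[where h = "\<lambda>_. ()"])
    show "bij_betw (\<lambda>_. ()) (fst (segments [(0, 0)] :: (_, 'k) comod)) (fst ?U)"
      by (rule bij_betw_byWitness[of _ "\<lambda>_. (0, 0)"]) (auto simp: fst seg_labels_def)
    fix p and a b :: "nat \<times> nat"
    assume "a \<in> fst (segments [(0, 0)] :: (_, 'k) comod)" "b \<in> fst (segments [(0, 0)] :: (_, 'k) comod)"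
    then show "cmat ?U p () () = cmat (segments [(0, 0)]) p a b"
      by (cases p) (auto simp: mat seg_mat_def seg_labels_def)
  qed (auto simp: msupp_seg_mat msupp_cmat)
  show fd: "fd_comodule ?U" by (rule fd_comodule_iso[OF fd_segments pre iso])
  show "cm_class ?U = frag_of (0, 0)"
    using cm_class_segments[OF fd iso] by (simp add: seg_class_def)
qed

subsection \<open>The quotient by the split relations\<close>

definition frag_class :: "'k::field_char_0 iso_frag \<Rightarrow> (path \<Rightarrow>\<^sub>0 int)"
  where "frag_class = frag_extend class_value"

text \<open>A section of \<open>frag_class\<close>. Its image turns out to meet every coset of the
  split relations exactly once.\<close>

definition class_frag :: "(path \<Rightarrow>\<^sub>0 int) \<Rightarrow> 'k::field_char_0 iso_frag"
  where "class_frag = frag_extend (\<lambda>p. frag_of (iso_class (segments [p])))"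

abbreviation (input) iso_frags :: "'k::field_char_0 iso_frag set"
  where "iso_frags \<equiv> {c. keys c \<subseteq> iso_classes}"

lemma frag_class_iso_class:
  fixes M :: "('b, 'k::field_char_0) comod"
  shows "fd_comodule M \<Longrightarrow> frag_class (frag_of (iso_class M)) = cm_class M"
  by (simp add: frag_class_def class_value_iso_class)

lemma frag_class_diff: "frag_class (a - b) = frag_class a - frag_class b"
  by (simp add: frag_class_def frag_extend_diff)

lemma frag_class_add: "frag_class (a + b) = frag_class a + frag_class b"
  by (simp add: frag_class_def frag_extend_add)

lemma class_frag_diff: "class_frag (a - b) = class_frag a - class_frag b"
  by (simp add: class_frag_def frag_extend_diff)

lemma class_frag_add: "class_frag (a + b) = class_frag a + class_frag b"
  by (simp add: class_frag_def frag_extend_add)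

lemma class_frag_in: "class_frag u \<in> iso_frags"
  unfolding class_frag_def
  using keys_frag_extend[of "\<lambda>p. frag_of (iso_class (segments [p]))" u] by (auto simp: iso_class_in[OF fd_segments])

lemma frag_class_class_frag: "frag_class (class_frag u :: 'k::field_char_0 iso_frag) = u"
proof -
  have "frag_class (frag_of (iso_class (segments [p])) :: 'k iso_frag) = frag_of p" for p
    by (subst frag_class_iso_class[OF fd_segments]) (rule cm_class_segments_single)
  then show ?thesis
    by (intro frag_additive_eqI[where c = u and g = "\<lambda>u. u"])
      (simp_all add: class_frag_diff frag_class_diff, simp add: class_frag_def)
qed

lemma iso_frags_diff: "a \<in> iso_frags \<Longrightarrow> b \<in> iso_frags \<Longrightarrow> a - b \<in> iso_frags"
  using keys_diff[of a b] by auto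

lemma iso_frags_add: "a \<in> iso_frags \<Longrightarrow> b \<in> iso_frags \<Longrightarrow> a + b \<in> iso_frags"
  using Poly_Mapping.keys_add[of a b] by auto

lemma split_relations_subgroup:
  "subgroup (split_relations :: 'k::field_char_0 iso_frag set) (free_Abelian_group iso_classes)"
  unfolding split_relations_def
proof (rule group.generate_is_subgroup[OF group_free_Abelian_group], clarify)
  fix M N :: "(nat, 'k) comod"
  assume "fd_comodule M" "fd_comodule N"
  then show "frag_of (iso_class (comodule_sum M N)) - frag_of (iso_class M) - frag_of (iso_class N)
      \<in> carrier (free_Abelian_group iso_classes)"
    using iso_frags_diff[OF iso_frags_diff, of "frag_of (iso_class (comodule_sum M N))" "frag_of (iso_class M)" "frag_of (iso_class N)"]
    by (simp add: iso_class_in fd_comodule_sum)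
qed

lemma split_relations_keys:
  assumes "a \<in> (split_relations :: 'k::field_char_0 iso_frag set)"
  shows "keys a \<subseteq> iso_classes"
  using subsetD[OF subgroup.subset[OF split_relations_subgroup] assms] by simp

lemma split_relations_diff:
  assumes "a \<in> split_relations" "b \<in> split_relations" shows "a - b \<in> (split_relations :: 'k::field_char_0 iso_frag set)"
proof -
  have "keys b \<subseteq> iso_classes" by (rule split_relations_keys[OF assms(2)])
  then show ?thesis
    using subgroup.m_closed[OF split_relations_subgroup assms(1) subgroup.m_inv_closed[OF split_relations_subgroup assms(2)]]
    by simp
qed

lemma split_relations_zero: "0 \<in> (split_relations :: 'k::field_char_0 iso_frag set)"
  using subgroup.one_closed[OF split_relations_subgroup] by simp

text \<open>The generators involve comodules with labels in \<open>nat\<close> only; passing to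
  representatives gives the relation for arbitrary label types.\<close>

lemma split_relations_sum:
  fixes M :: "('b, 'k::field_char_0) comod" and N :: "('c, 'k) comod"
  assumes M: "fd_comodule M" and N: "fd_comodule N"
  shows "frag_of (iso_class (comodule_sum M N)) - frag_of (iso_class M) - frag_of (iso_class N) \<in> split_relations"
proof -
  obtain M' where M': "M' \<in> iso_class M" "fd_comodule M'" "iso_class M = iso_class M'" by (rule iso_class_member[OF M])
  obtain N' where N': "N' \<in> iso_class N" "fd_comodule N'" "iso_class N = iso_class N'" by (rule iso_class_member[OF N])
  have "cm_iso M' M" "cm_iso N' N" using M'(1) N'(1) iso_class_iff[OF M] iso_class_iff[OF N] by blast+
  then have "iso_class (comodule_sum M' N') = iso_class (comodule_sum M N)"
    by (intro iso_class_eq fd_comodule_sum(1) cm_iso_sum fd_precomodule M N M'(2) N'(2))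
  moreover have "frag_of (iso_class (comodule_sum M' N')) - frag_of (iso_class M') - frag_of (iso_class N') \<in> split_relations"
    unfolding split_relations_def using M' N' by (intro generate.incl) blast
  ultimately show ?thesis using M' N' by simp
qed

text \<open>Splitting off one interval at a time shows that a sum of intervals is congruent to the
  sum of their classes.\<close>

lemma segments_mod_split_relations:
  "frag_of (iso_class (segments ps)) - class_frag (seg_class ps) \<in> (split_relations :: 'k::field_char_0 iso_frag set)"
proof (induction ps rule: rev_induct)
  case Nil
  let ?S = "segments [] :: (nat \<times> nat, 'k) comod"
  \<comment> \<open>The zero comodule is its own double, so the relation for this sum puts its class
    among the relations.\<close>
  have "iso_class ?S = iso_class (comodule_sum ?S ?S)"
    using cm_iso_segments_append[of "[]" "[]"] by (intro iso_class_eq fd_comodule_sum(1) fd_segments) simp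
  then have "0 - frag_of (iso_class ?S) \<in> split_relations"
    using split_relations_sum[where M = ?S and N = ?S, OF fd_segments fd_segments] by simp
  then have "0 - (0 - frag_of (iso_class ?S)) \<in> split_relations"
    by (rule split_relations_diff[OF split_relations_zero])
  then show ?case by (simp add: seg_class_def class_frag_def)
next
  case (snoc p ps)
  let ?S = "segments ps :: (nat \<times> nat, 'k) comod" and ?P = "segments [p] :: (nat \<times> nat, 'k) comod"
  have "iso_class (segments (ps @ [p]) :: (_, 'k) comod) = iso_class (comodule_sum ?S ?P)"
    by (intro iso_class_eq fd_comodule_sum(1) fd_segments cm_iso_segments_append)
  then have "frag_of (iso_class (segments (ps @ [p]) :: (_, 'k) comod)) - frag_of (iso_class ?S) - frag_of (iso_class ?P) \<in> split_relations"
    using split_relations_sum[where M = ?S and N = ?P, OF fd_segments fd_segments] by simp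
  from split_relations_diff[OF this split_relations_diff[OF split_relations_zero snoc]]
  show ?case by (simp add: seg_class_snoc class_frag_add) (simp add: class_frag_def algebra_simps)
qed

text \<open>Relations are killed because classes are additive on direct sums. Conversely every
  \<open>a\<close> is congruent to \<open>class_frag (frag_class a)\<close>, which is zero as soon
  as \<open>frag_class a\<close> is.\<close>

lemma split_relations_iff:
  "a \<in> (split_relations :: 'k::field_char_0 iso_frag set) \<longleftrightarrow> a \<in> iso_frags \<and> frag_class a = 0"
proof (intro iffI conjI)
  assume a: "a \<in> split_relations"
  then show "a \<in> iso_frags" using split_relations_keys by blast
  show "frag_class a = 0"
    using a unfolding split_relations_def
  proof (induction rule: generate.induct)
    case one
    then show ?case by (simp add: frag_class_def)
  next
    case (incl h)
    then show ?case by (auto simp: frag_class_diff frag_class_iso_class fd_comodule_sum)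
  next
    case (inv h)
    then obtain M N :: "(nat, 'k) comod" where MN: "fd_comodule M" "fd_comodule N"
      "h = frag_of (iso_class (comodule_sum M N)) - frag_of (iso_class M) - frag_of (iso_class N)" by blast
    have "h \<in> split_relations" unfolding MN(3) by (rule split_relations_sum[OF MN(1,2)])
    then have "keys h \<subseteq> iso_classes" by (rule split_relations_keys)
    then have "inv\<^bsub>free_Abelian_group iso_classes\<^esub> h = - h" by (rule inv_free_Abelian_group)
    moreover have "frag_class h = 0" using MN by (simp add: frag_class_diff frag_class_iso_class fd_comodule_sum)
    ultimately show ?case by (simp add: frag_class_def frag_extend_minus)
  next
    case (eng h1 h2)
    then show ?case by (simp add: frag_class_add)
  qed
next
  assume a: "a \<in> iso_frags \<and> frag_class a = 0"
  then have "keys a \<subseteq> iso_classes" by simp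
  then have "a - class_frag (frag_class a) \<in> split_relations"
  proof (induction a rule: frag_induction)
    case zero
    then show ?case by (simp add: frag_class_def class_frag_def split_relations_zero)
  next
    case (one C)
    then obtain M :: "(nat, 'k) comod" where M: "fd_comodule M" "C = iso_class M" by (auto simp: iso_classes_def)
    obtain ps where ps: "cm_iso (segments ps) M" by (rule comodule_decomposition[OF M(1)])
    have "C = iso_class (segments ps :: (_, 'k) comod)"
      unfolding M(2) by (rule iso_class_eq[OF fd_segments M(1) ps, symmetric])
    moreover have "frag_class (frag_of C) = seg_class ps"
      unfolding M(2) frag_class_iso_class[OF M(1)] by (rule cm_class_segments[OF M(1) ps])
    ultimately show ?case using segments_mod_split_relations[of ps] by simp
  next
    case (diff a b)
    then have "(a - class_frag (frag_class a)) - (b - class_frag (frag_class b)) \<in> split_relations"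
      by (rule split_relations_diff)
    then show ?case by (simp add: frag_class_diff class_frag_diff algebra_simps)
  qed
  then show "a \<in> split_relations" using a by (simp add: class_frag_def)
qed

subsection \<open>The isomorphism\<close>

text \<open>The Green ring written in the basis of intervals, the meeting point of the two
  isomorphisms below.\<close>

definition class_ring :: "'k::field_char_0 \<Rightarrow> (path \<Rightarrow>\<^sub>0 int) ring"
  where "class_ring q = \<lparr>carrier = UNIV, monoid.mult = class_mult q, one = frag_of (0, 0), ring.zero = 0, add = (+)\<rparr>"

lemma ring_class_ring:
  assumes q: "q \<noteq> (0 :: 'k::field_char_0)" shows "ring (class_ring q)"
proof (rule ringI)
  show "abelian_group (class_ring q)"
  proof (rule abelian_groupI)
    fix u assume "u \<in> carrier (class_ring q)"
    show "\<exists>v\<in>carrier (class_ring q). v \<oplus>\<^bsub>class_ring q\<^esub> u = \<zero>\<^bsub>class_ring q\<^esub>"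
      by (rule bexI[of _ "- u"]) (simp_all add: class_ring_def)
  qed (simp_all add: class_ring_def algebra_simps)
  have one_right: "class_mult q u (frag_of (0, 0)) = u" for u
    by (rule frag_additive_eqI[where c = u])
      (auto simp: class_mult_diff_left class_mult_frag_of pair_class_point[OF q])
  show "monoid (class_ring q)"
    by (rule monoidI) (simp_all add: class_ring_def class_mult_assoc[OF q] class_mult_one_left[OF q] one_right)
qed (simp_all add: class_ring_def class_mult_add_left class_mult_add_right)

lemma (in root_of_unity) laurent_quotient_iso: "laurent_ring Quot green_ideal d \<simeq> class_ring q"
proof -
  have L: "cring laurent_ring" unfolding laurent_ring_def by (rule cring_from_type_algebra)
  interpret L: cring laurent_ring by (rule L)
  have "laurent_class q d \<in> ring_hom laurent_ring (class_ring q)"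
    by (rule ring_hom_memI) (simp_all add: laurent_ring_def ring_of_type_algebra_def class_ring_def
        laurent_class_mult[OF q0 d1] laurent_class_add laurent_class_vars[OF q0])
  then interpret h: ring_hom_ring laurent_ring "class_ring q" "laurent_class q d"
    by (intro ring_hom_ringI2 L.ring_axioms ring_class_ring q0)
  have "green_ideal d = a_kernel laurent_ring (class_ring q) (laurent_class q d)"
    unfolding green_ideal_def a_kernel_def'
    by (subst L.cgenideal_eq_genideal[symmetric])
      (auto simp: cgenideal_def laurent_ring_def ring_of_type_algebra_def class_ring_def laurent_class_eq_0_iff)
  moreover have "laurent_class q d ` carrier laurent_ring = carrier (class_ring q)"
    using laurent_class_surj by (auto simp: laurent_ring_def ring_of_type_algebra_def class_ring_def surj_def) metis
  ultimately show ?thesis using h.FactRing_iso by simp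
qed

text \<open>The elements of the Green ring are the fibres of \<open>frag_class\<close>.\<close>

definition class_fibre :: "(path \<Rightarrow>\<^sub>0 int) \<Rightarrow> 'k::field_char_0 iso_frag set"
  where "class_fibre u = {a \<in> iso_frags. frag_class a = u}"

lemma class_frag_in_fibre: "class_frag u \<in> class_fibre u"
  using class_frag_in[of u] by (simp add: class_fibre_def frag_class_class_frag)

text \<open>\<open>pre_green_ring\<close> is not shown to be a ring, so general facts on quotient
  rings are not invoked. The cosets are identified with the fibres of \<open>frag_class\<close>, and
  the operations are compared on representatives.\<close>

lemma class_ring_iso_green_ring:
  fixes q :: "'k::field_char_0"
  assumes q: "q \<noteq> 0"
  shows "class_ring q \<simeq> green_ring q"
proof -
  let ?R = "pre_green_ring q" and ?I = "split_relations :: 'k iso_frag set"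
  have carrier: "carrier ?R = iso_frags" by (auto simp: pre_green_ring_def)
  have coset: "?I +>\<^bsub>?R\<^esub> a = class_fibre (frag_class a)" if a: "a \<in> iso_frags" for a
  proof (intro equalityI subsetI)
    fix b :: "'k iso_frag" assume "b \<in> ?I +>\<^bsub>?R\<^esub> a"
    then obtain i where i: "i \<in> ?I" "b = i + a" by (auto simp: a_r_coset_def' pre_green_ring_def)
    then show "b \<in> class_fibre (frag_class a)"
      using a iso_frags_add[of i a] by (simp add: split_relations_iff class_fibre_def frag_class_add)
  next
    fix b :: "'k iso_frag" assume b: "b \<in> class_fibre (frag_class a)"
    then have "b - a \<in> ?I"
      using a iso_frags_diff[of b a] by (simp add: split_relations_iff class_fibre_def frag_class_diff)
    moreover have "b = (b - a) + a" by simp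
    ultimately show "b \<in> ?I +>\<^bsub>?R\<^esub> a"
      unfolding a_r_coset_def' by (force simp: pre_green_ring_def)
  qed
  have mult: "a \<otimes>\<^bsub>?R\<^esub> b \<in> iso_frags \<and> frag_class (a \<otimes>\<^bsub>?R\<^esub> b) = class_mult q (frag_class a) (frag_class b)"
    if a: "a \<in> iso_frags" and b: "b \<in> iso_frags" for a b
  proof -
    define T where "T = (\<lambda>a b :: 'k iso_frag. frag_extend (\<lambda>C. frag_extend (\<lambda>D. frag_of (class_tensor q C D)) b) a)"
    have T: "a \<otimes>\<^bsub>?R\<^esub> b = T a b" by (simp add: pre_green_ring_def T_def)
    have gen: "class_tensor q C D \<in> iso_classes \<and> class_value (class_tensor q C D) = class_mult q (class_value C) (class_value D)"
      if C: "C \<in> iso_classes" and D: "D \<in> iso_classes" for C D :: "(nat, 'k) comod set"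
    proof -
      obtain M N :: "(nat, 'k) comod" where MN: "fd_comodule M" "C = iso_class M" "fd_comodule N" "D = iso_class N"
        using C D by (auto simp: iso_classes_def)
      have "fd_comodule (comodule_tensor q M N)" by (rule fd_comodule_tensor[OF q MN(1,3)])
      then show ?thesis
        unfolding MN(2,4) class_tensor_iso_class[OF q MN(1,3)] class_value_iso_class[OF MN(1)] class_value_iso_class[OF MN(3)]
        by (simp add: iso_class_in class_value_iso_class cm_class_tensor[OF q MN(1,3)])
    qed
    have 1: "T (frag_of C) b \<in> iso_frags \<and> frag_class (T (frag_of C) b) = class_mult q (class_value C) (frag_class b)"
      if C: "C \<in> iso_classes" and b: "keys b \<subseteq> iso_classes" for C b
      using b
    proof (induction b rule: frag_induction)
      case zero
      then show ?case by (simp add: T_def frag_class_def)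
    next
      case (one D)
      then show ?case using gen[OF C, of D] by (simp add: T_def frag_class_def)
    next
      case (diff b b')
      have "T (frag_of C) (b - b') = T (frag_of C) b - T (frag_of C) b'" by (simp add: T_def frag_extend_diff)
      then show ?case using diff iso_frags_diff[of "T (frag_of C) b" "T (frag_of C) b'"]
        by (simp add: frag_class_diff class_mult_diff_right)
    qed
    have b': "keys b \<subseteq> iso_classes" and a': "keys a \<subseteq> iso_classes" using a b by auto
    show ?thesis unfolding T using a'
    proof (induction a rule: frag_induction)
      case zero
      then show ?case by (simp add: T_def frag_class_def)
    next
      case (one C)
      then show ?case using 1[OF _ b', of C] by (simp add: frag_class_def)
    next
      case (diff a a')
      have "T (a - a') b = T a b - T a' b" by (simp add: T_def frag_extend_diff)
      then show ?case using diff iso_frags_diff[of "T a b" "T a' b"]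
        by (simp add: frag_class_diff class_mult_diff_left)
    qed
  qed
  have fibre_coset: "class_fibre u = ?I +>\<^bsub>?R\<^esub> class_frag u" for u
    using coset[OF class_frag_in, of u] by (simp add: frag_class_class_frag)
  have "class_fibre \<in> ring_hom (class_ring q) (green_ring q)"
  proof (rule ring_hom_memI)
    fix u v :: "path \<Rightarrow>\<^sub>0 int"
    show "class_fibre u \<in> carrier (green_ring q)"
      unfolding green_ring_def FactRing_def A_RCOSETS_def' fibre_coset
      using class_frag_in[of u] carrier by auto
    have in_fibre: "a \<in> iso_frags" "frag_class a = w" if "a \<in> class_fibre w" for a :: "'k iso_frag" and w
      using that by (auto simp: class_fibre_def)
    have "?I +>\<^bsub>?R\<^esub> (a \<otimes>\<^bsub>?R\<^esub> b) = class_fibre (class_mult q u v)" if "a \<in> class_fibre u" "b \<in> class_fibre v" for a b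
      using coset mult[OF in_fibre(1)[OF that(1)] in_fibre(1)[OF that(2)]] in_fibre(2)[OF that(1)] in_fibre(2)[OF that(2)] by metis
    \<comment> \<open>The product of cosets is a union over representatives; all its members
      coincide, and \<open>class_frag\<close> shows that the union is not empty.\<close>
    then have "rcoset_mult ?R ?I (class_fibre u) (class_fibre v) = class_fibre (class_mult q u v)"
      unfolding rcoset_mult_def using class_frag_in_fibre by blast
    then show "class_fibre (u \<otimes>\<^bsub>class_ring q\<^esub> v) = class_fibre u \<otimes>\<^bsub>green_ring q\<^esub> class_fibre v"
      by (simp add: green_ring_def FactRing_def class_ring_def)
    have "class_fibre u <+>\<^bsub>?R\<^esub> class_fibre v = class_fibre (u + v)"
    proof (intro equalityI subsetI)
      fix c :: "'k iso_frag" assume "c \<in> class_fibre u <+>\<^bsub>?R\<^esub> class_fibre v"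
      then obtain a b where "a \<in> class_fibre u" "b \<in> class_fibre v" "c = a + b"
        by (auto simp: set_add_def' pre_green_ring_def)
      then show "c \<in> class_fibre (u + v)"
        using iso_frags_add[of a b] by (simp add: class_fibre_def frag_class_add)
    next
      fix c :: "'k iso_frag" assume c: "c \<in> class_fibre (u + v)"
      then have "c - class_frag v \<in> class_fibre u"
        using iso_frags_diff[OF _ class_frag_in, of c v] by (simp add: class_fibre_def frag_class_diff frag_class_class_frag)
      moreover have "c = (c - class_frag v) + class_frag v" by simp
      ultimately show "c \<in> class_fibre u <+>\<^bsub>?R\<^esub> class_fibre v"
        unfolding set_add_def' using class_frag_in_fibre[of v] by (force simp: pre_green_ring_def)
    qed
    then show "class_fibre (u \<oplus>\<^bsub>class_ring q\<^esub> v) = class_fibre u \<oplus>\<^bsub>green_ring q\<^esub> class_fibre v"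
      by (simp add: green_ring_def FactRing_def class_ring_def)
  next
    have "frag_of (iso_class (comodule_unit :: (unit, 'k) comod)) \<in> iso_frags"
      by (simp add: iso_class_in comodule_unit)
    from coset[OF this] show "class_fibre \<one>\<^bsub>class_ring q\<^esub> = \<one>\<^bsub>green_ring q\<^esub>"
      by (simp add: green_ring_def FactRing_def class_ring_def frag_class_iso_class comodule_unit)
        (simp add: pre_green_ring_def)
  qed
  moreover have "bij_betw class_fibre (carrier (class_ring q)) (carrier (green_ring q))"
  proof (rule bij_betwI')
    fix u v :: "path \<Rightarrow>\<^sub>0 int"
    show "(class_fibre u = (class_fibre v :: 'k iso_frag set)) = (u = v)"
    proof
      assume "class_fibre u = (class_fibre v :: 'k iso_frag set)"
      then have "class_frag u \<in> (class_fibre v :: 'k iso_frag set)"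
        using class_frag_in_fibre by blast
      then show "u = v" by (simp add: class_fibre_def frag_class_class_frag)
    qed simp
    show "class_fibre u \<in> carrier (green_ring q)"
      unfolding green_ring_def FactRing_def A_RCOSETS_def' fibre_coset
      using class_frag_in[of u] carrier by auto
  next
    fix A assume "A \<in> carrier (green_ring q)"
    then obtain a where "a \<in> iso_frags" "A = ?I +>\<^bsub>?R\<^esub> a"
      unfolding green_ring_def FactRing_def A_RCOSETS_def' using carrier by auto
    then have "A = class_fibre (frag_class a)" using coset by simp
    then show "\<exists>u\<in>carrier (class_ring q). A = class_fibre u" by (auto simp: class_ring_def)
  qed
  ultimately show ?thesis unfolding is_ring_iso_def ring_iso_def by blast
qed

theorem theorem4p14:
  fixes q :: "'k::{alg_closed_field, field_char_0}" and d :: nat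
  assumes "d \<ge> 2"
    and "q ^ d = 1" and "\<And>m. 0 < m \<Longrightarrow> m < d \<Longrightarrow> q ^ m \<noteq> 1"
  shows "green_ring q \<simeq> laurent_ring Quot green_ideal d"
proof -
  interpret root_of_unity q d by unfold_locales (use assms in auto)
  interpret L: cring laurent_ring unfolding laurent_ring_def by (rule cring_from_type_algebra)
  have "ideal (green_ideal d) laurent_ring"
    unfolding green_ideal_def by (rule L.genideal_ideal) (simp add: laurent_ring_def ring_of_type_algebra_def)
  then have "ring (laurent_ring Quot green_ideal d)" by (rule ideal.quotient_is_ring)
  \<comment> \<open>The chain starts at the Laurent quotient, which is known to be a ring, because
    reversing an isomorphism requires this of its source.\<close>
  moreover have "laurent_ring Quot green_ideal d \<simeq> green_ring q"
    by (rule ring_iso_trans[OF laurent_quotient_iso class_ring_iso_green_ring[OF q0]])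
  ultimately show ?thesis by (rule ring_iso_sym)
qed

end
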